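(* Let $F$ be a (signed) functional of excursions of $X$ as defined in the context, with characteristic measure $n_F$, and let $\mu$ be a non-atomic probability measure on $\mathbb{R}$ with $\mu(\mathbb{R}_-)>0$, $\mu(\mathbb{R}_+)>0$, such that $$x,y\in \mathrm{supp}(\mu)\ \Rightarrow\ n_F((-\infty,x])\cdot n_F([y,\infty))>0,$$ $$D_\mu(\infty)=\int_0^\infty \frac{d\mu(s)}{n_F([s,\infty))}=\int_{-\infty}^0\frac{d\mu(s)}{n_F((-\infty,s])}=G_\mu(-\infty)$$ (the common value may be infinite). Let $\psi_\pm,\varphi_\pm$ be the functions associated with $\mu$ and $n_F$ in the context. Then $$T^F_{\varphi_-,\varphi_+}=\inf\{t>0:\psi_-(-F_t)\ge L_t\text{ or }\psi_+(F_t)\ge L_t\}=\inf\{t>0:F_t\notin(-\varphi_-(L_t),\varphi_+(L_t))\}$$ is an a.s. finite stopping time and it solves the Skorokhod embedding problem for $(F_t)_{t\ge 0}$, i.e. $F_{T^F_{\varphi_-,\varphi_+}}\sim\mu$. Furthermore, $T^F=T^F_{\varphi_-,\varphi_+}$ is minimal and $$F_{T^F}=\sup_{t\le T^F}F_t\cdot\mathbf 1_{F_{T^F}\ge 0}+\inf_{t\le T^F}F_t\cdot\mathbf 1_{F_{T^F}<0}.$$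
   Context: **Markov process.** $X=(X_t)_{t\ge0}$ is a process with right-continuous paths in a Polish space $E$ with a distinguished point $0$, started at $0$, with natural filtration $(\mathcal F_t)$ (right-continuous and completed). There are probability measures $(\mathbb P_x)_{x\in E}$ such that for every stopping time $T<\infty$, under $\mathbb P(\cdot|X_T=x)$, $(X_{T+t})_{t\ge 0}$ is independent of $\mathcal F_T$ and has the law of $X$ under $\mathbb P_x$; $\mathbb P=\mathbb P_0$. The point $0$ is regular ($\mathbb P_0(\inf\{t>0:X_t=0\}=0)=1$), instantaneous ($\mathbb P_0(\inf\{t\ge0:X_t\ne0\}=0)=1$) and recurrent. Put $\mathcal Z=\{t:X_t=0\}$, $g_t=\sup\{u\le t:X_u=0\}$, $d_t=\inf\{u>t:X_u=0\}$. **Local time and excursions.** $L=(L_t)$ is the local time of $X$ at $0$ (unique up to a multiplicative constant): the support of $dL$ is a.s. contained in $\overline{\mathcal Z}$, and for any stopping time $T$ with $X_T=0$ a.s. on $\{T<\infty\}$, under $\mathbb P(\cdot|T<\infty)$ the process $(X_{T+t},L_{T+t}-L_T)_{t\ge 0}$ is independent of $\mathcal F_T$ and has the law of $(X,L)$ under $\mathbb P$. $\tau_l=\inf\{s\ge 0:L_s>l\}$ is a subordinator with infinite Lévy measure; $L_\infty=\infty$ a.s. The excursion space is $U=\{\epsilon:\mathbb R_+\to E:\ \exists V(\epsilon),\ \epsilon(s)=0\Leftrightarrow s\in\{0\}\cup[V(\epsilon),\infty)\}$, with an added isolated point $\Upsilon$. The excursion process is $e_l=(X_{\tau_{l-}+s},0\le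 s\le\tau_l-\tau_{l-})$ if $\tau_{l-}<\tau_l$ (extended by $0$), and $e_l=\Upsilon$ otherwise; it is a Poisson point process with characteristic (Itô) measure $n$ (normalised consistently with $L$). **Functionals.** A functional is $F:U\times\mathbb R_+\to\mathbb R$, written $F(\epsilon,t)=F(\epsilon)(t)$, such that for each $\epsilon$: $F(\epsilon)$ is a monotone continuous function of time, $F(\epsilon)(0)=0$, $F(\epsilon)(t)=F(\epsilon)(V(\epsilon))$ for $t\ge V(\epsilon)$; $F(\epsilon,t)$ depends only on $(\epsilon_s)_{s\le t}$; $F(\Upsilon)\equiv0$; and $|F(\epsilon,V(\epsilon))|>0$ for all $\epsilon\in U$. It induces the process $F_t=F(e_{L_t})(t-g_t)$, which is right-continuous with left limits and, when it jumps, jumps to $0$. The terminal values $(F(e_l,V(e_l)))_{l\ge0}$ form a Poisson point process whose characteristic measure, the image of $n$ under $\epsilon\mapsto F(\epsilon,V(\epsilon))$, is denoted $n_F$ and called the characteristic measure of $F$. Since the zeros of $(F_t)$ and $X$ coincide, $L$ is adapted to the natural filtration of $(F_t)$. **Functions attached to $\mu$ and $n_F$.** $\overline\mu(t)=\mu([t,\infty))$; $a_\mu,b_\mu$ are the lower and upper bounds of $\mathrm{supp}(\mu)$. For $y\ge0$, $x\le0$, $$D_\mu(y)=\int_{[0,y]}\frac{d\mu(s)}{n_F([s,\infty))},\qquad G_\mu(x)=\int_{[x,0]}\frac{d\mu(s)}{n_F((-\infty,s])}.$$ $D_\mu^{-1},G_\mu^{-1}$ are the right-continuous inverses, with $D_\mu^{-1}=\infty$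 on $[D_\mu(b_\mu),\infty)$ and $G_\mu^{-1}=-\infty$ on $[G_\mu(a_\mu),\infty)$. For $y,z\ge0$, $$\psi_+(y)=\int_0^y\frac{d\mu(s)}{n_F([s,\infty))\big(1+\overline\mu(s)-\overline\mu(G_\mu^{-1}(D_\mu(s)))\big)},$$ $$\psi_-(z)=\int_{-z}^0\frac{d\mu(s)}{n_F((-\infty,s])\big(1+\overline\mu(D_\mu^{-1}(G_\mu(s)))-\overline\mu(s)\big)},$$ and $\psi_\pm=0$ on $\mathbb R_-$. $\varphi_\pm(y)=\inf\{x\ge0:\psi_\pm(x)\ge y\}$ with $\varphi_\pm(0)=0$. **Minimality.** A stopping time $T$ is minimal for a process $(F_t)$ if for every stopping time $S$, $S\le T$ and $F_S\sim F_T$ imply $S=T$ a.s. *)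

theory Defs
  imports "HOL-Probability.Probability"
begin

section \<open>General notions\<close>

text \<open>Time is \<^typ>\<open>real\<close> restricted to nonnegative values for processes, and \<^typ>\<open>ennreal\<close>
  for stopping times and filtrations, so that the library notions \<^const>\<open>stopping_time\<close> and
  \<^const>\<open>filtration.pre_sigma\<close> apply to stopping times that may be infinite. The value of a
  process at a stopping time is taken at \<^const>\<open>enn2real\<close> of that time and only matters where
  the time is finite.\<close>

definition measure_support :: "'b::topological_space measure \<Rightarrow> 'b set" where
  "measure_support N = {x. \<forall>U. open U \<longrightarrow> x \<in> U \<longrightarrow> emeasure N U > 0}"

definition path_algebra :: "'e measure \<Rightarrow> (real \<Rightarrow> 'e) measure" where
  "path_algebra N = PiM {0..} (\<lambda>_. N)"

definition history_sets :: "'a measure \<Rightarrow> (real \<Rightarrow> 'a \<Rightarrow> 'e::topological_space) \<Rightarrow> ennreal \<Rightarrow> 'a set set" where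
  "history_sets M X t = {X s -` A \<inter> space M | s A. 0 \<le> s \<and> ennreal s \<le> t \<and> A \<in> sets borel}"

text \<open>Natural filtration, made right-continuous and completed; at \<open>t = \<infinity>\<close> the index set of the
  intersection is \<open>{\<infinity>}\<close>, for \<open>t < \<infinity>\<close> it is \<open>{t<..}\<close>. The underlying space is always complete where
  this is used.\<close>

definition usual_filtration :: "'a measure \<Rightarrow> (real \<Rightarrow> 'a \<Rightarrow> 'e::topological_space) \<Rightarrow> ennreal \<Rightarrow> 'a measure" where
  "usual_filtration M X t = sigma (space M)
     (\<Inter>u\<in>{u. t < u \<or> u = \<infinity>}. sigma_sets (space M) (history_sets M X u \<union> null_sets M))"

definition sigma_at :: "'a measure \<Rightarrow> (real \<Rightarrow> 'a \<Rightarrow> 'e::topological_space) \<Rightarrow> ('a \<Rightarrow> ennreal) \<Rightarrow> 'a measure" where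
  "sigma_at M X T = filtration.pre_sigma (space M) (usual_filtration M X) T"

lemma sigma_algebra_history:
  "sigma_algebra (space M) (sigma_sets (space M) (history_sets M X u \<union> null_sets M))"
  by (rule sigma_algebra_sigma_sets)
     (auto simp: history_sets_def dest: null_setsD2 sets.sets_into_space)

lemma sets_usual_filtration:
  "sets (usual_filtration M X t) =
     (\<Inter>u\<in>{u. t < u \<or> u = \<infinity>}. sigma_sets (space M) (history_sets M X u \<union> null_sets M))"
proof -
  let ?S = "\<lambda>u. sigma_sets (space M) (history_sets M X u \<union> null_sets M)"
  let ?I = "{u. t < u \<or> u = \<infinity>}"
  have S: "sigma_algebra (space M) (?S u)" for u
    by (rule sigma_algebra_history)
  have "sigma_algebra (space M) (\<Inter>(?S ` ?I))"
    unfolding sigma_algebra_iff2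
  proof (intro conjI ballI allI impI)
    show "\<Inter>(?S ` ?I) \<subseteq> Pow (space M)"
      using S [of \<infinity>] unfolding sigma_algebra_iff2 by blast
    show "{} \<in> \<Inter>(?S ` ?I)"
      by (simp add: sigma_sets.Empty)
    show "space M - A \<in> \<Inter>(?S ` ?I)" if "A \<in> \<Inter>(?S ` ?I)" for A
      using that by (simp add: sigma_sets.Compl)
    show "(\<Union>i::nat. A i) \<in> \<Inter>(?S ` ?I)" if "range A \<subseteq> \<Inter>(?S ` ?I)" for A
    proof (rule INT_I)
      fix u assume "u \<in> ?I"
      then have "A i \<in> ?S u" for i
        using that by blast
      then show "(\<Union>i. A i) \<in> ?S u"
        by (rule sigma_sets.Union)
    qed
  qed
  then show ?thesis
    unfolding usual_filtration_def by (rule sigma_algebra.sets_measure_of_eq)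
qed

lemma filtration_usual_filtration: "filtration (space M) (usual_filtration M X)"
proof
  show "space (usual_filtration M X t) = space M" for t
  proof -
    have "(\<Inter>u\<in>{u. t < u \<or> u = \<infinity>}. sigma_sets (space M) (history_sets M X u \<union> null_sets M))
        \<subseteq> Pow (space M)"
      using sigma_algebra_history [of M X \<infinity>] unfolding sigma_algebra_iff2 by blast
    then show ?thesis
      unfolding usual_filtration_def by (rule space_measure_of)
  qed
  show "sets (usual_filtration M X s) \<subseteq> sets (usual_filtration M X t)" if "s \<le> t" for s t
    unfolding sets_usual_filtration using that by (intro INF_superset_mono) (use le_less_trans in blast)+
qed

definition same_law :: "'a measure \<Rightarrow> ('a \<Rightarrow> real) \<Rightarrow> ('a \<Rightarrow> real) \<Rightarrow> bool" where
  "same_law M Y Z \<longleftrightarrow> Y \<in> borel_measurable M \<and> Z \<in> borel_measurable M \<and> distr M borel Y = distr M borel Z"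

definition minimal_for ::
  "'a measure \<Rightarrow> (ennreal \<Rightarrow> 'a measure) \<Rightarrow> (real \<Rightarrow> 'a \<Rightarrow> real) \<Rightarrow> ('a \<Rightarrow> ennreal) \<Rightarrow> bool" where
  "minimal_for M \<F> Y T \<longleftrightarrow>
     (\<forall>S. stopping_time \<F> S \<longrightarrow> (AE \<omega> in M. S \<omega> \<le> T \<omega>) \<longrightarrow>
          same_law M (\<lambda>\<omega>. Y (enn2real (S \<omega>)) \<omega>) (\<lambda>\<omega>. Y (enn2real (T \<omega>)) \<omega>) \<longrightarrow>
          (AE \<omega> in M. S \<omega> = T \<omega>))"

section \<open>Poisson point processes\<close>

text \<open>A point process with values in \<open>space n\<close> plus an isolated point is a family
  \<open>(e l)\<close>, \<open>l \<ge> 0\<close>, of elements of the option type, \<^const>\<open>None\<close> being the isolated point.\<close>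

definition point_count :: "(real \<Rightarrow> 'a \<Rightarrow> 'b option) \<Rightarrow> (real \<times> 'b) set \<Rightarrow> 'a \<Rightarrow> ennreal" where
  "point_count e B \<omega> = emeasure (count_space UNIV) {l. \<exists>x. e l \<omega> = Some x \<and> (l, x) \<in> B}"

text \<open>The point process has characteristic measure \<open>n\<close> if its counting measure is a Poisson
  random measure on \<open>[0,\<infinity>) \<times> space n\<close> with intensity \<open>dl \<otimes> n\<close>.\<close>

definition poisson_point_process :: "'a measure \<Rightarrow> 'b measure \<Rightarrow> (real \<Rightarrow> 'a \<Rightarrow> 'b option) \<Rightarrow> bool" where
  "poisson_point_process M n e \<longleftrightarrow>
     sigma_finite_measure n \<and>
     (AE \<omega> in M. \<forall>l\<ge>0. e l \<omega> \<in> insert None (Some ` space n)) \<and>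
     (let J = restrict_space lborel {0..} \<Otimes>\<^sub>M n in
       (\<forall>B\<in>sets J. point_count e B \<in> borel_measurable M) \<and>
       (\<forall>B\<in>sets J. emeasure J B < \<infinity> \<longrightarrow>
          (\<forall>k. measure M {\<omega> \<in> space M. point_count e B \<omega> = of_nat k} =
                 measure J B ^ k / fact k * exp (- measure J B))) \<and>
       (\<forall>B\<in>sets J. emeasure J B = \<infinity> \<longrightarrow> (AE \<omega> in M. point_count e B \<omega> = \<infinity>)) \<and>
       (\<forall>m B. (\<forall>i<m. B i \<in> sets J) \<longrightarrow> disjoint_family_on B {..<m} \<longrightarrow>
          prob_space.indep_vars M (\<lambda>_. borel) (\<lambda>i. point_count e (B i)) {..<m::nat}))"

section \<open>Excursions away from a point\<close>

definition excursions :: "'e \<Rightarrow> (real \<Rightarrow> 'e) set" where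
  "excursions z = {\<epsilon> \<in> extensional {0..}. \<exists>v>0. \<forall>s\<ge>0. \<epsilon> s = z \<longleftrightarrow> s = 0 \<or> v \<le> s}"

definition lifetime :: "'e \<Rightarrow> (real \<Rightarrow> 'e) \<Rightarrow> real" where
  "lifetime z \<epsilon> = (THE v. v > 0 \<and> (\<forall>s\<ge>0. \<epsilon> s = z \<longleftrightarrow> s = 0 \<or> v \<le> s))"

lemma lifetime:
  assumes "\<epsilon> \<in> excursions z"
  shows "lifetime z \<epsilon> > 0" and "s \<ge> 0 \<Longrightarrow> \<epsilon> s = z \<longleftrightarrow> s = 0 \<or> lifetime z \<epsilon> \<le> s"
proof -
  let ?P = "\<lambda>v. v > 0 \<and> (\<forall>s\<ge>0. \<epsilon> s = z \<longleftrightarrow> s = 0 \<or> v \<le> s)"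
  obtain v where v: "?P v"
    using assms by (auto simp: excursions_def)
  have le: "v1 \<le> v2" if "?P v1" "?P v2" for v1 v2
  proof -
    have "\<epsilon> v2 = z" using that(2) by simp
    then show ?thesis using that by (metis less_imp_le less_irrefl)
  qed
  have "v' = v" if "?P v'" for v'
    using le [OF that v] le [OF v that] by (rule antisym)
  with v have "?P (lifetime z \<epsilon>)"
    unfolding lifetime_def by (rule theI)
  then show "lifetime z \<epsilon> > 0" and "s \<ge> 0 \<Longrightarrow> \<epsilon> s = z \<longleftrightarrow> s = 0 \<or> lifetime z \<epsilon> \<le> s"
    by blast+
qed

definition excursion_algebra :: "'e::topological_space \<Rightarrow> (real \<Rightarrow> 'e) measure" where
  "excursion_algebra z = restrict_space (path_algebra borel) (excursions z)"

text \<open>The inverse local time \<open>\<tau>\<^sub>l\<close> is real-valued on the event that \<open>L\<close> is unbounded, which has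
  probability one below. By convention \<open>\<tau>\<^bsub>0-\<^esub> = 0\<close>.\<close>

definition inv_local_time :: "(real \<Rightarrow> 'a \<Rightarrow> real) \<Rightarrow> real \<Rightarrow> 'a \<Rightarrow> real" where
  "inv_local_time L l \<omega> = Inf {s. 0 \<le> s \<and> L s \<omega> > l}"

definition inv_local_time_left :: "(real \<Rightarrow> 'a \<Rightarrow> real) \<Rightarrow> real \<Rightarrow> 'a \<Rightarrow> real" where
  "inv_local_time_left L l \<omega> = (if l = 0 then 0 else Lim (at_left l) (\<lambda>k. inv_local_time L k \<omega>))"

definition excursion_process ::
  "(real \<Rightarrow> 'a \<Rightarrow> 'e) \<Rightarrow> 'e \<Rightarrow> (real \<Rightarrow> 'a \<Rightarrow> real) \<Rightarrow> real \<Rightarrow> 'a \<Rightarrow> (real \<Rightarrow> 'e) option" where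
  "excursion_process X z L l \<omega> =
     (let a = inv_local_time_left L l \<omega>; b = inv_local_time L l \<omega> in
      if a < b then Some (\<lambda>s\<in>{0..}. if s \<le> b - a then X (a + s) \<omega> else z) else None)"

definition last_zero :: "(real \<Rightarrow> 'a \<Rightarrow> 'e) \<Rightarrow> 'e \<Rightarrow> real \<Rightarrow> 'a \<Rightarrow> real" where
  "last_zero X z t \<omega> = Sup {u. 0 \<le> u \<and> u \<le> t \<and> X u \<omega> = z}"

definition functional_process ::
  "(real \<Rightarrow> 'a \<Rightarrow> 'e) \<Rightarrow> 'e \<Rightarrow> (real \<Rightarrow> 'a \<Rightarrow> real) \<Rightarrow> ((real \<Rightarrow> 'e) \<Rightarrow> real \<Rightarrow> real) \<Rightarrow> real \<Rightarrow> 'a \<Rightarrow> real" where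
  "functional_process X z L F t \<omega> =
     (case excursion_process X z L (L t \<omega>) \<omega> of
        None \<Rightarrow> 0
      | Some \<epsilon> \<Rightarrow> F \<epsilon> (t - last_zero X z t \<omega>))"

definition functional_measure ::
  "'e \<Rightarrow> (real \<Rightarrow> 'e) measure \<Rightarrow> ((real \<Rightarrow> 'e) \<Rightarrow> real \<Rightarrow> real) \<Rightarrow> real measure" where
  "functional_measure z n F = distr n borel (\<lambda>\<epsilon>. F \<epsilon> (lifetime z \<epsilon>))"

section \<open>Standing assumptions\<close>

text \<open>\<open>PX x\<close> is the law of the path under \<open>P\<^sub>x\<close>. The strong Markov property is written in integrated
  form: for \<open>A \<in> \<F>\<^sub>T\<close>, \<open>P(A, X\<^bsub>T+\<cdot>\<^esub> \<in> B) = E(1\<^sub>A P\<^bsub>X(T)\<^esub>(B))\<close>, which is what conditional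
  independence given \<open>X\<^sub>T\<close>, with conditional law \<open>P\<^bsub>X(T)\<^esub>\<close>, means.\<close>

locale markov_process = prob_space M + complete_measure M for M :: "'a measure" +
  fixes X :: "real \<Rightarrow> 'a \<Rightarrow> 'e::polish_space"
    and z :: 'e
    and PX :: "'e \<Rightarrow> (real \<Rightarrow> 'e) measure"
  assumes X_measurable: "0 \<le> t \<Longrightarrow> X t \<in> borel_measurable M"
    and X_right_continuous: "\<omega> \<in> space M \<Longrightarrow> 0 \<le> t \<Longrightarrow> continuous (at_right t) (\<lambda>s. X s \<omega>)"
    and X_start: "AE \<omega> in M. X 0 \<omega> = z"
    and kernel: "PX \<in> borel \<rightarrow>\<^sub>M prob_algebra (path_algebra borel)"
    and X_law: "distr M (path_algebra borel) (\<lambda>\<omega>. \<lambda>t\<in>{0..}. X t \<omega>) = PX z"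
    and strong_markov:
      "\<And>T A B. stopping_time (usual_filtration M X) T \<Longrightarrow> (\<And>\<omega>. \<omega> \<in> space M \<Longrightarrow> T \<omega> < \<infinity>) \<Longrightarrow>
        A \<in> sets (sigma_at M X T) \<Longrightarrow> B \<in> sets (path_algebra borel) \<Longrightarrow>
        emeasure M {\<omega> \<in> A. (\<lambda>t\<in>{0..}. X (enn2real (T \<omega>) + t) \<omega>) \<in> B} =
          (\<integral>\<^sup>+\<omega>\<in>A. emeasure (PX (X (enn2real (T \<omega>)) \<omega>)) B \<partial>M)"
    and z_regular: "AE \<omega> in M. Inf {ennreal t | t. 0 < t \<and> X t \<omega> = z} = 0"
    and z_instantaneous: "AE \<omega> in M. Inf {ennreal t | t. 0 \<le> t \<and> X t \<omega> \<noteq> z} = 0"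
    and z_recurrent: "AE \<omega> in M. \<forall>t\<ge>0. \<exists>u>t. X u \<omega> = z"

text \<open>The measure \<open>dL\<close> is the Stieltjes measure of \<open>L\<close>, extended by \<open>L\<^sub>0\<close> to negative times. In
  \<open>L_regenerative\<close>, independence of \<open>\<F>\<^sub>T\<close> under \<open>P(\<cdot> | T < \<infinity>)\<close> and the identification of the law
  are combined in one product formula, multiplied by \<open>P(T < \<infinity>)\<close>; \<open>A = space M\<close> gives the law.\<close>

locale excursion_setting = markov_process M X z PX
  for M :: "'a measure" and X :: "real \<Rightarrow> 'a \<Rightarrow> 'e::polish_space" and z :: 'e
    and PX :: "'e \<Rightarrow> (real \<Rightarrow> 'e) measure" +
  fixes L :: "real \<Rightarrow> 'a \<Rightarrow> real"
    and n :: "(real \<Rightarrow> 'e) measure"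
  assumes L_adapted: "0 \<le> t \<Longrightarrow> L t \<in> borel_measurable (usual_filtration M X (ennreal t))"
    and L_paths: "AE \<omega> in M. L 0 \<omega> = 0 \<and> mono_on {0..} (\<lambda>t. L t \<omega>) \<and> continuous_on {0..} (\<lambda>t. L t \<omega>)"
    and L_support: "AE \<omega> in M.
      measure_support (interval_measure (\<lambda>t. L (max 0 t) \<omega>)) \<subseteq> closure {t. 0 \<le> t \<and> X t \<omega> = z}"
    and L_unbounded: "AE \<omega> in M. filterlim (\<lambda>t. L t \<omega>) at_top at_top"
    and L_regenerative:
      "\<And>T A B. stopping_time (usual_filtration M X) T \<Longrightarrow>
        (AE \<omega> in M. T \<omega> < \<infinity> \<longrightarrow> X (enn2real (T \<omega>)) \<omega> = z) \<Longrightarrow>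
        A \<in> sets (sigma_at M X T) \<Longrightarrow> B \<in> sets (path_algebra (borel \<Otimes>\<^sub>M borel)) \<Longrightarrow>
        measure M {\<omega> \<in> A. T \<omega> < \<infinity> \<and>
            (\<lambda>t\<in>{0..}. (X (enn2real (T \<omega>) + t) \<omega>, L (enn2real (T \<omega>) + t) \<omega> - L (enn2real (T \<omega>)) \<omega>)) \<in> B} =
          measure M {\<omega> \<in> A. T \<omega> < \<infinity>} *
          measure M {\<omega> \<in> space M. (\<lambda>t\<in>{0..}. (X t \<omega>, L t \<omega>)) \<in> B}"
    and n_sets: "sets n = sets (excursion_algebra z)"
    and n_characteristic: "poisson_point_process M n (excursion_process X z L)"

text \<open>\<open>F_nonanticipating\<close> says that \<open>F \<epsilon> t\<close> is a measurable function of the restriction of \<open>\<epsilon>\<close> to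
  \<open>[0,t]\<close>. Path regularity of the induced process (\<open>F_cadlag\<close>) does not follow from the other
  conditions: it excludes infinitely many excursions, within a bounded amount of local time,
  on which \<open>F\<close> exceeds a fixed level.\<close>

locale excursion_functional = excursion_setting M X z PX L n
  for M :: "'a measure" and X :: "real \<Rightarrow> 'a \<Rightarrow> 'e::polish_space" and z :: 'e
    and PX :: "'e \<Rightarrow> (real \<Rightarrow> 'e) measure" and L :: "real \<Rightarrow> 'a \<Rightarrow> real"
    and n :: "(real \<Rightarrow> 'e) measure" +
  fixes F :: "(real \<Rightarrow> 'e) \<Rightarrow> real \<Rightarrow> real"
  assumes F_monotone: "\<epsilon> \<in> excursions z \<Longrightarrow> mono_on {0..} (F \<epsilon>) \<or> antimono_on {0..} (F \<epsilon>)"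
    and F_continuous: "\<epsilon> \<in> excursions z \<Longrightarrow> continuous_on {0..} (F \<epsilon>)"
    and F_start: "\<epsilon> \<in> excursions z \<Longrightarrow> F \<epsilon> 0 = 0"
    and F_end: "\<epsilon> \<in> excursions z \<Longrightarrow> lifetime z \<epsilon> \<le> t \<Longrightarrow> F \<epsilon> t = F \<epsilon> (lifetime z \<epsilon>)"
    and F_nonzero: "\<epsilon> \<in> excursions z \<Longrightarrow> \<bar>F \<epsilon> (lifetime z \<epsilon>)\<bar> > 0"
    and F_nonanticipating: "0 \<le> t \<Longrightarrow> (\<lambda>\<epsilon>. F \<epsilon> t) \<in> borel_measurable
      (vimage_algebra (excursions z) (\<lambda>\<epsilon>. restrict \<epsilon> {0..t}) (PiM {0..t} (\<lambda>_. borel)))"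
    and F_cadlag: "AE \<omega> in M. \<forall>t\<ge>0.
      continuous (at_right t) (\<lambda>s. functional_process X z L F s \<omega>) \<and>
      (0 < t \<longrightarrow> (\<exists>y. ((\<lambda>s. functional_process X z L F s \<omega>) \<longlongrightarrow> y) (at_left t)))"

section \<open>The functions attached to \<open>\<mu>\<close> and a measure \<open>\<nu>\<close> on the line\<close>

definition tail :: "real measure \<Rightarrow> ereal \<Rightarrow> real" where
  "tail \<mu> t = measure \<mu> {x. t \<le> ereal x}"

definition supp_lower :: "real measure \<Rightarrow> ereal" where
  "supp_lower \<mu> = Inf (ereal ` measure_support \<mu>)"

definition supp_upper :: "real measure \<Rightarrow> ereal" where
  "supp_upper \<mu> = Sup (ereal ` measure_support \<mu>)"

definition D_fun :: "real measure \<Rightarrow> real measure \<Rightarrow> ereal \<Rightarrow> ennreal" where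
  "D_fun \<mu> \<nu> y = (\<integral>\<^sup>+s\<in>{s. 0 \<le> s \<and> ereal s \<le> y}. (1 / emeasure \<nu> {s..}) \<partial>\<mu>)"

definition G_fun :: "real measure \<Rightarrow> real measure \<Rightarrow> ereal \<Rightarrow> ennreal" where
  "G_fun \<mu> \<nu> x = (\<integral>\<^sup>+s\<in>{s. x \<le> ereal s \<and> s \<le> 0}. (1 / emeasure \<nu> {..s}) \<partial>\<mu>)"

definition D_inv :: "real measure \<Rightarrow> real measure \<Rightarrow> ennreal \<Rightarrow> ereal" where
  "D_inv \<mu> \<nu> v = (if D_fun \<mu> \<nu> (supp_upper \<mu>) \<le> v then \<infinity>
     else Inf {ereal y | y. 0 \<le> y \<and> v < D_fun \<mu> \<nu> (ereal y)})"

text \<open>\<^const>\<open>G_fun\<close> is decreasing in its argument, whence the supremum.\<close>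

definition G_inv :: "real measure \<Rightarrow> real measure \<Rightarrow> ennreal \<Rightarrow> ereal" where
  "G_inv \<mu> \<nu> v = (if G_fun \<mu> \<nu> (supp_lower \<mu>) \<le> v then - \<infinity>
     else Sup {ereal x | x. x \<le> 0 \<and> v < G_fun \<mu> \<nu> (ereal x)})"

definition psi_plus :: "real measure \<Rightarrow> real measure \<Rightarrow> real \<Rightarrow> ennreal" where
  "psi_plus \<mu> \<nu> y = (\<integral>\<^sup>+s\<in>{0..y}. (1 / (emeasure \<nu> {s..} *
     ennreal (1 + tail \<mu> (ereal s) - tail \<mu> (G_inv \<mu> \<nu> (D_fun \<mu> \<nu> (ereal s)))))) \<partial>\<mu>)"

definition psi_minus :: "real measure \<Rightarrow> real measure \<Rightarrow> real \<Rightarrow> ennreal" where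
  "psi_minus \<mu> \<nu> y = (\<integral>\<^sup>+s\<in>{-y..0}. (1 / (emeasure \<nu> {..s} *
     ennreal (1 + tail \<mu> (D_inv \<mu> \<nu> (G_fun \<mu> \<nu> (ereal s))) - tail \<mu> (ereal s)))) \<partial>\<mu>)"

text \<open>Generalised inverse, applied to \<^const>\<open>psi_plus\<close> and \<^const>\<open>psi_minus\<close>; it vanishes at \<open>0\<close>
  and is infinite where the infimum is over the empty set.\<close>

definition phi_of :: "(real \<Rightarrow> ennreal) \<Rightarrow> real \<Rightarrow> ereal" where
  "phi_of \<psi> l = Inf {ereal x | x. 0 \<le> x \<and> ennreal l \<le> \<psi> x}"

section \<open>The embedding time\<close>

definition embedding_time ::
  "(real \<Rightarrow> ennreal) \<Rightarrow> (real \<Rightarrow> ennreal) \<Rightarrow> (real \<Rightarrow> 'a \<Rightarrow> real) \<Rightarrow> (real \<Rightarrow> 'a \<Rightarrow> real) \<Rightarrow> 'a \<Rightarrow> ennreal" where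
  "embedding_time \<psi>\<^sub>m \<psi>\<^sub>p Y L \<omega> =
     Inf {ennreal t | t. 0 < t \<and> (\<psi>\<^sub>m (- Y t \<omega>) \<ge> ennreal (L t \<omega>) \<or> \<psi>\<^sub>p (Y t \<omega>) \<ge> ennreal (L t \<omega>))}"

end

theory Submission
  imports Defs
begin

text \<open>Indexed by local time, the excursions form a Poisson point process, and \<open>T\<close> stops at the first
  \<open>l\<close> whose excursion has terminal value \<open>y\<close> with \<open>w y \<ge> l\<close>, where \<open>w y\<close> is \<open>\<psi>\<^sub>+ y\<close> for \<open>y \<ge> 0\<close> and \<open>\<psi>\<^sub>- (-y)\<close> for
  \<open>y < 0\<close>. Let \<open>S l\<close> be the \<open>\<mu>\<close>-mass of \<open>{w > l}\<close>. The denominators in \<open>\<psi>\<^sub>+\<close> and \<open>\<psi>\<^sub>-\<close> are exactly the values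
  \<open>S (w y)\<close>, because \<open>\<psi>\<^sub>+\<close> and \<open>\<psi>\<^sub>-\<close> arise from \<open>D\<close> and \<open>G\<close> by the same increasing change of clock. By
  Fubini, the intensity \<open>\<Lambda>\<close> of the positive stopping excursions in \<open>(l,m]\<close> is the integral of
  \<open>1 / S (w y)\<close> over \<open>{y > 0, l < w y \<le> m}\<close> with respect to \<open>\<mu>\<close>. The total intensity of \<open>(0,l]\<close> is therefore
  \<open>- ln (S l)\<close>, that is, \<open>P (L\<^sub>T > l) = S l\<close>; and both \<open>P (l < L\<^sub>T \<le> m, F\<^sub>T > 0)\<close> and \<open>\<mu> {y > 0, l < w y \<le> m}\<close> lie
  between \<open>S m * \<Lambda>\<close> and \<open>S l * \<Lambda>\<close>, so they agree after refining \<open>(l,m]\<close>. Since \<open>w (F\<^sub>T) = L\<^sub>T\<close>, this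
  determines the law of \<open>F\<^sub>T\<close>. Minimality and the formula for \<open>F\<^sub>T\<close> use that \<open>w (F\<^sub>t) < L\<^sub>t\<close> for
  \<open>0 < t < T\<close>.\<close>

section \<open>Integrals of a density against an atomless measure\<close>

text \<open>Two obstacles shape the proof. The functions \<open>D\<close> and \<open>\<psi>\<close>
  may be flat on gaps of the support and infinite at its end, so they have no genuine inverses. As
  \<mu> has no atoms, flat stretches at finite levels are \<mu>-null, and almost every point has
  mass beyond it, which makes everything finite there. Identities are therefore proved at points
  \<open>y\<close> with \<open>0 < emeasure \<mu> {y<..}\<close> or almost everywhere, and the end
  of the support is reached by approximation. Secondly, nothing is differentiated. Two quantities
  attached to an interval with the same lower and upper bound differ by at most the square of the
  increment of a continuous function, up to a constant; such errors disappear under bisection. This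
  serves once for the logarithm of \<open>Sr\<close> and once for the law of the stopped value. The
  path itself enters only through deterministic facts valid off a null set. Regular paths admit
  finitely many large excursions in bounded local time, which yields both the finite tails of the
  characteristic measure and a least stopping level.\<close>

locale weight = prob_space \<mu> for \<mu> :: "real measure" +
  fixes f :: "real \<Rightarrow> ennreal"
  assumes sets_mu [measurable_cong, simp]: "sets \<mu> = sets borel"
    and atomless: "emeasure \<mu> {x} = 0"
    and f_measurable [measurable]: "f \<in> borel_measurable borel"
    and f_pos: "0 < s \<Longrightarrow> 0 < f s"
    and f_finite: "0 < emeasure \<mu> {y<..} \<Longrightarrow> (\<integral>\<^sup>+s\<in>{0..y}. f s \<partial>\<mu>) < \<infinity>"
begin

lemma space_mu [simp]: "space \<mu> = UNIV"
  using sets_eq_imp_space_eq [OF sets_mu] by simp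

definition K :: "real \<Rightarrow> ennreal" where
  "K y = (\<integral>\<^sup>+s\<in>{0..y}. f s \<partial>\<mu>)"

definition \<kappa> :: "real measure" where
  "\<kappa> = density \<mu> (\<lambda>s. f s * indicator {0..} s)"

lemma sets_kappa [measurable_cong, simp]: "sets \<kappa> = sets borel"
  by (simp add: \<kappa>_def)

lemma space_kappa [simp]: "space \<kappa> = UNIV"
  by (simp add: \<kappa>_def)

lemma emeasure_kappa:
  "A \<in> sets borel \<Longrightarrow> emeasure \<kappa> A = (\<integral>\<^sup>+s. f s * indicator ({0..} \<inter> A) s \<partial>\<mu>)"
  unfolding \<kappa>_def by (subst emeasure_density) (auto simp: indicator_inter_arith mult.assoc)

lemma kappa_atMost: "emeasure \<kappa> {..y} = K y"
  unfolding K_def by (subst emeasure_kappa) (auto intro!: arg_cong [where f="nn_integral \<mu>"] simp: indicator_def fun_eq_iff)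

lemma weight_measurable: "(\<lambda>s. f s * indicator {0..} s) \<in> borel_measurable \<mu>"
  by measurable

lemma kappa_null: "A \<in> null_sets \<mu> \<Longrightarrow> A \<in> null_sets \<kappa>"
  unfolding \<kappa>_def by (auto simp: null_sets_density_iff [OF weight_measurable] dest: AE_not_in null_setsD2 elim: AE_mp)

lemma singleton_null: "{x} \<in> null_sets \<mu>"
  by (auto simp: null_sets_def atomless)

lemma K_mono: "x \<le> y \<Longrightarrow> K x \<le> K y"
  unfolding K_def by (intro nn_integral_mono) (auto simp: indicator_def)

lemma K_nonpos: assumes "y \<le> 0" shows "K y = 0"
proof -
  have "K y \<le> K 0" using assms by (rule K_mono)
  also have "K 0 = 0"
    unfolding K_def using AE_not_in [OF singleton_null [of 0]]
    by (subst nn_integral_0_iff_AE) (auto simp: indicator_def)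
  finally show ?thesis by simp
qed

lemma kappa_Ioc: "x \<le> y \<Longrightarrow> K x < \<infinity> \<Longrightarrow> emeasure \<kappa> {x<..y} = K y - K x"
proof -
  assume "x \<le> y" "K x < \<infinity>"
  moreover have "{x<..y} = {..y} - {..x}" by auto
  ultimately show ?thesis
    by (simp add: emeasure_Diff kappa_atMost)
qed

section \<open>Continuity of \<open>K\<close> as a function with values in [0,\<infinity>]\<close>

lemma K_left:
  assumes "e < K y" shows "\<exists>x<y. e < K x"
proof -
  have "emeasure \<kappa> {..y} = emeasure \<kappa> ({..<y} \<union> {y})"
    by (rule arg_cong [where f="emeasure \<kappa>"]) auto
  also have "\<dots> = emeasure \<kappa> {..<y}"
    using kappa_null [OF singleton_null, of y] by (intro emeasure_Un_null_set) auto
  also have "{..<y} = (\<Union>n. {..y - 1 / real (Suc n)})"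
  proof (intro equalityI subsetI)
    fix x assume "x \<in> {..<y}"
    then obtain n where "1 / real (Suc n) < y - x"
      using reals_Archimedean [of "y - x"] by (auto simp: inverse_eq_divide)
    then show "x \<in> (\<Union>n. {..y - 1 / real (Suc n)})" by (auto intro!: exI [of _ n])
  next
    fix x assume "x \<in> (\<Union>n. {..y - 1 / real (Suc n)})"
    then obtain n where "x \<le> y - 1 / real (Suc n)" by auto
    moreover have "1 / real (Suc n) > 0" by simp
    ultimately have "x < y" by linarith
    then show "x \<in> {..<y}" by simp
  qed
  also have "emeasure \<kappa> \<dots> = (SUP n. emeasure \<kappa> {..y - 1 / real (Suc n)})"
  proof (rule SUP_emeasure_incseq [symmetric])
    have "1 / real (Suc n) \<le> 1 / real (Suc m)" if "m \<le> n" for m n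
      using that by (intro divide_left_mono) simp_all
    then show "incseq (\<lambda>n. {..y - 1 / real (Suc n)})"
      unfolding incseq_def atMost_subset_iff by (simp add: diff_left_mono)
  qed auto
  finally have "K y = (SUP n. K (y - 1 / real (Suc n)))"
    by (simp add: kappa_atMost)
  with assms obtain n where "e < K (y - 1 / real (Suc n))"
    by (auto simp: less_SUP_iff)
  moreover have "1 / real (Suc n) > 0" by simp
  ultimately show ?thesis
    by (intro exI [of _ "y - 1 / real (Suc n)"]) (auto simp del: of_nat_Suc)
qed

lemma Greater_emeasure_pos:
  assumes "0 < emeasure \<mu> {y<..}" obtains x where "y < x" "0 < emeasure \<mu> {x<..}"
proof -
  have "{y<..} = (\<Union>n. {y + 1 / real (Suc n)<..})"
  proof (intro equalityI subsetI)
    fix x assume "x \<in> {y<..}"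
    then obtain n where "1 / real (Suc n) < x - y"
      using reals_Archimedean [of "x - y"] by (auto simp: inverse_eq_divide)
    then show "x \<in> (\<Union>n. {y + 1 / real (Suc n)<..})" by (auto intro!: exI [of _ n])
  next
    fix x assume "x \<in> (\<Union>n. {y + 1 / real (Suc n)<..})"
    then obtain n where "x > y + 1 / real (Suc n)" by auto
    moreover have "1 / real (Suc n) > 0" by simp
    ultimately have "y < x" by linarith
    then show "x \<in> {y<..}" by simp
  qed
  then have "\<not> (\<forall>n. {y + 1 / real (Suc n)<..} \<in> null_sets \<mu>)"
    using assms null_sets_UN [of "\<lambda>n. {y + 1 / real (Suc n)<..}" \<mu>] by (auto simp: null_sets_def)
  then obtain n where "0 < emeasure \<mu> {y + 1 / real (Suc n)<..}"
    by (auto simp: null_sets_def zero_less_iff_neq_zero)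
  moreover have "1 / real (Suc n) > 0" by simp
  ultimately show ?thesis by (intro that [of "y + 1 / real (Suc n)"]) (auto simp del: of_nat_Suc)
qed

lemma K_finite: "0 < emeasure \<mu> {y<..} \<Longrightarrow> K y < \<infinity>"
  using f_finite by (simp add: K_def)

text \<open>Continuity from above needs finite mass. If \<mu> charges \<open>{y<..}\<close>, it
  still charges some \<open>{x0<..}\<close> with \<open>y < x0\<close>, so \<open>K\<close> is
  finite on a right neighbourhood of \<open>y\<close>; otherwise \<open>K\<close> is constant to the
  right of \<open>y\<close>.\<close>

lemma K_right:
  assumes "K y < e" shows "\<exists>x>y. K x < e"
proof (cases "0 < emeasure \<mu> {y<..}")
  case True
  then obtain x0 where x0: "y < x0" "0 < emeasure \<mu> {x0<..}"
    by (rule Greater_emeasure_pos)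
  let ?x = "\<lambda>n. y + (x0 - y) / real (Suc n)"
  have le: "?x n \<le> x0" for n
    using x0 mult_left_mono [of y x0 "real n"] by (simp add: field_simps)
  have eq: "{..y} = (\<Inter>n. {..?x n})"
  proof (intro equalityI subsetI)
    fix x assume x: "x \<in> (\<Inter>n. {..?x n})"
    show "x \<in> {..y}"
    proof (rule ccontr)
      assume "x \<notin> {..y}"
      then have "0 < (x - y) / (x0 - y)" using x0 by simp
      then obtain n where "1 / real (Suc n) < (x - y) / (x0 - y)"
        using reals_Archimedean by (auto simp: inverse_eq_divide)
      then have "?x n < x" using x0 by (simp add: field_simps)
      with x show False by (auto simp: not_le dest: spec [of _ n])
    qed
  next
    fix x assume "x \<in> {..y}" then show "x \<in> (\<Inter>n. {..?x n})"
      using x0 by (auto intro!: add_increasing2 divide_nonneg_nonneg)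
  qed
  have "(INF n. emeasure \<kappa> {..?x n}) = emeasure \<kappa> (\<Inter>n. {..?x n})"
  proof (rule INF_emeasure_decseq)
    show "decseq (\<lambda>n. {..?x n})"
      using x0 unfolding decseq_def atMost_subset_iff
      by (auto intro!: divide_left_mono)
    have "K (?x n) < \<infinity>" for n
      using K_mono [OF le [of n]] K_finite [OF x0(2)] by (rule order.strict_trans1)
    then show "emeasure \<kappa> {..?x n} \<noteq> \<infinity>" for n
      by (simp add: kappa_atMost less_top)
  qed auto
  then have "K y = (INF n. K (?x n))" unfolding eq [symmetric] kappa_atMost by simp
  with assms obtain n where "K (?x n) < e" by (auto simp: INF_less_iff)
  with x0 show ?thesis by (intro exI [of _ "?x n"]) auto
next
  case False
  have "K (y + 1) \<le> emeasure \<kappa> ({..y} \<union> {y<..})"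
    unfolding kappa_atMost [symmetric] by (intro emeasure_mono) auto
  also have "\<dots> = K y"
    using False kappa_null [of "{y<..}"]
    by (subst emeasure_Un_null_set) (auto simp: null_sets_def kappa_atMost)
  finally have "K (y + 1) < e" using assms by (rule le_less_trans)
  then show ?thesis by (intro exI [of _ "y + 1"] conjI) simp_all
qed

lemma K_continuous: "continuous_on A K"
proof -
  have "(K \<longlongrightarrow> K y) (at y)" for y
  proof (rule order_tendstoI)
    fix e assume "e < K y"
    then obtain x where x: "x < y" "e < K x" using K_left by blast
    have "e < K s" if "s \<in> {x<..}" for s
      using x(2) K_mono [of x s] that by (auto intro: less_le_trans [of e "K x"])
    with x(1) show "\<forall>\<^sub>F s in at y. e < K s"
      unfolding eventually_at_topological by (intro exI [of _ "{x<..}"]) simp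
  next
    fix e assume "K y < e"
    then obtain x where x: "y < x" "K x < e" using K_right by blast
    have "K s < e" if "s \<in> {..<x}" for s
      using x(2) K_mono [of s x] that by (auto intro: le_less_trans [of "K s" "K x"])
    with x(1) show "\<forall>\<^sub>F s in at y. K s < e"
      unfolding eventually_at_topological by (intro exI [of _ "{..<x}"]) simp
  qed
  then show ?thesis
    unfolding continuous_on_def using tendsto_within_subset [OF _ subset_UNIV] by blast
qed

lemma K_measurable [measurable]: "K \<in> borel_measurable borel"
  using K_continuous by (rule borel_measurable_continuous_onI)

lemma K_IVT: assumes "u \<le> K y" obtains x where "x \<le> y" "K x = u"
proof (cases "0 \<le> y")
  case True
  then show thesis
    using IVT' [of K 0 u y] K_continuous assms by (auto simp: K_nonpos intro: that)
next
  case False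
  then show thesis
    using assms by (intro that [of y]) (auto simp: K_nonpos)
qed

text \<open>By monotonicity the flat stretch is an interval starting at \<open>y\<close>. The sets
  \<open>{y<..r}\<close> with rational \<open>r\<close> in it, each of mass
  \<open>K r - K y = 0\<close>, cover it except for a possible largest element, a null
  singleton.\<close>

lemma kappa_level:
  assumes "K y < \<infinity>" shows "emeasure \<kappa> {x. y < x \<and> K x = K y} = 0"
proof -
  define A where "A = {x. y < x \<and> K x = K y}"
  define B where "B = {x \<in> A. \<forall>x'\<in>A. x' \<le> x}"
  have "A \<in> sets borel" unfolding A_def by measurable
  have B: "B \<in> null_sets \<kappa>"
  proof (cases "B = {}")
    case False
    then obtain x where "x \<in> B" by auto
    then have "B = {x}" by (auto simp: B_def intro: antisym)
    then show ?thesis using kappa_null [OF singleton_null] by simp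
  qed simp
  have C: "(\<Union>r\<in>{r\<in>\<rat>. y < r \<and> K r = K y}. {y<..r}) \<in> null_sets \<kappa>"
  proof (rule null_sets_UN')
    show "countable {r\<in>\<rat>. y < r \<and> K r = K y}"
      by (rule countable_subset [OF _ countable_rat]) auto
    fix r assume "r \<in> {r\<in>\<rat>. y < r \<and> K r = K y}"
    then have "emeasure \<kappa> {y<..r} = 0" using assms by (subst kappa_Ioc) auto
    then show "{y<..r} \<in> null_sets \<kappa>" by (simp add: null_sets_def)
  qed
  have "A \<subseteq> B \<union> (\<Union>r\<in>{r\<in>\<rat>. y < r \<and> K r = K y}. {y<..r})"
  proof
    fix x assume x: "x \<in> A"
    show "x \<in> B \<union> (\<Union>r\<in>{r\<in>\<rat>. y < r \<and> K r = K y}. {y<..r})"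
    proof (cases "x \<in> B")
      case False
      then obtain x' where x': "x' \<in> A" "x < x'" using x by (auto simp: B_def not_le)
      then obtain r where r: "r \<in> \<rat>" "x < r" "r < x'" using Rats_dense_in_real by blast
      have "K r = K y"
        using K_mono [of x r] K_mono [of r x'] r x x' by (simp add: A_def)
      moreover have "y < x" "y < r" using x r by (auto simp: A_def)
      ultimately show ?thesis using r by (intro UnI2 UN_I [of r]) auto
    qed simp
  qed
  with B C \<open>A \<in> sets borel\<close> have "A \<in> null_sets \<kappa>"
    by (intro null_sets_subset [OF null_sets.Un [OF B C]]) auto
  then show ?thesis by (simp add: A_def null_sets_def)
qed

text \<open>The density of \<open>\<kappa>\<close> is strictly positive on \<open>{0<..}\<close>, so
  null sets pass back to \<mu> there; at 0 it may vanish.\<close>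

lemma mu_null_of_kappa:
  assumes "A \<in> sets borel" "emeasure \<kappa> A = 0" "A \<subseteq> {0<..}"
  shows "emeasure \<mu> A = 0"
proof -
  have "AE s in \<mu>. s \<in> A \<longrightarrow> f s * indicator {0..} s = 0"
  proof -
    have "A \<in> null_sets \<kappa>" using assms(1,2) by (simp add: null_sets_def)
    then show ?thesis
      unfolding \<kappa>_def null_sets_density_iff [OF weight_measurable] by simp
  qed
  then have "AE s in \<mu>. s \<notin> A"
    by eventually_elim (use assms(3) f_pos in \<open>auto simp: subset_eq indicator_def less_le split: if_splits\<close>)
  then show ?thesis using assms(1)
    by (subst (asm) AE_iff_measurable [of A]) auto
qed

lemma mu_level:
  assumes "0 \<le> y" "K y < \<infinity>" shows "emeasure \<mu> {x. y < x \<and> K x = K y} = 0"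
  using assms by (intro mu_null_of_kappa kappa_level) auto

text \<open>If \<open>K\<close> takes the value \<open>u\<close> at some \<open>x \<le> y\<close>,
  the set is \<open>{..x}\<close> up to a flat stretch, which is null. The formula is the
  distribution function of the image of \<open>\<kappa>\<close> under \<open>K\<close>.\<close>

lemma kappa_atMost_level:
  "emeasure \<kappa> {x. x \<le> y \<and> K x \<le> ennreal u} = min (ennreal u) (K y)"
proof (cases "ennreal u \<le> K y")
  case True
  then obtain x where x: "x \<le> y" "K x = ennreal u" by (rule K_IVT)
  then have eq: "{x. x \<le> y \<and> K x \<le> ennreal u} = {..x} \<union> {x'. x' \<le> y \<and> x < x' \<and> K x' = K x}"
  proof (intro equalityI subsetI)
    fix x' assume x': "x' \<in> {x. x \<le> y \<and> K x \<le> ennreal u}"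
    show "x' \<in> {..x} \<union> {x'. x' \<le> y \<and> x < x' \<and> K x' = K x}"
    proof (cases "x' \<le> x")
      case False
      then have "K x \<le> K x'" by (intro K_mono) simp
      moreover have "K x' \<le> K x" using x' x by simp
      ultimately show ?thesis using False x' by simp
    qed simp
  next
    fix x' assume x': "x' \<in> {..x} \<union> {x'. x' \<le> y \<and> x < x' \<and> K x' = K x}"
    show "x' \<in> {x. x \<le> y \<and> K x \<le> ennreal u}"
    proof (cases "x' \<le> x")
      case True
      then have "K x' \<le> K x" by (rule K_mono)
      then show ?thesis using True x by simp
    next
      case False
      then show ?thesis using x' x by simp
    qed
  qed
  have "{x'. x' \<le> y \<and> x < x' \<and> K x' = K x} \<in> null_sets \<kappa>"
  proof (rule null_sets_subset)
    have "K x < \<infinity>" using x by simp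
    then show "{x'. x < x' \<and> K x' = K x} \<in> null_sets \<kappa>"
      using kappa_level [of x] by (intro null_setsI) simp_all
    show "{x'. x' \<le> y \<and> x < x' \<and> K x' = K x} \<in> sets \<kappa>" by measurable
    show "{x'. x' \<le> y \<and> x < x' \<and> K x' = K x} \<subseteq> {x'. x < x' \<and> K x' = K x}" by auto
  qed
  then have "emeasure \<kappa> {x. x \<le> y \<and> K x \<le> ennreal u} = K x"
    unfolding eq by (subst emeasure_Un_null_set) (auto simp: kappa_atMost)
  then show ?thesis using x True by (simp add: min_def)
next
  case False
  then have "{x. x \<le> y \<and> K x \<le> ennreal u} = {..y}"
  proof (intro equalityI subsetI)
    fix x assume "x \<in> {..y}"
    then have "K x \<le> K y" by (intro K_mono) simp
    also have "K y \<le> ennreal u" using False by simp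
    finally show "x \<in> {x. x \<le> y \<and> K x \<le> ennreal u}" using \<open>x \<in> {..y}\<close> by simp
  qed simp
  then show ?thesis using False by (simp add: kappa_atMost min_def)
qed

text \<open>Change of variables: \<open>K\<close> maps the measure \<open>f d\<mu>\<close> on \<open>[0,y]\<close> to Lebesgue measure on \<open>[0, K y]\<close>.\<close>

lemma nn_integral_K:
  assumes "0 \<le> y" "K y < \<infinity>" and g [measurable]: "g \<in> borel_measurable borel"
  shows "(\<integral>\<^sup>+s\<in>{0..y}. g (K s) * f s \<partial>\<mu>) = (\<integral>\<^sup>+u\<in>{0..enn2real (K y)}. g (ennreal u) \<partial>lborel)"
proof -
  let ?k = "enn2real (K y)"
  have Ky: "K y = ennreal ?k" using assms by (simp add: less_top)
  \<comment> \<open>The image of \<open>\<kappa>\<close> on \<open>{..y}\<close> under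
    \<open>K\<close> is compared with Lebesgue measure on open half-lines, which suffices for finite
    measures.\<close>
  define N1 where "N1 = distr (density \<kappa> (indicator {..y})) borel (\<lambda>s. enn2real (K s))"
  define N2 where "N2 = density lborel (indicator {0..?k} :: real \<Rightarrow> ennreal)"
  have tot: "emeasure N1 UNIV = K y"
    unfolding N1_def by (subst emeasure_distr) (auto simp: emeasure_density kappa_atMost)
  have "N1 = N2"
  proof (rule measure_eqI_lessThan)
    show "sets N1 = sets borel" "sets N2 = sets borel" by (auto simp: N1_def N2_def)
    have "emeasure N1 {x<..} \<le> emeasure N1 UNIV" for x by (intro emeasure_mono) (auto simp: N1_def)
    then show "emeasure N1 {x<..} < \<infinity>" for x
      using tot assms(2) by (metis order.strict_trans1)
    fix x
    have N1: "emeasure N1 {x<..} = emeasure \<kappa> {s. s \<le> y \<and> x < enn2real (K s)}"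
    proof -
      have "emeasure N1 {x<..} = emeasure (density \<kappa> (indicator {..y})) {s. x < enn2real (K s)}"
        unfolding N1_def by (subst emeasure_distr) (auto intro!: arg_cong [where f="emeasure _"])
      also have "\<dots> = emeasure \<kappa> ({..y} \<inter> {s. x < enn2real (K s)})"
        by (subst emeasure_density) (auto simp: indicator_inter_arith [symmetric])
      also have "{..y} \<inter> {s. x < enn2real (K s)} = {s. s \<le> y \<and> x < enn2real (K s)}" by auto
      finally show ?thesis .
    qed
    have fin: "K s < \<infinity>" if "s \<le> y" for s using K_mono [OF that] assms(2) by (rule order.strict_trans1)
    have N2: "emeasure N2 {x<..} = ennreal (?k - max 0 x)" (is "_ = ennreal ?r")
    proof -
      have "emeasure N2 {x<..} = emeasure lborel ({0..?k} \<inter> {x<..})"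
        unfolding N2_def by (subst emeasure_density) (auto simp: indicator_inter_arith [symmetric])
      also have "\<dots> = ennreal ?r"
      proof (cases "x < 0")
        case True
        then have "{0..?k} \<inter> {x<..} = {0..?k}" by auto
        then show ?thesis using True by simp
      next
        case False
        then have "{0..?k} \<inter> {x<..} = {x<..?k}" by auto
        then show ?thesis using False by (cases "x \<le> ?k") (auto simp: ennreal_neg)
      qed
      finally show ?thesis .
    qed
    show "emeasure N1 {x<..} = emeasure N2 {x<..}"
    proof (cases "x < 0")
      case True
      then have "{s. s \<le> y \<and> x < enn2real (K s)} = {..y}"
        by (auto intro: less_le_trans)
      then show ?thesis using True N1 N2 Ky by (simp add: kappa_atMost)
    next
      case False
      then have "{s. s \<le> y \<and> x < enn2real (K s)} = {..y} - {s. s \<le> y \<and> K s \<le> ennreal x}"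
      proof -
        have "x < enn2real (K s) \<longleftrightarrow> \<not> K s \<le> ennreal x" if "s \<le> y" for s
        proof -
          have "K s = ennreal (enn2real (K s))" using fin [OF that] by simp
          then have "K s \<le> ennreal x \<longleftrightarrow> enn2real (K s) \<le> x"
            using False by (metis ennreal_le_iff not_less)
          then show ?thesis by auto
        qed
        then show ?thesis by auto
      qed
      then have "emeasure N1 {x<..} = K y - min (ennreal x) (K y)"
        using N1 assms(2) kappa_atMost_level [of y x]
        by (simp, subst emeasure_Diff) (auto simp: kappa_atMost min_def)
      also have "\<dots> = ennreal (?k - x)"
        using False by (subst (1 2) Ky) (auto simp: min_def ennreal_minus ennreal_neg)
      finally show ?thesis using N2 False by simp
    qed
  qed
  then have "(\<integral>\<^sup>+x. g (ennreal x) \<partial>N1) = (\<integral>\<^sup>+x. g (ennreal x) \<partial>N2)" by simp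
  moreover have "(\<integral>\<^sup>+x. g (ennreal x) \<partial>N2) = (\<integral>\<^sup>+u\<in>{0..?k}. g (ennreal u) \<partial>lborel)"
    unfolding N2_def by (subst nn_integral_density) (auto simp: mult.commute)
  moreover have "(\<integral>\<^sup>+x. g (ennreal x) \<partial>N1) = (\<integral>\<^sup>+s\<in>{0..y}. g (K s) * f s \<partial>\<mu>)"
  proof -
    have fin: "ennreal (enn2real (K s)) = K s" if "s \<le> y" for s
      using order.strict_trans1 [OF K_mono [OF that] assms(2)] by simp
    have "(\<integral>\<^sup>+x. g (ennreal x) \<partial>N1) = (\<integral>\<^sup>+s. indicator {..y} s * g (ennreal (enn2real (K s))) \<partial>\<kappa>)"
      unfolding N1_def by (subst nn_integral_distr, simp, simp) (subst nn_integral_density, auto)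
    also have "\<dots> = (\<integral>\<^sup>+s. f s * indicator {0..} s * (indicator {..y} s * g (ennreal (enn2real (K s)))) \<partial>\<mu>)"
      unfolding \<kappa>_def by (subst nn_integral_density) auto
    also have "\<dots> = (\<integral>\<^sup>+s\<in>{0..y}. g (K s) * f s \<partial>\<mu>)"
      by (intro nn_integral_cong) (auto simp: indicator_def fin ac_simps)
    finally show ?thesis .
  qed
  ultimately show ?thesis by simp
qed

end

text \<open>An open set missing the support is covered by open null sets, of which Lindelof keeps
  countably many.\<close>

lemma open_meets_support:
  fixes N :: "'b::second_countable_topology measure"
  assumes "open U" "0 < emeasure N U" "sets N = sets borel"
  obtains x where "x \<in> U" "x \<in> measure_support N"
proof (rule ccontr)
  assume "\<not> thesis"
  then have "\<forall>x\<in>U. \<exists>V. open V \<and> x \<in> V \<and> emeasure N V = 0"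
    using that by (auto simp: measure_support_def zero_less_iff_neq_zero)
  then obtain V where V: "\<And>x. x \<in> U \<Longrightarrow> open (V x) \<and> x \<in> V x \<and> emeasure N (V x) = 0"
    by metis
  have "open A" if "A \<in> V ` U" for A using that V by auto
  then obtain \<V> where \<V>: "\<V> \<subseteq> V ` U" "countable \<V>" "\<Union>\<V> = \<Union>(V ` U)"
    by (rule Lindelof [of "V ` U"])
  have "(\<Union>A\<in>\<V>. A) \<in> null_sets N"
  proof (rule null_sets_UN' [OF \<V>(2)])
    fix A assume "A \<in> \<V>"
    then obtain x where "x \<in> U" "A = V x" using \<V>(1) by auto
    then show "A \<in> null_sets N" using V [of x] assms(3) by (auto intro: null_setsI)
  qed
  moreover have "U \<subseteq> (\<Union>A\<in>\<V>. A)" using V \<V>(3) by auto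
  ultimately have "emeasure N U = 0"
    using assms by (intro null_setsD1 null_sets_subset [of _ N U]) auto
  then show False using assms by simp
qed

context weight
begin

text \<open>The exceptional points form an up-set: those above a rational member \<open>r\<close>
  lie in the null set \<open>{r<..}\<close>, and only a least element can remain. Hence the
  finiteness assumption of the locale is available almost everywhere.\<close>

lemma AE_tail_pos: "AE x in \<mu>. 0 < emeasure \<mu> {x<..}"
proof -
  define A where "A = {x. emeasure \<mu> {x<..} = 0}"
  define B where "B = {x\<in>A. \<forall>x'\<in>A. x \<le> x'}"
  have B: "B \<in> null_sets \<mu>"
  proof (cases "B = {}")
    case False
    then obtain x where "x \<in> B" by auto
    then have "B = {x}" by (auto simp: B_def intro: antisym)
    then show ?thesis using singleton_null by simp
  qed simp
  have C: "(\<Union>r\<in>A \<inter> \<rat>. {r<..}) \<in> null_sets \<mu>"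
    by (rule null_sets_UN') (auto simp: A_def null_sets_def countable_rat)
  have "A \<subseteq> B \<union> (\<Union>r\<in>A \<inter> \<rat>. {r<..})"
  proof
    fix x assume x: "x \<in> A"
    show "x \<in> B \<union> (\<Union>r\<in>A \<inter> \<rat>. {r<..})"
    proof (cases "x \<in> B")
      case False
      then obtain x' where x': "x' \<in> A" "x' < x" using x by (auto simp: B_def not_le)
      then obtain r where r: "r \<in> \<rat>" "x' < r" "r < x" using Rats_dense_in_real by blast
      have "emeasure \<mu> {r<..} \<le> emeasure \<mu> {x'<..}" using r by (intro emeasure_mono) auto
      then have "r \<in> A" using x' by (simp add: A_def)
      then show ?thesis using r by auto
    qed simp
  qed
  then show ?thesis
    by (intro AE_I' [OF null_sets.Un [OF B C]]) (auto simp: A_def zero_less_iff_neq_zero)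
qed

text \<open>Here the level is not tied to a point. By continuity the level set in
  \<open>{0..}\<close> is closed, so it has a least element, and \<open>mu_level\<close> applies to
  what lies beyond it.\<close>

lemma mu_level_null:
  assumes "u < \<infinity>" shows "emeasure \<mu> {x. 0 < x \<and> K x = u} = 0"
proof (cases "{x. 0 \<le> x \<and> K x = u} = {}")
  case True
  then have *: "{x. 0 < x \<and> K x = u} = {}" by (auto dest: less_imp_le)
  show ?thesis unfolding * by simp
next
  case False
  let ?C = "{x. 0 \<le> x \<and> K x = u}"
  have "closed ({0..} \<inter> {x. K x = u})"
    by (intro closed_Int closed_atLeast closed_Collect_eq K_continuous continuous_on_const)
  then have "closed ?C" by (simp add: Int_def)
  then have "Inf ?C \<in> ?C"
    using False by (intro closed_contains_Inf) (auto intro: bdd_belowI [of _ 0])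
  moreover have "Inf ?C \<le> x" if "x \<in> ?C" for x
    using that by (intro cInf_lower) (auto intro: bdd_belowI [of _ 0])
  ultimately have sub: "{x. 0 < x \<and> K x = u} \<subseteq> {x. Inf ?C < x \<and> K x = K (Inf ?C)} \<union> {Inf ?C}"
    by (auto simp: less_le)
  have "{x. Inf ?C < x \<and> K x = K (Inf ?C)} \<in> null_sets \<mu>"
    using \<open>Inf ?C \<in> ?C\<close> assms by (intro null_setsI mu_level) auto
  then have "{x. 0 < x \<and> K x = u} \<in> null_sets \<mu>"
    by (intro null_sets_subset [OF null_sets.Un [OF _ singleton_null] _ sub]) auto
  then show ?thesis by (rule null_setsD1)
qed

end

section \<open>The functions attached to the target law\<close>

text \<open>Reflection turns \<open>G\<close> and \<open>\<psi>\<^sub>-\<close> into \<open>D\<close> and \<open>\<psi>\<^sub>+\<close>, so that only the right half-line has to be treated.\<close>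

definition mirror :: "real measure \<Rightarrow> real measure" where
  "mirror N = distr N borel uminus"

lemma sets_mirror [measurable_cong, simp]: "sets (mirror N) = sets borel"
  by (simp add: mirror_def)

lemma space_mirror [simp]: "space (mirror N) = UNIV"
  by (simp add: mirror_def)

lemma emeasure_mirror:
  "sets N = sets borel \<Longrightarrow> A \<in> sets borel \<Longrightarrow> emeasure (mirror N) A = emeasure N {x. - x \<in> A}"
  unfolding mirror_def using sets_eq_imp_space_eq [of N borel]
  by (subst emeasure_distr) (auto simp: vimage_def cong: measurable_cong_sets)

lemma mirror_mirror: "sets N = sets borel \<Longrightarrow> mirror (mirror N) = N"
  by (rule measure_eqI) (simp_all add: emeasure_mirror)

lemma nn_integral_mirror:
  "sets N = sets borel \<Longrightarrow> g \<in> borel_measurable borel \<Longrightarrow> (\<integral>\<^sup>+x. g x \<partial>mirror N) = (\<integral>\<^sup>+x. g (- x) \<partial>N)"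
  unfolding mirror_def by (subst nn_integral_distr) (auto cong: measurable_cong_sets)

lemma support_mirror: "sets N = sets borel \<Longrightarrow> x \<in> measure_support (mirror N) \<longleftrightarrow> - x \<in> measure_support N"
proof -
  assume N: "sets N = sets borel"
  have *: "- x \<in> measure_support N" if "x \<in> measure_support (mirror N)" "sets N = sets borel" for x N
    unfolding measure_support_def
  proof (intro CollectI allI impI)
    fix U :: "real set" assume "open U" "- x \<in> U"
    moreover have "uminus ` U = {y. - y \<in> U}" by (auto simp: image_iff) (metis minus_minus)
    ultimately have "0 < emeasure (mirror N) {y. - y \<in> U}"
      using that open_negations [of U] unfolding measure_support_def by auto
    moreover have "{y. - y \<in> U} \<in> sets borel"
      using \<open>open U\<close> open_negations [of U] \<open>uminus ` U = {y. - y \<in> U}\<close> by simp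
    ultimately show "0 < emeasure N U" using that by (simp add: emeasure_mirror)
  qed
  show ?thesis
    using * [of x N] * [of "- x" "mirror N"] N by (auto simp: mirror_mirror)
qed

lemma tail_measurable [measurable]:
  fixes N :: "real measure"
  assumes "sigma_finite_measure N" "sets N = sets borel"
  shows "(\<lambda>s. emeasure N {s..}) \<in> borel_measurable borel"
proof -
  interpret sigma_finite_measure N by fact
  note assms(2) [measurable_cong]
  have "{x \<in> space (borel \<Otimes>\<^sub>M N). fst x \<le> snd x} \<in> sets (borel \<Otimes>\<^sub>M N)" by measurable
  from measurable_emeasure_Pair [OF this] show ?thesis
    using sets_eq_imp_space_eq [OF assms(2)] by (simp add: vimage_def space_pair_measure atLeast_def)
qed

text \<open>\<open>\<nu>\<close> stands for the characteristic measure of the functional. The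
  assumptions are symmetric under reflection, and \<open>\<nu>\<close> may be infinite near
  0.\<close>

locale target = prob_space \<mu> for \<mu> :: "real measure" +
  fixes \<nu> :: "real measure"
  assumes mu_sets [measurable_cong, simp]: "sets \<mu> = sets borel"
    and nu_sets [measurable_cong, simp]: "sets \<nu> = sets borel"
    and nu_sigma_finite: "sigma_finite_measure \<nu>"
    and mu_atomless: "emeasure \<mu> {x} = 0"
    and nu_support: "x \<in> measure_support \<mu> \<Longrightarrow> y \<in> measure_support \<mu> \<Longrightarrow>
      0 < emeasure \<nu> {..x} * emeasure \<nu> {y..}"
    and nu_finite: "0 < c \<Longrightarrow> emeasure \<nu> {c..} < \<infinity>" "0 < c \<Longrightarrow> emeasure \<nu> {..-c} < \<infinity>"
begin

lemma mu_space [simp]: "space \<mu> = UNIV"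
  using sets_eq_imp_space_eq [OF mu_sets] by simp

lemma nu_space [simp]: "space \<nu> = UNIV"
  using sets_eq_imp_space_eq [OF nu_sets] by simp

lemma target_mirror: "target (mirror \<mu>) (mirror \<nu>)"
proof -
  interpret m: prob_space "mirror \<mu>"
    unfolding mirror_def by (rule prob_space_distr) simp
  interpret nu: sigma_finite_measure \<nu> by (rule nu_sigma_finite)
  interpret m\<nu>: sigma_finite_measure "mirror \<nu>"
    proof -
      obtain A :: "nat \<Rightarrow> real set" where A: "range A \<subseteq> sets \<nu>" "(\<Union>i. A i) = space \<nu>" "\<And>i. emeasure \<nu> (A i) \<noteq> \<infinity>"
        using nu.sigma_finite by blast
      define B where "B i = {y. - y \<in> A i}" for i
      have *: "A i \<in> sets borel" for i using A(1) by auto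
      have B: "B i \<in> sets borel" for i
        unfolding B_def using measurable_sets [OF borel_measurable_uminus [OF measurable_ident] *, of i] by (simp add: vimage_def)
      show "sigma_finite_measure (mirror \<nu>)"
      proof
        show "\<exists>F. countable F \<and> F \<subseteq> sets (mirror \<nu>) \<and> \<Union>F = space (mirror \<nu>) \<and> (\<forall>a\<in>F. emeasure (mirror \<nu>) a \<noteq> \<infinity>)"
        proof (intro exI conjI ballI)
          show "countable (range B)" by simp
          show "range B \<subseteq> sets (mirror \<nu>)" using B by auto
          show "\<Union>(range B) = space (mirror \<nu>)" using A(2) by (fastforce simp: B_def)
          fix a assume "a \<in> range B"
          then obtain i where "a = B i" by auto
          then show "emeasure (mirror \<nu>) a \<noteq> \<infinity>"
            using emeasure_mirror [OF nu_sets B, of i] A(3) [of i] by (simp add: B_def)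
        qed
      qed
    qed
  show ?thesis
  proof
    have "{y. - y \<in> {x}} = {- x}" for x :: real by auto
    then show "emeasure (mirror \<mu>) {x} = 0" for x by (simp add: emeasure_mirror mu_atomless)
    have le: "{x. - x \<in> {..y}} = {-y..}" "{x. - x \<in> {y..}} = {..-y}" for y :: real by auto
    show "0 < emeasure (mirror \<nu>) {..x} * emeasure (mirror \<nu>) {y..}"
      if "x \<in> measure_support (mirror \<mu>)" "y \<in> measure_support (mirror \<mu>)" for x y
      using nu_support [of "- y" "- x"] that le
      by (simp add: support_mirror emeasure_mirror mult.commute)
    show "emeasure (mirror \<nu>) {c..} < \<infinity>" if "0 < c" for c
      using nu_finite [OF that] le by (simp add: emeasure_mirror)
    show "emeasure (mirror \<nu>) {..-c} < \<infinity>" if "0 < c" for c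
      using nu_finite [OF that] le [of "- c"] by (simp add: emeasure_mirror atLeast_def)
  qed simp_all
qed

definition D :: "real \<Rightarrow> ennreal" where "D y = D_fun \<mu> \<nu> (ereal y)"

lemma nu_tail_pos:
  assumes "0 < emeasure \<mu> {y<..}" obtains x where "y < x" "0 < emeasure \<nu> {x..}"
proof -
  obtain x where "x \<in> {y<..}" "x \<in> measure_support \<mu>"
    using open_meets_support [of "{y<..}" \<mu>] assms by auto
  then show thesis using nu_support [of x x] that [of x] by (auto simp: zero_less_iff_neq_zero)
qed

lemma nu_tail_measurable [measurable]: "(\<lambda>s. emeasure \<nu> {s..}) \<in> borel_measurable borel"
  by (intro tail_measurable nu_sigma_finite nu_sets)

lemma inverse_antimono_ennreal: "a \<le> b \<Longrightarrow> 1 / b \<le> 1 / (a::ennreal)"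
proof (cases a rule: ennreal_cases)
  case (real r)
  show "1 / b \<le> 1 / a" if "a \<le> b"
  proof (cases b rule: ennreal_cases)
    case (real s)
    then show ?thesis
      using that \<open>a = ennreal r\<close> \<open>0 \<le> r\<close>
      by (cases "r = 0") (auto simp: divide_ennreal simp flip: ennreal_1 intro!: ennreal_leI frac_le)
  qed simp
qed (simp add: top_unique)

lemma bounded_weight_finite:
  assumes "\<And>s. s \<in> {0..y} \<Longrightarrow> g s \<le> c" "c < \<infinity>"
  shows "(\<integral>\<^sup>+s\<in>{0..y}. g s \<partial>\<mu>) < (\<infinity>::ennreal)"
proof -
  have "(\<integral>\<^sup>+s\<in>{0..y}. g s \<partial>\<mu>) \<le> (\<integral>\<^sup>+s. c \<partial>\<mu>)"
    using assms(1) by (intro nn_integral_mono) (auto simp: indicator_def)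
  also have "\<dots> = c" by (simp add: emeasure_space_1 [simplified])
  finally show ?thesis using assms(2) by (rule order.strict_trans1)
qed

text \<open>The weight grows with \<open>s\<close>, so up to \<open>y\<close> it is bounded by its
  value at a point beyond \<open>y\<close> whose \<open>\<nu>\<close>-tail is positive. Positivity
  is claimed for \<open>s > 0\<close> only, since \<open>emeasure \<nu> {0..}\<close> may be
  infinite.\<close>

sublocale D: weight \<mu> "\<lambda>s. 1 / emeasure \<nu> {s..}"
  rewrites "weight.K \<mu> (\<lambda>s. 1 / emeasure \<nu> {s..}) = D"
proof -
  show *: "weight \<mu> (\<lambda>s. 1 / emeasure \<nu> {s..})"
  proof
    show "0 < 1 / emeasure \<nu> {s..}" if "0 < s" for s
      using nu_finite(1) [OF that] by (simp add: ennreal_zero_less_divide less_top)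
    fix y assume "0 < emeasure \<mu> {y<..}"
    then obtain x where x: "y < x" "0 < emeasure \<nu> {x..}" by (rule nu_tail_pos)
    show "(\<integral>\<^sup>+s\<in>{0..y}. (1 / emeasure \<nu> {s..}) \<partial>\<mu>) < \<infinity>"
    proof (rule bounded_weight_finite)
      show "1 / emeasure \<nu> {s..} \<le> 1 / emeasure \<nu> {x..}" if "s \<in> {0..y}" for s
        using that x by (intro inverse_antimono_ennreal emeasure_mono) auto
      show "1 / emeasure \<nu> {x..} < \<infinity>" using x by (simp add: ennreal_divide_eq_top_iff less_top [symmetric])
    qed
  qed (simp_all add: mu_atomless)
  show "weight.K \<mu> (\<lambda>s. 1 / emeasure \<nu> {s..}) = D"
    unfolding weight.K_def [OF *] D_def D_fun_def by (auto simp: fun_eq_iff indicator_def intro!: nn_integral_cong)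
qed

lemma D_eq: "D y = D_fun \<mu> \<nu> (ereal y)" by (simp add: D_def)

abbreviation D' where "D' \<equiv> target.D (mirror \<mu>) (mirror \<nu>)"

lemma D'_measurable [measurable]: "D' \<in> borel_measurable borel"
proof -
  interpret m: target "mirror \<mu>" "mirror \<nu>" by (rule target_mirror)
  show ?thesis by (rule m.D.K_measurable)
qed

lemma D'_mono: "x \<le> y \<Longrightarrow> D' x \<le> D' y"
proof -
  interpret m: target "mirror \<mu>" "mirror \<nu>" by (rule target_mirror)
  show "x \<le> y \<Longrightarrow> D' x \<le> D' y" by (rule m.D.K_mono)
qed

lemma G_fun_mirror: "G_fun \<mu> \<nu> x = D_fun (mirror \<mu>) (mirror \<nu>) (- x)"
proof -
  interpret m: target "mirror \<mu>" "mirror \<nu>" by (rule target_mirror)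
  have [measurable]: "{s. 0 \<le> s \<and> ereal s \<le> - x} \<in> sets borel" by measurable
  have "(\<integral>\<^sup>+s\<in>{s. 0 \<le> s \<and> ereal s \<le> - x}. (1 / emeasure (mirror \<nu>) {s..}) \<partial>mirror \<mu>) =
    (\<integral>\<^sup>+s. 1 / emeasure (mirror \<nu>) {-s..} * indicator {s. 0 \<le> s \<and> ereal s \<le> - x} (- s) \<partial>\<mu>)"
    by (subst nn_integral_mirror) (simp_all add: m.nu_tail_measurable)
  also have "\<dots> = G_fun \<mu> \<nu> x"
    unfolding G_fun_def
  proof (rule nn_integral_cong)
    fix s :: real
    have "{y. - y \<in> {- s..}} = {..s}" by auto
    moreover have "ereal (- s) \<le> - x \<longleftrightarrow> x \<le> ereal s"
      by (metis ereal_minus_le_minus uminus_ereal.simps(1))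
    ultimately show "1 / emeasure (mirror \<nu>) {-s..} * indicator {s. 0 \<le> s \<and> ereal s \<le> - x} (- s) =
      1 / emeasure \<nu> {..s} * indicator {s. x \<le> ereal s \<and> s \<le> 0} s"
      by (auto simp: emeasure_mirror indicator_def)
  qed
  finally show ?thesis by (simp add: D_fun_def)
qed

lemma G_fun_real: "G_fun \<mu> \<nu> (ereal x) = D' (- x)"
proof -
  interpret m: target "mirror \<mu>" "mirror \<nu>" by (rule target_mirror)
  show ?thesis by (simp add: G_fun_mirror m.D_eq)
qed

lemma AE_not_in_open:
  assumes U: "open U" and disj: "U \<inter> measure_support \<mu> = {}" shows "AE s in \<mu>. s \<notin> U"
proof (rule AE_not_in, rule null_setsI)
  show "emeasure \<mu> U = 0"
  proof (rule ccontr)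
    assume "emeasure \<mu> U \<noteq> 0"
    then have "0 < emeasure \<mu> U" by (simp add: zero_less_iff_neq_zero)
    from U this mu_sets obtain x where "x \<in> U" "x \<in> measure_support \<mu>" by (rule open_meets_support)
    then show False using disj by blast
  qed
qed (use U in simp)

lemma below_supp_lower: "AE s in \<mu>. supp_lower \<mu> \<le> ereal s"
proof -
  have "AE s in \<mu>. s \<notin> {s. ereal s < supp_lower \<mu>}"
  proof (rule AE_not_in_open)
    show "open {s. ereal s < supp_lower \<mu>}" by (intro open_Collect_less continuous_intros continuous_on_ereal)
    show "{s. ereal s < supp_lower \<mu>} \<inter> measure_support \<mu> = {}"
    proof (rule equals0I)
      fix x assume x: "x \<in> {s. ereal s < supp_lower \<mu>} \<inter> measure_support \<mu>"
      then have "supp_lower \<mu> \<le> ereal x" unfolding supp_lower_def by (intro Inf_lower) auto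
      then show False using x by auto
    qed
  qed
  then show ?thesis by (simp add: not_less)
qed

lemma above_supp_upper: "AE s in \<mu>. ereal s \<le> supp_upper \<mu>"
proof -
  have "AE s in \<mu>. s \<notin> {s. supp_upper \<mu> < ereal s}"
  proof (rule AE_not_in_open)
    show "open {s. supp_upper \<mu> < ereal s}" by (intro open_Collect_less continuous_intros continuous_on_ereal)
    show "{s. supp_upper \<mu> < ereal s} \<inter> measure_support \<mu> = {}"
    proof (rule equals0I)
      fix x assume x: "x \<in> {s. supp_upper \<mu> < ereal s} \<inter> measure_support \<mu>"
      then have "ereal x \<le> supp_upper \<mu>" unfolding supp_upper_def by (intro Sup_upper) auto
      then show False using x by auto
    qed
  qed
  then show ?thesis by (simp add: not_less)
qed

text \<open>The default value is consistent with the supremum: beyond the support nothing is added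
  to \<open>G_fun\<close>, so in the first branch the set is empty and its supremum in the extended
  reals is -\<infinity>.\<close>

lemma G_inv_eq: "G_inv \<mu> \<nu> v = Sup {ereal x | x. x \<le> 0 \<and> v < D' (- x)}"
proof (cases "G_fun \<mu> \<nu> (supp_lower \<mu>) \<le> v")
  case True
  have "G_fun \<mu> \<nu> (ereal x) \<le> G_fun \<mu> \<nu> (supp_lower \<mu>)" for x
    unfolding G_fun_def
  proof (rule nn_integral_mono_AE)
    show "AE s in \<mu>. 1 / emeasure \<nu> {..s} * indicator {s. ereal x \<le> ereal s \<and> s \<le> 0} s
        \<le> 1 / emeasure \<nu> {..s} * indicator {s. supp_lower \<mu> \<le> ereal s \<and> s \<le> 0} s"
      using below_supp_lower by eventually_elim (auto simp: indicator_def)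
  qed
  then have "D' (- x) \<le> v" for x using True unfolding G_fun_real [symmetric] by (rule order_trans)
  then have *: "{ereal x | x. x \<le> 0 \<and> v < D' (- x)} = {}" by (auto simp: not_less)
  show ?thesis unfolding * using True by (simp add: G_inv_def bot_ereal_def)
next
  case False
  then show ?thesis by (simp add: G_inv_def G_fun_real)
qed

text \<open>The denominators in \<open>\<psi>\<^sub>+\<close> and \<open>\<psi>\<^sub>-\<close> are values of one function \<open>Q\<close>: the \<open>\<mu>\<close>-mass of the points at
  which \<open>D\<close> (on the right) or \<open>G\<close> (on the left) exceeds a given level.\<close>

definition Q1 :: "ennreal \<Rightarrow> ennreal" where "Q1 u = emeasure \<mu> {x. 0 < x \<and> u < D x}"

lemma Q1_measurable [measurable]: "Q1 \<in> borel_measurable borel"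
proof -
  have "{p \<in> space (borel \<Otimes>\<^sub>M \<mu>). 0 < snd p \<and> fst p < D (snd p)} \<in> sets (borel \<Otimes>\<^sub>M \<mu>)"
    by measurable
  from measurable_emeasure_Pair [OF this] show ?thesis
    by (simp add: Q1_def [abs_def] vimage_def space_pair_measure)
qed

abbreviation Q1' where "Q1' \<equiv> target.Q1 (mirror \<mu>) (mirror \<nu>)"

lemma Q1'_measurable [measurable]: "Q1' \<in> borel_measurable borel"
proof -
  interpret m: target "mirror \<mu>" "mirror \<nu>" by (rule target_mirror)
  show ?thesis by (rule m.Q1_measurable)
qed

lemma Q1'_eq: "Q1' u = emeasure \<mu> {x. x < 0 \<and> u < D' (- x)}"
proof -
  interpret m: target "mirror \<mu>" "mirror \<nu>" by (rule target_mirror)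
  have "{x. 0 < x \<and> u < D' x} \<in> sets borel" by measurable
  then show ?thesis unfolding m.Q1_def by (subst emeasure_mirror) auto
qed

definition d :: "real \<Rightarrow> real" where
  "d s = 1 + tail \<mu> (ereal s) - tail \<mu> (G_inv \<mu> \<nu> (D_fun \<mu> \<nu> (ereal s)))"

text \<open>\<open>G_inv\<close> at \<open>D s\<close> is the right end of the left half-line on
  which \<open>G_fun\<close> exceeds \<open>D s\<close>. As this end point is null, one minus the
  tail there is the mass of that half-line.\<close>

lemma d_eq: "ennreal (d s) = emeasure \<mu> {s..} + Q1' (D s)"
proof -
  define v where "v = D s"
  define g where "g = G_inv \<mu> \<nu> v"
  have [measurable]: "{x. ereal x < g} \<in> sets borel" "{x. x < 0 \<and> v < D' (- x)} \<in> sets borel" by measurable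
  have "tail \<mu> g = 1 - measure \<mu> {x. ereal x < g}"
    unfolding tail_def by (subst prob_compl [symmetric]) (auto intro!: arg_cong [where f="measure \<mu>"])
  also have "measure \<mu> {x. ereal x < g} = measure \<mu> {x. x < 0 \<and> v < D' (- x)}"
  proof (rule measure_eq_AE)
    have "AE x in \<mu>. x \<noteq> real_of_ereal g" using AE_not_in [OF D.singleton_null] by simp
    then show "AE x in \<mu>. x \<in> {x. ereal x < g} \<longleftrightarrow> x \<in> {x. x < 0 \<and> v < D' (- x)}"
    proof eventually_elim
      case (elim x)
      show ?case
      proof
        assume "x \<in> {x. ereal x < g}"
        then obtain y where y: "x < y" "y \<le> 0" "v < D' (- y)"
          by (auto simp: g_def G_inv_eq less_Sup_iff)
        then show "x \<in> {x. x < 0 \<and> v < D' (- x)}"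
          using D'_mono [of "- y" "- x"] by (auto intro: less_le_trans)
      next
        assume "x \<in> {x. x < 0 \<and> v < D' (- x)}"
        then have "ereal x \<le> g" unfolding g_def G_inv_eq by (intro Sup_upper) auto
        moreover have "ereal x \<noteq> g" using elim by auto
        ultimately show "x \<in> {x. ereal x < g}" by simp
      qed
    qed
  qed (simp_all)
  finally have "d s = measure \<mu> {s..} + measure \<mu> {x. x < 0 \<and> v < D' (- x)}"
    unfolding d_def g_def v_def D_eq by (simp add: tail_def atLeast_def)
  then show ?thesis by (simp add: Q1'_eq v_def emeasure_eq_measure)
qed

lemma d_measurable [measurable]: "(\<lambda>s. ennreal (d s)) \<in> borel_measurable borel"
proof -
  have "(\<lambda>s. emeasure \<mu> {s..}) \<in> borel_measurable borel"
    by (intro tail_measurable mu_sets) unfold_locales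
  then show ?thesis unfolding d_eq by measurable
qed

definition Q :: "ennreal \<Rightarrow> ennreal" where "Q u = Q1 u + Q1' u"

lemma Q_measurable [measurable]: "Q \<in> borel_measurable borel"
  unfolding Q_def by measurable

lemma mirror_mirror_simps [simp]: "mirror (mirror \<mu>) = \<mu>" "mirror (mirror \<nu>) = \<nu>"
  by (simp_all add: mirror_mirror)

lemma Q_mirror: "target.Q (mirror \<mu>) (mirror \<nu>) u = Q u"
proof -
  interpret m: target "mirror \<mu>" "mirror \<nu>" by (rule target_mirror)
  show ?thesis unfolding m.Q_def Q_def by (simp add: add.commute)
qed

lemma Q_le_1: "Q u \<le> 1"
proof -
  have "Q u = emeasure \<mu> ({x. 0 < x \<and> u < D x} \<union> {x. x < 0 \<and> u < D' (- x)})"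
    unfolding Q_def Q1'_eq Q1_def by (rule plus_emeasure) auto
  then show ?thesis using emeasure_le_1 by simp
qed

text \<open>The set \<open>{s..}\<close> exceeds \<open>{x. D s < D x}\<close> only by
  \<open>s\<close> and the flat stretch of \<open>D\<close> behind it, both null.\<close>

lemma d_eq_Q: "0 \<le> s \<Longrightarrow> D s < \<infinity> \<Longrightarrow> ennreal (d s) = Q (D s)"
proof -
  assume s: "0 \<le> s" "D s < \<infinity>"
  have "AE x in \<mu>. x \<notin> {x. s < x \<and> D x = D s}"
    using D.mu_level [OF s] by (intro AE_not_in null_setsI) auto
  moreover have "AE x in \<mu>. x \<noteq> s" using AE_not_in [OF D.singleton_null] by simp
  ultimately have "AE x in \<mu>. x \<in> {s..} \<longleftrightarrow> x \<in> {x. 0 < x \<and> D s < D x}"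
  proof eventually_elim
    case (elim x)
    show ?case
    proof (cases "s \<le> x")
      case True then show ?thesis using elim D.K_mono [of s x] s by (auto simp: less_le)
    next
      case False then show ?thesis using D.K_mono [of x s] by (auto simp: not_le)
    qed
  qed
  then have "emeasure \<mu> {s..} = Q1 (D s)"
    unfolding Q1_def by (intro emeasure_eq_AE) auto
  then show ?thesis by (simp add: d_eq Q_def)
qed

lemma psi_plus_eq: "psi_plus \<mu> \<nu> y = (\<integral>\<^sup>+s\<in>{0..y}. (1 / (emeasure \<nu> {s..} * ennreal (d s))) \<partial>\<mu>)"
  by (simp add: psi_plus_def d_def)

lemma d_ge: "emeasure \<mu> {s..} \<le> ennreal (d s)"
  by (simp add: d_eq)

text \<open>The second factor of the denominator is kept away from 0 by \<open>d_ge\<close>: for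
  \<open>s \<le> y\<close> it is at least the mass beyond some fixed \<open>x > y\<close>.\<close>

sublocale psi: weight \<mu> "\<lambda>s. 1 / (emeasure \<nu> {s..} * ennreal (d s))"
  rewrites "weight.K \<mu> (\<lambda>s. 1 / (emeasure \<nu> {s..} * ennreal (d s))) = psi_plus \<mu> \<nu>"
proof -
  show *: "weight \<mu> (\<lambda>s. 1 / (emeasure \<nu> {s..} * ennreal (d s)))"
  proof
    show "0 < 1 / (emeasure \<nu> {s..} * ennreal (d s))" if "0 < s" for s
      using nu_finite(1) [OF that] by (simp add: ennreal_zero_less_divide ennreal_mult_less_top less_top)
    fix y assume "0 < emeasure \<mu> {y<..}"
    then obtain x where x: "y < x" "0 < emeasure \<mu> {x<..}" by (rule D.Greater_emeasure_pos)
    then obtain x' where x': "x < x'" "0 < emeasure \<nu> {x'..}" by (metis nu_tail_pos)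
    show "(\<integral>\<^sup>+s\<in>{0..y}. (1 / (emeasure \<nu> {s..} * ennreal (d s))) \<partial>\<mu>) < \<infinity>"
    proof (rule bounded_weight_finite)
      fix s assume s: "s \<in> {0..y}"
      have "emeasure \<mu> {x<..} \<le> emeasure \<mu> {s..}" using s x by (intro emeasure_mono) auto
      also have "\<dots> \<le> ennreal (d s)" by (rule d_ge)
      finally have "emeasure \<mu> {x<..} \<le> ennreal (d s)" .
      then show "1 / (emeasure \<nu> {s..} * ennreal (d s)) \<le> 1 / (emeasure \<nu> {x'..} * emeasure \<mu> {x<..})"
        using s x x' by (intro inverse_antimono_ennreal mult_mono emeasure_mono) auto
    next
      show "1 / (emeasure \<nu> {x'..} * emeasure \<mu> {x<..}) < \<infinity>"
        using x x' by (simp add: ennreal_divide_eq_top_iff less_top [symmetric] zero_less_iff_neq_zero)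
    qed
  qed (simp_all add: mu_atomless)
  show "weight.K \<mu> (\<lambda>s. 1 / (emeasure \<nu> {s..} * ennreal (d s))) = psi_plus \<mu> \<nu>"
    unfolding weight.K_def [OF *] by (simp add: fun_eq_iff psi_plus_eq)
qed

text \<open>\<open>Psi\<close> is the common change of clock: \<open>\<psi>\<^sub>+ = Psi \<circ> D\<close> and \<open>\<psi>\<^sub>- = Psi \<circ> G\<close>.\<close>

definition Psi :: "real \<Rightarrow> ennreal" where
  "Psi v = (\<integral>\<^sup>+u\<in>{0..v}. (1 / Q (ennreal u)) \<partial>lborel)"

abbreviation \<psi> where "\<psi> \<equiv> psi_plus \<mu> \<nu>"
abbreviation \<psi>' where "\<psi>' \<equiv> psi_plus (mirror \<mu>) (mirror \<nu>)"

lemma Psi_mirror: "target.Psi (mirror \<mu>) (mirror \<nu>) v = Psi v"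
proof -
  interpret m: target "mirror \<mu>" "mirror \<nu>" by (rule target_mirror)
  show ?thesis unfolding m.Psi_def Psi_def Q_mirror ..
qed

text \<open>This is the substitution \<open>u = D s\<close> in \<open>Psi\<close>:
  \<open>nn_integral_K\<close> supplies the factor \<open>1 / emeasure \<nu> {s..}\<close>, and
  \<open>Q (D s)\<close> is the denominator by \<open>d_eq_Q\<close>.\<close>

lemma psi_Psi:
  assumes "0 \<le> y" "0 < emeasure \<mu> {y<..}"
  shows "\<psi> y = Psi (enn2real (D y))"
proof -
  have Dy: "D y < \<infinity>" using assms(2) by (rule D.K_finite)
  have "Psi (enn2real (D y)) = (\<integral>\<^sup>+s\<in>{0..y}. 1 / Q (D s) * (1 / emeasure \<nu> {s..}) \<partial>\<mu>)"
    unfolding Psi_def using D.nn_integral_K [OF assms(1) Dy, of "\<lambda>u. 1 / Q u"] by simp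
  also have "\<dots> = \<psi> y"
    unfolding psi_plus_eq
  proof (rule nn_integral_cong_AE)
    \<comment> \<open>At 0 the tail of \<open>\<nu>\<close> may be infinite, and then the inverse of
      the product need not split.\<close>
    have "AE s in \<mu>. s \<noteq> 0" using AE_not_in [OF D.singleton_null] by simp
    then show "AE s in \<mu>. 1 / Q (D s) * (1 / emeasure \<nu> {s..}) * indicator {0..y} s =
        1 / (emeasure \<nu> {s..} * ennreal (d s)) * indicator {0..y} s"
    proof eventually_elim
      case (elim s)
      show ?case
      proof (cases "s \<in> {0..y}")
        case True
        then have s: "0 < s" "s \<le> y" using elim by auto
        have "D s < \<infinity>" using D.K_mono [OF s(2)] Dy by (rule order.strict_trans1)
        then have "ennreal (d s) = Q (D s)" using s by (intro d_eq_Q) auto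
        moreover have "emeasure \<nu> {s..} < top" using nu_finite(1) [OF s(1)] by simp
        moreover have "Q (D s) < top" using Q_le_1 by (rule order.strict_trans1) simp
        ultimately show ?thesis
          by (simp add: divide_ennreal_def ennreal_inverse_mult mult.commute)
      qed simp
    qed
  qed
  finally show ?thesis by simp
qed

lemma Psi_mono: "v \<le> v' \<Longrightarrow> Psi v \<le> Psi v'"
  unfolding Psi_def by (intro nn_integral_mono) (auto simp: indicator_def)

text \<open>As \<open>Q \<le> 1\<close>, the integrand is at least 1, so \<open>Psi\<close>
  increases by at least \<open>v' - v\<close>.\<close>

lemma Psi_strict: assumes "0 \<le> v" "v < v'" "Psi v < \<infinity>" shows "Psi v < Psi v'"
proof -
  have "Psi v < Psi v + ennreal (v' - v)"
    using assms by (simp add: less_top ennreal_add_left_cancel_less [where b=0, simplified])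
  also have "ennreal (v' - v) = (\<integral>\<^sup>+u. indicator {v<..v'} u \<partial>lborel)"
    using assms by simp
  also have "Psi v + \<dots> = (\<integral>\<^sup>+u. 1 / Q (ennreal u) * indicator {0..v} u + indicator {v<..v'} u \<partial>lborel)"
    unfolding Psi_def by (subst nn_integral_add) auto
  also have "\<dots> \<le> Psi v'"
    unfolding Psi_def
  proof (rule nn_integral_mono)
    fix u :: real
    have "1 \<le> 1 / Q (ennreal u)" using inverse_antimono_ennreal [OF Q_le_1] by simp
    then show "1 / Q (ennreal u) * indicator {0..v} u + indicator {v<..v'} u \<le> 1 / Q (ennreal u) * indicator {0..v'} u"
      using assms by (auto simp: indicator_def)
  qed
  finally show ?thesis .
qed

lemma Psi_less_iff: "0 \<le> v \<Longrightarrow> Psi v < \<infinity> \<Longrightarrow> Psi v < Psi v' \<longleftrightarrow> v < v'"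
  using Psi_strict Psi_mono by (meson not_less)

lemma enn2real_less_iff: "a < \<infinity> \<Longrightarrow> b < \<infinity> \<Longrightarrow> enn2real a < enn2real b \<longleftrightarrow> a < (b::ennreal)"
  by (cases a; cases b) (auto simp: ennreal_less_iff)

lemma psi_less_iff:
  assumes "0 \<le> x" "0 < emeasure \<mu> {x<..}" "0 \<le> y" "0 < emeasure \<mu> {y<..}"
  shows "\<psi> x < \<psi> y \<longleftrightarrow> D x < D y"
  using psi.K_finite [OF assms(2)] D.K_finite [OF assms(2)] D.K_finite [OF assms(4)]
  by (simp add: psi_Psi assms Psi_less_iff enn2real_less_iff)

text \<open>Both sides run on the same strictly increasing clock \<open>Psi\<close>, so values on
  opposite half-lines compare as those of \<open>D\<close> and \<open>D'\<close> do. This is what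
  allows \<open>Q\<close> to be rewritten as \<open>S\<close>.\<close>

lemma psi_less_iff':
  assumes "0 \<le> x" "0 < emeasure \<mu> {x<..}" "0 \<le> y" "0 < emeasure (mirror \<mu>) {y<..}"
  shows "\<psi> x < \<psi>' y \<longleftrightarrow> D x < D' y"
proof -
  interpret m: target "mirror \<mu>" "mirror \<nu>" by (rule target_mirror)
  show ?thesis
    using psi.K_finite [OF assms(2)] D.K_finite [OF assms(2)] m.D.K_finite [OF assms(4)]
    by (simp add: psi_Psi m.psi_Psi assms Psi_mirror Psi_less_iff enn2real_less_iff)
qed

lemma psi'_measurable [measurable]: "\<psi>' \<in> borel_measurable borel"
proof -
  interpret m: target "mirror \<mu>" "mirror \<nu>" by (rule target_mirror)
  show ?thesis by (rule m.psi.K_measurable)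
qed

text \<open>\<open>S\<close> is \<open>Q\<close> read on the scale of \<open>\<psi>\<close>, which will be that of local time.\<close>

definition S1 :: "ennreal \<Rightarrow> ennreal" where "S1 u = emeasure \<mu> {x. 0 < x \<and> u < \<psi> x}"

abbreviation S1' where "S1' \<equiv> target.S1 (mirror \<mu>) (mirror \<nu>)"

definition S :: "ennreal \<Rightarrow> ennreal" where "S u = S1 u + S1' u"

lemma S1_antimono: "u \<le> v \<Longrightarrow> S1 v \<le> S1 u"
  unfolding S1_def by (intro emeasure_mono) auto

lemma S_antimono: "u \<le> v \<Longrightarrow> S v \<le> S u"
proof -
  interpret m: target "mirror \<mu>" "mirror \<nu>" by (rule target_mirror)
  show "u \<le> v \<Longrightarrow> S v \<le> S u" unfolding S_def by (intro add_mono S1_antimono m.S1_antimono)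
qed

lemma S1_measurable [measurable]: "S1 \<in> borel_measurable borel"
proof -
  have "{p \<in> space (borel \<Otimes>\<^sub>M \<mu>). 0 < snd p \<and> fst p < \<psi> (snd p)} \<in> sets (borel \<Otimes>\<^sub>M \<mu>)"
    by measurable
  from measurable_emeasure_Pair [OF this] show ?thesis
    by (simp add: S1_def [abs_def] vimage_def space_pair_measure)
qed

lemma S_measurable [measurable]: "S \<in> borel_measurable borel"
proof -
  interpret m: target "mirror \<mu>" "mirror \<nu>" by (rule target_mirror)
  show ?thesis unfolding S_def [abs_def] using m.S1_measurable by measurable
qed

lemma S1'_eq: "S1' u = emeasure \<mu> {x. x < 0 \<and> u < \<psi>' (- x)}"
proof -
  interpret m: target "mirror \<mu>" "mirror \<nu>" by (rule target_mirror)
  have "{x. 0 < x \<and> u < \<psi>' x} \<in> sets borel" by measurable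
  then show ?thesis unfolding m.S1_def by (subst emeasure_mirror) auto
qed

lemma Q_eq_S:
  assumes "0 \<le> s" "0 < emeasure \<mu> {s<..}"
  shows "Q (D s) = S (\<psi> s)"
proof -
  interpret m: target "mirror \<mu>" "mirror \<nu>" by (rule target_mirror)
  have "Q1 (D s) = S1 (\<psi> s)"
    unfolding Q1_def S1_def
  proof (rule emeasure_eq_AE)
    show "AE x in \<mu>. x \<in> {x. 0 < x \<and> D s < D x} \<longleftrightarrow> x \<in> {x. 0 < x \<and> \<psi> s < \<psi> x}"
      using D.AE_tail_pos by eventually_elim (auto simp: psi_less_iff assms)
  qed auto
  moreover have "Q1' (D s) = S1' (\<psi> s)"
    unfolding m.Q1_def m.S1_def
  proof (rule emeasure_eq_AE)
    show "AE x in mirror \<mu>. x \<in> {x. 0 < x \<and> D s < D' x} \<longleftrightarrow> x \<in> {x. 0 < x \<and> \<psi> s < \<psi>' x}"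
      using m.D.AE_tail_pos by eventually_elim (auto simp: psi_less_iff' assms)
  qed auto
  ultimately show ?thesis by (simp add: Q_def S_def)
qed

text \<open>So \<open>\<psi>\<close> solves a self-consistent equation: its density is
  \<open>1 / (emeasure \<nu> {s..} * S (\<psi> s))\<close>, with \<open>S\<close> itself built from
  \<open>\<psi>\<close> and \<open>\<psi>'\<close>.\<close>

lemma d_eq_S:
  assumes "0 \<le> s" "0 < emeasure \<mu> {s<..}" shows "ennreal (d s) = S (\<psi> s)"
  using d_eq_Q [OF assms(1) D.K_finite [OF assms(2)]] Q_eq_S [OF assms] by simp

lemma S_pos:
  assumes "0 \<le> s" "0 < emeasure \<mu> {s<..}" shows "0 < S (\<psi> s)"
proof -
  have "emeasure \<mu> {s<..} \<le> emeasure \<mu> {s..}" by (intro emeasure_mono) auto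
  also have "\<dots> \<le> S (\<psi> s)" unfolding d_eq_S [OF assms, symmetric] by (rule d_ge)
  finally show ?thesis using assms(2) by (rule order.strict_trans2 [rotated])
qed

lemma S_le_1: "S u \<le> 1"
proof -
  have "S u = emeasure \<mu> ({x. 0 < x \<and> u < \<psi> x} \<union> {x. x < 0 \<and> u < \<psi>' (- x)})"
    unfolding S_def S1'_eq S1_def by (rule plus_emeasure) auto
  then show ?thesis using emeasure_le_1 by simp
qed

text \<open>The intensity of the excursions in \<open>(l,m]\<close> whose terminal value is large enough to stop at a
  positive value.\<close>

definition Lam :: "real \<Rightarrow> real \<Rightarrow> ennreal" where
  "Lam l m = (\<integral>\<^sup>+y. emeasure lborel {u. l < u \<and> u \<le> m \<and> ennreal u \<le> \<psi> y} \<partial>\<nu>)"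

section \<open>The intensity as an integral against \<mu>\<close>

lemma lborel_slice:
  assumes "0 \<le> l" "l \<le> m"
  shows "emeasure lborel {u. l < u \<and> u \<le> m \<and> ennreal u \<le> k} = min (ennreal m) k - min (ennreal l) k"
proof (cases k rule: ennreal_cases)
  case (real r)
  then have "{u. l < u \<and> u \<le> m \<and> ennreal u \<le> k} = {l<..min m r}"
    using assms by auto
  moreover have "min (ennreal m) k - min (ennreal l) k = ennreal (min m r) - ennreal (min l r)"
    using real assms by (simp add: min_def)
  moreover have "ennreal (min m r) - ennreal (min l r) = ennreal (min m r - min l r)"
    using real assms by (intro ennreal_minus) simp
  moreover have "emeasure lborel {l<..min m r} = ennreal (min m r - min l r)"
  proof (cases "l \<le> r")
    case True
    then show ?thesis using assms by simp
  next
    case False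
    then have "{l<..min m r} = {}" "min m r - min l r = 0" using assms by auto
    then show ?thesis by simp
  qed
  ultimately show ?thesis by simp
next
  case top
  then have "{u. l < u \<and> u \<le> m \<and> ennreal u \<le> k} = {l<..m}" by auto
  then show ?thesis using assms top by (simp add: min_def ennreal_minus)
qed

text \<open>The right-hand side is that of \<open>lborel_slice\<close> at
  \<open>k = \<psi> y\<close>. The length of a slice of levels can thus be exchanged for the mass of
  points \<open>s \<le> y\<close>, which makes Fubini applicable.\<close>

lemma kappa_slice:
  assumes "0 \<le> l" "l \<le> m"
  shows "emeasure psi.\<kappa> {s. s \<le> y \<and> ennreal l < \<psi> s \<and> \<psi> s \<le> ennreal m} = min (ennreal m) (\<psi> y) - min (ennreal l) (\<psi> y)"
proof -
  have *: "{s. s \<le> y \<and> ennreal l < \<psi> s \<and> \<psi> s \<le> ennreal m} = {s. s \<le> y \<and> \<psi> s \<le> ennreal m} - {s. s \<le> y \<and> \<psi> s \<le> ennreal l}"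
    by auto
  have "emeasure psi.\<kappa> ({s. s \<le> y \<and> \<psi> s \<le> ennreal m} - {s. s \<le> y \<and> \<psi> s \<le> ennreal l}) = emeasure psi.\<kappa> {s. s \<le> y \<and> \<psi> s \<le> ennreal m} - emeasure psi.\<kappa> {s. s \<le> y \<and> \<psi> s \<le> ennreal l}"
  proof (rule emeasure_Diff)
    show "emeasure psi.\<kappa> {s. s \<le> y \<and> \<psi> s \<le> ennreal l} \<noteq> \<infinity>"
      unfolding psi.kappa_atMost_level by (auto simp: min_def top_unique)
    show "{s. s \<le> y \<and> \<psi> s \<le> ennreal l} \<subseteq> {s. s \<le> y \<and> \<psi> s \<le> ennreal m}"
      using order_trans [OF _ ennreal_leI [OF assms(2)]] by blast
    have "{s. s \<le> y \<and> \<psi> s \<le> ennreal c} \<in> sets borel" for c by measurable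
    then show "{s. s \<le> y \<and> \<psi> s \<le> ennreal m} \<in> sets psi.\<kappa>" "{s. s \<le> y \<and> \<psi> s \<le> ennreal l} \<in> sets psi.\<kappa>"
      unfolding psi.sets_kappa by this+
  qed
  then show ?thesis unfolding * psi.kappa_atMost_level .
qed

text \<open>After exchanging slices, integrating over \<open>y \<ge> s\<close> first produces
  \<open>emeasure \<nu> {s..}\<close>, which cancels the same factor in the density of
  \<open>\<psi>\<close>; by \<open>d_eq_S\<close> only \<open>1 / S (\<psi> s)\<close> is
  left.\<close>

lemma Lam_eq:
  assumes "0 \<le> l" "l \<le> m"
  shows "Lam l m = (\<integral>\<^sup>+s\<in>{s. 0 < s \<and> ennreal l < \<psi> s \<and> \<psi> s \<le> ennreal m}. (1 / S (\<psi> s)) \<partial>\<mu>)"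
proof -
  interpret nu: sigma_finite_measure \<nu> by (rule nu_sigma_finite)
  interpret pair_sigma_finite \<mu> \<nu> ..
  let ?f = "\<lambda>s. 1 / (emeasure \<nu> {s..} * ennreal (d s))"
  let ?A = "{s. ennreal l < \<psi> s \<and> \<psi> s \<le> ennreal m}"
  have "Lam l m = (\<integral>\<^sup>+y. emeasure psi.\<kappa> {s. s \<le> y \<and> ennreal l < \<psi> s \<and> \<psi> s \<le> ennreal m} \<partial>\<nu>)"
    unfolding Lam_def lborel_slice [OF assms] kappa_slice [OF assms] ..
  also have "\<dots> = (\<integral>\<^sup>+y. \<integral>\<^sup>+s. ?f s * indicator ({0..} \<inter> ?A) s * indicator {(s, y). s \<le> y} (s, y) \<partial>\<mu> \<partial>\<nu>)"
  proof (intro nn_integral_cong)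
    fix y
    have "{s. s \<le> y \<and> ennreal l < \<psi> s \<and> \<psi> s \<le> ennreal m} \<in> sets borel" by measurable
    from psi.emeasure_kappa [OF this]
    show "emeasure psi.\<kappa> {s. s \<le> y \<and> ennreal l < \<psi> s \<and> \<psi> s \<le> ennreal m}
      = (\<integral>\<^sup>+s. ?f s * indicator ({0..} \<inter> ?A) s * indicator {(s, y). s \<le> y} (s, y) \<partial>\<mu>)"
      by (simp, intro nn_integral_cong) (auto simp: indicator_def)
  qed
  also have "\<dots> = (\<integral>\<^sup>+s. \<integral>\<^sup>+y. ?f s * indicator ({0..} \<inter> ?A) s * indicator {(s, y). s \<le> y} (s, y) \<partial>\<nu> \<partial>\<mu>)"
    by (rule Fubini') measurable
  also have "\<dots> = (\<integral>\<^sup>+s. ?f s * indicator ({0..} \<inter> ?A) s * emeasure \<nu> {s..} \<partial>\<mu>)"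
  proof (rule nn_integral_cong)
    fix s
    have "(\<integral>\<^sup>+y. ?f s * indicator ({0..} \<inter> ?A) s * indicator {(s, y). s \<le> y} (s, y) \<partial>\<nu>) =
      (\<integral>\<^sup>+y. ?f s * indicator ({0..} \<inter> ?A) s * indicator {s..} y \<partial>\<nu>)"
      by (intro nn_integral_cong) (auto simp: indicator_def)
    also have "\<dots> = ?f s * indicator ({0..} \<inter> ?A) s * emeasure \<nu> {s..}"
      by (subst nn_integral_cmult_indicator) auto
    finally show "(\<integral>\<^sup>+y. ?f s * indicator ({0..} \<inter> ?A) s * indicator {(s, y). s \<le> y} (s, y) \<partial>\<nu>) =
      ?f s * indicator ({0..} \<inter> ?A) s * emeasure \<nu> {s..}" .
  qed
  also have "\<dots> = (\<integral>\<^sup>+s\<in>{s. 0 < s \<and> ennreal l < \<psi> s \<and> \<psi> s \<le> ennreal m}. (1 / S (\<psi> s)) \<partial>\<mu>)"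
  proof (rule nn_integral_cong_AE)
    have "AE s in \<mu>. s \<noteq> 0" using AE_not_in [OF D.singleton_null] by simp
    with D.AE_tail_pos show "AE s in \<mu>. ?f s * indicator ({0..} \<inter> ?A) s * emeasure \<nu> {s..} =
      1 / S (\<psi> s) * indicator {s. 0 < s \<and> ennreal l < \<psi> s \<and> \<psi> s \<le> ennreal m} s"
    proof eventually_elim
      case (elim s)
      show ?case
      proof (cases "0 < s")
        case True
        let ?p = "emeasure \<nu> {s..}"
        \<comment> \<open>Cancelling needs a tail that is neither 0 nor infinite: the mass beyond
          \<open>s\<close> gives the former, \<open>0 < s\<close> the latter.\<close>
        obtain x where "s < x" "0 < emeasure \<nu> {x..}" using elim(1) by (rule nu_tail_pos)
        moreover have "emeasure \<nu> {x..} \<le> ?p" if "s < x" for x using that by (intro emeasure_mono) auto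
        ultimately have p: "0 < ?p" "?p < top"
          using nu_finite(1) [OF True] by (metis order.strict_trans2, simp)
        have "S (\<psi> s) < top" using S_le_1 by (rule order.strict_trans1) simp
        then have "?f s * ?p = 1 / S (\<psi> s) * (?p / ?p)"
          using p True elim by (simp add: d_eq_S divide_ennreal_def ennreal_inverse_mult ac_simps)
        also have "?p / ?p = 1" using p by (intro ennreal_divide_self) auto
        finally have *: "?f s * ?p = 1 / S (\<psi> s)" by simp
        have "?f s * indicator ({0..} \<inter> ?A) s * ?p = (?f s * ?p) * indicator ?A s"
          using True by (simp add: indicator_def)
        also have "\<dots> = 1 / S (\<psi> s) * indicator {s. 0 < s \<and> ennreal l < \<psi> s \<and> \<psi> s \<le> ennreal m} s"
          unfolding * using True by (simp add: indicator_def)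
        finally show ?thesis .
      qed (use elim in \<open>auto simp: indicator_def\<close>)
    qed
  qed
  finally show ?thesis .
qed

lemma Lam_bounds:
  assumes "0 \<le> l" "l \<le> m"
  defines "N \<equiv> emeasure \<mu> {s. 0 < s \<and> ennreal l < \<psi> s \<and> \<psi> s \<le> ennreal m}"
  shows "1 / S (ennreal l) * N \<le> Lam l m" "Lam l m \<le> 1 / S (ennreal m) * N"
proof -
  let ?A = "{s. 0 < s \<and> ennreal l < \<psi> s \<and> \<psi> s \<le> ennreal m}"
  have [measurable]: "?A \<in> sets borel" by measurable
  have "1 / S (ennreal l) * N = (\<integral>\<^sup>+s. 1 / S (ennreal l) * indicator ?A s \<partial>\<mu>)"
    unfolding N_def by (subst nn_integral_cmult_indicator) auto
  also have "\<dots> \<le> Lam l m"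
    unfolding Lam_eq [OF assms(1,2)]
    by (intro nn_integral_mono) (auto simp: indicator_def intro!: inverse_antimono_ennreal S_antimono)
  finally show "1 / S (ennreal l) * N \<le> Lam l m" .
  have "Lam l m \<le> (\<integral>\<^sup>+s. 1 / S (ennreal m) * indicator ?A s \<partial>\<mu>)"
    unfolding Lam_eq [OF assms(1,2)]
    by (intro nn_integral_mono) (auto simp: indicator_def intro!: inverse_antimono_ennreal S_antimono)
  also have "\<dots> = 1 / S (ennreal m) * N"
    unfolding N_def by (subst nn_integral_cmult_indicator) auto
  finally show "Lam l m \<le> 1 / S (ennreal m) * N" .
qed

end

text \<open>Bisecting the range of \<open>s\<close> halves the bound at every step.\<close>

lemma const_of_quadratic_bound:
  fixes E s :: "real \<Rightarrow> real"
  assumes "l \<le> m" and s: "continuous_on {l..m} s"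
    and bound: "\<And>a b. l \<le> a \<Longrightarrow> a \<le> b \<Longrightarrow> b \<le> m \<Longrightarrow> \<bar>E b - E a\<bar> \<le> C * (s a - s b)\<^sup>2"
  shows "E m = E l"
proof -
  have *: "\<bar>E b - E a\<bar> \<le> C * (s a - s b)\<^sup>2 / 2 ^ k" if "l \<le> a" "a \<le> b" "b \<le> m" for a b k
    using that
  proof (induction k arbitrary: a b)
    case 0
    then show ?case using bound by simp
  next
    case (Suc k)
    have cont: "continuous_on {a..b} s" using s by (rule continuous_on_subset) (use Suc.prems in auto)
    have "\<exists>c\<ge>a. c \<le> b \<and> s c = (s a + s b) / 2"
    proof (cases "s a \<le> s b")
      case True
      then show ?thesis using IVT' [of s a "(s a + s b) / 2" b] cont Suc.prems by auto
    next
      case False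
      then show ?thesis using IVT2' [of s b "(s a + s b) / 2" a] cont Suc.prems by auto
    qed
    then obtain c where c: "a \<le> c" "c \<le> b" "s c = (s a + s b) / 2" by blast
    have "\<bar>E b - E a\<bar> \<le> \<bar>E c - E a\<bar> + \<bar>E b - E c\<bar>" by simp
    also have "\<dots> \<le> C * (s a - s c)\<^sup>2 / 2 ^ k + C * (s c - s b)\<^sup>2 / 2 ^ k"
      using Suc.IH [of a c] Suc.IH [of c b] Suc.prems c(1,2) by (intro add_mono) auto
    also have "\<dots> = C * (s a - s b)\<^sup>2 / 2 ^ Suc k"
      unfolding c(3) by (simp add: power2_eq_square field_simps)
    finally show ?case .
  qed
  have "(\<lambda>k. C * (s l - s m)\<^sup>2 / 2 ^ k) \<longlonglongrightarrow> 0"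
    using LIMSEQ_inverse_realpow_zero [of 2] tendsto_mult_right_zero [of "\<lambda>k. inverse (2 ^ k)" sequentially "C * (s l - s m)\<^sup>2"]
    by (simp add: divide_inverse)
  then have "\<bar>E m - E l\<bar> \<le> 0"
    by (rule LIMSEQ_le_const) (use * [of l m] assms(1) in auto)
  then show ?thesis by simp
qed

context target
begin

lemma D_inv_eq: "D_inv \<mu> \<nu> v = Inf {ereal x | x. 0 \<le> x \<and> v < D x}"
proof (cases "D_fun \<mu> \<nu> (supp_upper \<mu>) \<le> v")
  case True
  have "D x \<le> D_fun \<mu> \<nu> (supp_upper \<mu>)" for x
    unfolding D_eq D_fun_def
  proof (rule nn_integral_mono_AE)
    show "AE s in \<mu>. 1 / emeasure \<nu> {s..} * indicator {s. 0 \<le> s \<and> ereal s \<le> ereal x} s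
        \<le> 1 / emeasure \<nu> {s..} * indicator {s. 0 \<le> s \<and> ereal s \<le> supp_upper \<mu>} s"
      using above_supp_upper by eventually_elim (auto simp: indicator_def)
  qed
  then have "D x \<le> v" for x using True by (rule order_trans)
  then have *: "{ereal x | x. 0 \<le> x \<and> v < D x} = {}" by (auto simp: not_less)
  show ?thesis unfolding * using True by (simp add: D_inv_def top_ereal_def)
next
  case False
  then show ?thesis by (simp add: D_inv_def D_eq)
qed

lemma G_inv_mirror: "G_inv (mirror \<mu>) (mirror \<nu>) v = - D_inv \<mu> \<nu> v"
proof -
  interpret m: target "mirror \<mu>" "mirror \<nu>" by (rule target_mirror)
  have "{ereal x | x. x \<le> 0 \<and> v < D (- x)} = uminus ` {ereal x | x. 0 \<le> x \<and> v < D x}"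
  proof (intro equalityI subsetI)
    fix y assume "y \<in> {ereal x | x. x \<le> 0 \<and> v < D (- x)}"
    then obtain x where "y = ereal x" "x \<le> 0" "v < D (- x)" by auto
    then show "y \<in> uminus ` {ereal x | x. 0 \<le> x \<and> v < D x}"
      by (intro image_eqI [of _ _ "ereal (- x)"]) auto
  next
    fix y assume "y \<in> uminus ` {ereal x | x. 0 \<le> x \<and> v < D x}"
    then obtain x where "y = ereal (- x)" "0 \<le> x" "v < D x" by auto
    then show "y \<in> {ereal x | x. x \<le> 0 \<and> v < D (- x)}"
      by (auto intro!: exI [of _ "- x"])
  qed
  then show ?thesis
    unfolding m.G_inv_eq D_inv_eq by (simp add: ereal_Sup_uminus_image_eq)
qed

text \<open>The reflected tail \<open>{x. x \<le> t}\<close> and the tail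
  \<open>{x. t \<le> x}\<close> overlap only at \<open>t\<close>, a null point.\<close>

lemma tail_mirror: "tail (mirror \<mu>) (- t) = 1 - tail \<mu> t"
proof -
  have [measurable]: "{x. - t \<le> ereal x} \<in> sets borel" "{x. t \<le> ereal x} \<in> sets borel" by measurable
  have "emeasure (mirror \<mu>) {x. - t \<le> ereal x} = emeasure \<mu> {x. - t \<le> ereal (- x)}"
    by (subst emeasure_mirror) auto
  then have "tail (mirror \<mu>) (- t) = measure \<mu> {x. - t \<le> ereal (- x)}"
    by (simp add: tail_def measure_def)
  also have "\<dots> = measure \<mu> (space \<mu> - {x. t \<le> ereal x})"
  proof (rule measure_eq_AE)
    have "AE x in \<mu>. x \<noteq> real_of_ereal t" using AE_not_in [OF D.singleton_null] by simp
    then show "AE x in \<mu>. x \<in> {x. - t \<le> ereal (- x)} \<longleftrightarrow> x \<in> space \<mu> - {x. t \<le> ereal x}"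
    proof eventually_elim
      case (elim x)
      then have "ereal x \<noteq> t" by auto
      moreover have "- t \<le> ereal (- x) \<longleftrightarrow> ereal x \<le> t"
        by (metis ereal_minus_le_minus uminus_ereal.simps(1))
      ultimately show ?case by auto
    qed
  qed (simp_all)
  also have "\<dots> = 1 - tail \<mu> t" unfolding tail_def by (subst prob_compl) auto
  finally show ?thesis .
qed

lemma psi_minus_mirror: "psi_minus \<mu> \<nu> y = \<psi>' y"
proof -
  interpret m: target "mirror \<mu>" "mirror \<nu>" by (rule target_mirror)
  have "\<psi>' y = (\<integral>\<^sup>+s. 1 / (emeasure (mirror \<nu>) {-s..} * ennreal (m.d (- s))) * indicator {0..y} (- s) \<partial>\<mu>)"
    unfolding m.psi_plus_eq by (subst nn_integral_mirror) (auto intro!: m.d_measurable m.nu_tail_measurable)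
  also have "\<dots> = psi_minus \<mu> \<nu> y"
    unfolding psi_minus_def
  proof (rule nn_integral_cong)
    fix s :: real
    have "{x. - x \<in> {- s..}} = {..s}" by auto
    then have e: "emeasure (mirror \<nu>) {-s..} = emeasure \<nu> {..s}" by (subst emeasure_mirror) auto
    have i: "indicator {0..y} (- s) = (indicator {-y..0} s :: ennreal)" by (auto simp: indicator_def)
    have d: "m.d (- s) = 1 + tail \<mu> (D_inv \<mu> \<nu> (G_fun \<mu> \<nu> (ereal s))) - tail \<mu> (ereal s)"
    proof -
      have g: "D_fun (mirror \<mu>) (mirror \<nu>) (ereal (- s)) = G_fun \<mu> \<nu> (ereal s)"
        by (simp add: G_fun_mirror)
      have "tail (mirror \<mu>) (ereal (- s)) = 1 - tail \<mu> (ereal s)"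
        using tail_mirror [of "ereal s"] by simp
      then show ?thesis unfolding m.d_def g G_inv_mirror tail_mirror by linarith
    qed
    show "1 / (emeasure (mirror \<nu>) {-s..} * ennreal (m.d (- s))) * indicator {0..y} (- s) =
      1 / (emeasure \<nu> {..s} * ennreal (1 + tail \<mu> (D_inv \<mu> \<nu> (G_fun \<mu> \<nu> (ereal s))) - tail \<mu> (ereal s))) * indicator {-y..0} s"
      unfolding e i d ..
  qed
  finally show ?thesis by simp
qed

text \<open>One of the two summands vanishes.\<close>

definition w :: "real \<Rightarrow> ennreal" where "w x = \<psi> x + psi_minus \<mu> \<nu> (- x)"

lemma psi'_nonpos: "x \<le> 0 \<Longrightarrow> \<psi>' x = 0"
proof -
  interpret m: target "mirror \<mu>" "mirror \<nu>" by (rule target_mirror)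
  show "x \<le> 0 \<Longrightarrow> \<psi>' x = 0" by (rule m.psi.K_nonpos)
qed

lemma w_nonneg: "0 \<le> x \<Longrightarrow> w x = \<psi> x" and w_nonpos: "x \<le> 0 \<Longrightarrow> w x = \<psi>' (- x)"
  by (simp_all add: w_def psi_minus_mirror psi'_nonpos psi.K_nonpos)

lemma w_mirror: "target.w (mirror \<mu>) (mirror \<nu>) x = w (- x)"
proof -
  interpret m: target "mirror \<mu>" "mirror \<nu>" by (rule target_mirror)
  show ?thesis unfolding m.w_def w_def psi_minus_mirror m.psi_minus_mirror by (simp add: add.commute)
qed

lemma w_measurable [measurable]: "w \<in> borel_measurable borel"
  unfolding w_def psi_minus_mirror by measurable

lemma AE_nonzero: "AE x in \<mu>. x \<noteq> 0"
  using AE_not_in [OF D.singleton_null] by simp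

section \<open>The survival function of \<open>w\<close> under \<mu>\<close>

definition Sr :: "real \<Rightarrow> real" where "Sr l = measure \<mu> {x. ennreal l < w x}"

lemma S_eq: "S (ennreal l) = ennreal (Sr l)"
proof -
  have "S (ennreal l) = emeasure \<mu> ({x. 0 < x \<and> ennreal l < \<psi> x} \<union> {x. x < 0 \<and> ennreal l < \<psi>' (- x)})"
    unfolding S_def S1'_eq S1_def by (rule plus_emeasure) auto
  also have "\<dots> = emeasure \<mu> {x. ennreal l < w x}"
  proof (rule emeasure_eq_AE)
    show "AE x in \<mu>. x \<in> {x. 0 < x \<and> ennreal l < \<psi> x} \<union> {x. x < 0 \<and> ennreal l < \<psi>' (- x)} \<longleftrightarrow> x \<in> {x. ennreal l < w x}"
      using AE_nonzero by eventually_elim (auto simp: w_nonneg w_nonpos not_less linorder_neq_iff)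
  qed auto
  finally show ?thesis by (simp add: Sr_def emeasure_eq_measure)
qed

lemma Sr_mirror: "target.Sr (mirror \<mu>) (mirror \<nu>) l = Sr l"
proof -
  interpret m: target "mirror \<mu>" "mirror \<nu>" by (rule target_mirror)
  show ?thesis unfolding m.Sr_def Sr_def measure_def w_mirror by (subst emeasure_mirror) auto
qed

lemma Sr_antimono: "l \<le> m \<Longrightarrow> Sr m \<le> Sr l"
  unfolding Sr_def by (intro finite_measure_mono) (auto elim: le_less_trans [rotated] intro: ennreal_leI)

lemma w_level_null: "emeasure \<mu> {x. w x = ennreal l} = 0"
proof -
  interpret m: target "mirror \<mu>" "mirror \<nu>" by (rule target_mirror)
  have "{x. 0 < x \<and> \<psi> x = ennreal l} \<in> null_sets \<mu>"
    by (intro null_setsI psi.mu_level_null) auto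
  moreover have "{x. x < 0 \<and> \<psi>' (- x) = ennreal l} \<in> null_sets \<mu>"
  proof (rule null_setsI)
    have "emeasure (mirror \<mu>) {x. 0 < x \<and> \<psi>' x = ennreal l} = 0"
      by (intro m.psi.mu_level_null) auto
    moreover have "{x. 0 < x \<and> \<psi>' x = ennreal l} \<in> sets borel" by measurable
    ultimately show "emeasure \<mu> {x. x < 0 \<and> \<psi>' (- x) = ennreal l} = 0"
      by (simp add: emeasure_mirror)
  qed auto
  ultimately have "{x. 0 < x \<and> \<psi> x = ennreal l} \<union> {x. x < 0 \<and> \<psi>' (- x) = ennreal l} \<union> {0} \<in> null_sets \<mu>"
    by (intro null_sets.Un D.singleton_null)
  moreover have "{x. w x = ennreal l} \<subseteq> {x. 0 < x \<and> \<psi> x = ennreal l} \<union> {x. x < 0 \<and> \<psi>' (- x) = ennreal l} \<union> {0}"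
  proof
    fix x assume "x \<in> {x. w x = ennreal l}"
    then show "x \<in> {x. 0 < x \<and> \<psi> x = ennreal l} \<union> {x. x < 0 \<and> \<psi>' (- x) = ennreal l} \<union> {0}"
      using w_nonneg [of x] w_nonpos [of x] by (cases x "0::real" rule: linorder_cases) auto
  qed
  moreover have "{x. w x = ennreal l} \<in> sets \<mu>" by simp
  ultimately have "{x. w x = ennreal l} \<in> null_sets \<mu>"
    using null_sets_subset by blast
  then show ?thesis by (rule null_setsD1)
qed

lemma AE_w_finite: "AE x in \<mu>. w x < \<infinity>"
proof -
  interpret m: target "mirror \<mu>" "mirror \<nu>" by (rule target_mirror)
  have "AE x in mirror \<mu>. 0 < emeasure (mirror \<mu>) {x<..}" by (rule m.D.AE_tail_pos)
  then have "AE x in mirror \<mu>. \<psi>' x < \<infinity>" by eventually_elim (rule m.psi.K_finite)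
  then have "AE x in \<mu>. \<psi>' (- x) < \<infinity>"
    unfolding mirror_def by (subst (asm) AE_distr_iff) (auto simp: mirror_def [symmetric])
  with D.AE_tail_pos show ?thesis
  proof eventually_elim
    case (elim x)
    then show ?case using psi.K_finite [OF elim(1)] by (cases "0 \<le> x") (auto simp: w_nonneg w_nonpos)
  qed
qed

lemma Sr_0: "Sr 0 = 1"
proof -
  have "AE x in \<mu>. x \<notin> {x. w x = ennreal 0}" by (intro AE_not_in null_setsI w_level_null) auto
  then have "AE x in \<mu>. x \<in> {x. ennreal 0 < w x}" by eventually_elim (auto simp: zero_less_iff_neq_zero)
  then show ?thesis unfolding Sr_def by (subst prob_eq_1) auto
qed

text \<open>Through the distribution function, continuity of \<open>Sr\<close> reduces to
  \<open>w_level_null\<close>, and its limit at infinity becomes a library fact. That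
  \<open>enn2real\<close> sends \<infinity> to 0 is harmless by \<open>AE_w_finite\<close>.\<close>

lemma Sr_cdf:
  assumes "0 \<le> l"
  shows "Sr l = 1 - cdf (distr \<mu> borel (\<lambda>x. enn2real (w x))) l"
proof -
  have "cdf (distr \<mu> borel (\<lambda>x. enn2real (w x))) l = measure \<mu> {x. enn2real (w x) \<le> l}"
    unfolding cdf_def by (subst measure_distr) (auto intro!: arg_cong [where f="measure \<mu>"])
  also have "\<dots> = measure \<mu> (space \<mu> - {x. ennreal l < w x})"
  proof (rule measure_eq_AE)
    show "AE x in \<mu>. x \<in> {x. enn2real (w x) \<le> l} \<longleftrightarrow> x \<in> space \<mu> - {x. ennreal l < w x}"
      using AE_w_finite
    proof eventually_elim
      case (elim x)
      then have "w x = ennreal (enn2real (w x))" by simp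
      then have "w x \<le> ennreal l \<longleftrightarrow> enn2real (w x) \<le> l" using assms by (metis ennreal_le_iff)
      then show ?case by auto
    qed
  qed auto
  also have "\<dots> = 1 - Sr l" unfolding Sr_def by (rule prob_compl) auto
  finally show ?thesis by simp
qed

lemma Sr_continuous: "continuous_on {0..} Sr"
proof -
  interpret W: real_distribution "distr \<mu> borel (\<lambda>x. enn2real (w x))"
    by (rule real_distribution_distr) auto
  have "isCont (cdf (distr \<mu> borel (\<lambda>x. enn2real (w x)))) l" if "0 \<le> l" for l
  proof -
    have "measure (distr \<mu> borel (\<lambda>x. enn2real (w x))) {l} = measure \<mu> {x. enn2real (w x) = l}"
      by (subst measure_distr) (auto intro!: arg_cong [where f="measure \<mu>"])
    also have "\<dots> = measure \<mu> {x. w x = ennreal l}"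
    proof (rule measure_eq_AE)
      show "AE x in \<mu>. x \<in> {x. enn2real (w x) = l} \<longleftrightarrow> x \<in> {x. w x = ennreal l}"
        using AE_w_finite by eventually_elim (use that in auto)
    qed auto
    also have "\<dots> = 0" by (simp add: measure_def w_level_null)
    finally show ?thesis by (simp add: W.isCont_cdf)
  qed
  then have "continuous_on {0..} (\<lambda>l. 1 - cdf (distr \<mu> borel (\<lambda>x. enn2real (w x))) l)"
    by (intro continuous_intros continuous_at_imp_continuous_on) auto
  then show ?thesis by (rule continuous_on_eq) (simp add: Sr_cdf)
qed

lemma Sr_tendsto: "(Sr \<longlongrightarrow> 0) at_top"
proof -
  interpret W: real_distribution "distr \<mu> borel (\<lambda>x. enn2real (w x))"
    by (rule real_distribution_distr) auto
  have "((\<lambda>l. 1 - cdf (distr \<mu> borel (\<lambda>x. enn2real (w x))) l) \<longlongrightarrow> 1 - 1) at_top"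
    by (intro tendsto_intros W.cdf_lim_at_top_prob)
  then have "((\<lambda>l. 1 - cdf (distr \<mu> borel (\<lambda>x. enn2real (w x))) l) \<longlongrightarrow> 0) at_top" by simp
  moreover have "\<forall>\<^sub>F l in at_top. 1 - cdf (distr \<mu> borel (\<lambda>x. enn2real (w x))) l = Sr l"
    using eventually_ge_at_top [of "0::real"] by eventually_elim (simp add: Sr_cdf)
  ultimately show ?thesis by (rule Lim_transform_eventually)
qed

text \<open>The value has to stay positive because \<open>Sr_exp\<close> is available only there;
  continuity provides the intermediate value \<open>\<epsilon> / 2\<close>.\<close>

lemma Sr_small: assumes "0 < \<epsilon>" obtains l where "0 \<le> l" "0 < Sr l" "Sr l < \<epsilon>"
proof (cases "\<epsilon> \<le> 1")
  case True
  have "\<forall>\<^sub>F l in at_top. Sr l < \<epsilon> / 2" using Sr_tendsto assms by (intro order_tendstoD) auto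
  moreover have "\<forall>\<^sub>F l in at_top. (0::real) \<le> l" by (rule eventually_ge_at_top)
  ultimately have "\<forall>\<^sub>F l in at_top. 0 \<le> l \<and> Sr l < \<epsilon> / 2" by eventually_elim simp
  then obtain l where l: "0 \<le> l" "Sr l < \<epsilon> / 2" by (auto dest: eventually_happens)
  then obtain l' where "0 \<le> l'" "Sr l' = \<epsilon> / 2"
    using IVT2' [of Sr l "\<epsilon> / 2" 0] Sr_0 True assms continuous_on_subset [OF Sr_continuous, of "{0..l}"] by auto
  then show ?thesis using that [of l'] assms by auto
next
  case False
  then show ?thesis using that [of 0] Sr_0 by simp
qed

lemma Sr_pos:
  assumes "0 \<le> s" "0 < emeasure \<mu> {s<..}" shows "w s < \<infinity>" "0 < Sr (enn2real (w s))"
proof -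
  show "w s < \<infinity>" using psi.K_finite [OF assms(2)] assms(1) by (simp add: w_nonneg)
  then show "0 < Sr (enn2real (w s))"
    using S_pos [OF assms] S_eq [of "enn2real (w s)"] assms(1) by (simp add: w_nonneg)
qed

definition mass :: "real \<Rightarrow> real \<Rightarrow> real" where
  "mass l m = measure \<mu> {x. 0 < x \<and> ennreal l < w x \<and> w x \<le> ennreal m}"

lemma Lam_real:
  assumes "0 \<le> l" "l \<le> m" "0 < Sr m"
  shows "Lam l m < \<infinity>" "mass l m / Sr l \<le> enn2real (Lam l m)" "enn2real (Lam l m) \<le> mass l m / Sr m"
proof -
  have N: "emeasure \<mu> {s. 0 < s \<and> ennreal l < \<psi> s \<and> \<psi> s \<le> ennreal m} = ennreal (mass l m)"
    unfolding mass_def emeasure_eq_measure by (intro arg_cong [where f="\<lambda>A. ennreal (measure \<mu> A)"]) (auto simp: w_nonneg)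
  have pos: "0 < Sr l" using Sr_antimono [OF assms(2)] assms(3) by simp
  have up: "Lam l m \<le> ennreal (mass l m / Sr m)"
    using Lam_bounds(2) [OF assms(1,2)] assms(3) unfolding N S_eq
    by (simp add: divide_ennreal ennreal_mult' [symmetric] mass_def flip: ennreal_1)
  then show "Lam l m < \<infinity>" by (rule order.strict_trans1) simp
  have lo: "ennreal (mass l m / Sr l) \<le> Lam l m"
    using Lam_bounds(1) [OF assms(1,2)] pos unfolding N S_eq
    by (simp add: divide_ennreal ennreal_mult' [symmetric] mass_def flip: ennreal_1)
  show "mass l m / Sr l \<le> enn2real (Lam l m)"
    using enn2real_mono [OF lo] \<open>Lam l m < \<infinity>\<close> pos by (simp add: mass_def)
  show "enn2real (Lam l m) \<le> mass l m / Sr m"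
    using up assms(3) by (intro enn2real_leI) (auto simp: mass_def)
qed

lemma mass_sum:
  assumes "0 \<le> l" "l \<le> m"
  shows "mass l m + target.mass (mirror \<mu>) (mirror \<nu>) l m = Sr l - Sr m"
proof -
  interpret m: target "mirror \<mu>" "mirror \<nu>" by (rule target_mirror)
  have "m.mass l m = measure \<mu> {x. x < 0 \<and> ennreal l < w x \<and> w x \<le> ennreal m}"
    unfolding m.mass_def measure_def w_mirror by (subst emeasure_mirror) auto
  then have "mass l m + m.mass l m = measure \<mu> ({x. 0 < x \<and> ennreal l < w x \<and> w x \<le> ennreal m} \<union> {x. x < 0 \<and> ennreal l < w x \<and> w x \<le> ennreal m})"
    unfolding mass_def by (subst finite_measure_Union) auto
  also have "{x. 0 < x \<and> ennreal l < w x \<and> w x \<le> ennreal m} \<union> {x. x < 0 \<and> ennreal l < w x \<and> w x \<le> ennreal m}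
    = {x. ennreal l < w x} - {x. ennreal m < w x}"
  proof -
    have "w 0 = 0" by (simp add: w_nonneg psi.K_nonpos)
    then have "x \<noteq> 0" if "ennreal l < w x" for x using that by auto
    then show ?thesis by (force simp: not_less)
  qed
  also have "measure \<mu> \<dots> = Sr l - Sr m"
    unfolding Sr_def using ennreal_leI [OF assms(2)] by (intro finite_measure_Diff) (auto intro: le_less_trans)
  finally show ?thesis .
qed

lemma Lam_add:
  assumes "0 \<le> a" "a \<le> b" "b \<le> c" shows "Lam a c = Lam a b + Lam b c"
proof -
  have le: "ennreal a \<le> ennreal b" "ennreal b \<le> ennreal c" using assms by (auto intro: ennreal_leI)
  have "Lam a b + Lam b c = (\<integral>\<^sup>+s. 1 / S (\<psi> s) * indicator {s. 0 < s \<and> ennreal a < \<psi> s \<and> \<psi> s \<le> ennreal b} s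
     + 1 / S (\<psi> s) * indicator {s. 0 < s \<and> ennreal b < \<psi> s \<and> \<psi> s \<le> ennreal c} s \<partial>\<mu>)"
    using assms by (subst (1 2) Lam_eq) (auto intro!: nn_integral_add [symmetric])
  also have "\<dots> = Lam a c"
  proof -
    have "indicator {s. 0 < s \<and> ennreal a < \<psi> s \<and> \<psi> s \<le> ennreal b} s + indicator {s. 0 < s \<and> ennreal b < \<psi> s \<and> \<psi> s \<le> ennreal c} s
      = (indicator {s. 0 < s \<and> ennreal a < \<psi> s \<and> \<psi> s \<le> ennreal c} s :: ennreal)" for s
    proof (cases "\<psi> s \<le> ennreal b")
      case True
      then have "\<psi> s \<le> ennreal c" using le by simp
      then show ?thesis using True by (simp add: indicator_def not_less)
    next
      case False
      then have "ennreal a < \<psi> s" using le by simp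
      then show ?thesis using False by (simp add: indicator_def not_le)
    qed
    then show ?thesis
      using assms by (subst Lam_eq) (auto simp: distrib_left [symmetric])
  qed
  finally show ?thesis by simp
qed

abbreviation Lam' where "Lam' \<equiv> target.Lam (mirror \<mu>) (mirror \<nu>)"

text \<open>\<open>Lam + Lam'\<close> and \<open>- ln Sr\<close> have increments between \<open>(Sr a - Sr b) / Sr a\<close> and
  \<open>(Sr a - Sr b) / Sr b\<close>.\<close>

lemma Sr_exp:
  assumes "0 \<le> l" "0 < Sr l"
  shows "Sr l = exp (- (enn2real (Lam 0 l) + enn2real (Lam' 0 l)))" "Lam' 0 l < \<infinity>"
proof -
  interpret m: target "mirror \<mu>" "mirror \<nu>" by (rule target_mirror)
  \<comment> \<open>\<open>E\<close> vanishes at 0, and its constancy is the claimed exponential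
    formula.\<close>
  define E where "E x = enn2real (Lam 0 x) + enn2real (Lam' 0 x) + ln (Sr x)" for x
  show "Lam' 0 l < \<infinity>" using m.Lam_real [of 0 l] assms by (simp add: Sr_mirror)
  have "E l = E 0"
  proof (rule const_of_quadratic_bound [of 0 l Sr _ "1 / (Sr l)\<^sup>2"])
    show "continuous_on {0..l} Sr" by (rule continuous_on_subset [OF Sr_continuous]) auto
    fix a b assume ab: "0 \<le> a" "a \<le> b" "b \<le> l"
    have S: "Sr l \<le> Sr b" "Sr b \<le> Sr a" using Sr_antimono ab by auto
    then have pos: "0 < Sr b" "0 < Sr a" using assms by auto
    define p q where "p = enn2real (Lam a b)" and "q = enn2real (Lam' a b)"
    have "enn2real (Lam 0 b) = enn2real (Lam 0 a) + p"
      unfolding p_def using ab pos Lam_real(1) [of 0 a] Lam_real(1) [of a b]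
      by (subst Lam_add [of 0 a b]) (auto simp: enn2real_plus)
    moreover have "enn2real (Lam' 0 b) = enn2real (Lam' 0 a) + q"
      unfolding q_def using ab pos m.Lam_real(1) [of 0 a] m.Lam_real(1) [of a b]
      by (subst m.Lam_add [of 0 a b]) (auto simp: enn2real_plus Sr_mirror)
    ultimately have eq: "E b - E a = p + q + (ln (Sr b) - ln (Sr a))" by (simp add: E_def)
    have "mass a b / Sr a + m.mass a b / Sr a \<le> p + q"
      unfolding p_def q_def using ab pos Lam_real(2) [of a b] m.Lam_real(2) [of a b] by (auto simp: Sr_mirror)
    then have lo: "(Sr a - Sr b) / Sr a \<le> p + q" using mass_sum [OF ab(1,2)] by (simp add: add_divide_distrib [symmetric])
    have "p + q \<le> mass a b / Sr b + m.mass a b / Sr b"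
      unfolding p_def q_def using ab pos Lam_real(3) [of a b] m.Lam_real(3) [of a b] by (auto simp: Sr_mirror)
    then have up: "p + q \<le> (Sr a - Sr b) / Sr b" using mass_sum [OF ab(1,2)] by (simp add: add_divide_distrib [symmetric])
    have "ln (Sr b) - ln (Sr a) = ln (Sr b / Sr a)" using pos by (simp add: ln_div)
    also have "\<dots> \<le> Sr b / Sr a - 1" using pos by (intro ln_le_minus_one) simp
    finally have lnup: "ln (Sr b) - ln (Sr a) \<le> - ((Sr a - Sr b) / Sr a)" using pos by (simp add: field_simps)
    have "ln (Sr a) - ln (Sr b) = ln (Sr a / Sr b)" using pos by (simp add: ln_div)
    also have "\<dots> \<le> Sr a / Sr b - 1" using pos by (intro ln_le_minus_one) simp
    finally have lnlo: "- ((Sr a - Sr b) / Sr b) \<le> ln (Sr b) - ln (Sr a)" using pos by (simp add: field_simps)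
    \<comment> \<open>Both increments lie in the same interval, so they differ by at most its width,
      which is quadratic in \<open>Sr a - Sr b\<close>. Since \<open>Sr l\<close> is a lower bound
      of \<open>Sr a\<close> and \<open>Sr b\<close>, the constant is
      \<open>1 / (Sr l)\<^sup>2\<close>.\<close>
    have "\<bar>E b - E a\<bar> \<le> (Sr a - Sr b) / Sr b - (Sr a - Sr b) / Sr a"
      unfolding eq using lo up lnup lnlo by (simp add: abs_le_iff)
    also have "\<dots> = (Sr a - Sr b)\<^sup>2 / (Sr a * Sr b)"
      using pos by (simp add: field_simps power2_eq_square)
    also have "\<dots> \<le> (Sr a - Sr b)\<^sup>2 / (Sr l * Sr l)"
      using S assms by (intro divide_left_mono mult_mono mult_pos_pos) auto
    finally show "\<bar>E b - E a\<bar> \<le> 1 / (Sr l)\<^sup>2 * (Sr a - Sr b)\<^sup>2" by (simp add: power2_eq_square)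
  qed (use assms in auto)
  moreover have "Lam 0 0 = 0" "Lam' 0 0 = 0"
  proof -
    have *: "{u. 0 < u \<and> u \<le> (0::real) \<and> ennreal u \<le> k} = {}" for k by auto
    show "Lam 0 0 = 0" "Lam' 0 0 = 0" unfolding Lam_def m.Lam_def * by simp_all
  qed
  ultimately have "ln (Sr l) = - (enn2real (Lam 0 l) + enn2real (Lam' 0 l))"
    by (simp add: E_def Sr_0)
  then show "Sr l = exp (- (enn2real (Lam 0 l) + enn2real (Lam' 0 l)))"
    using assms by (metis exp_ln)
qed

end

section \<open>A single path\<close>

text \<open>The statements about a path are deterministic; the assumptions are properties that
  almost every \<open>\<omega>\<close> has. \<open>exc_0\<close> excludes an excursion at local time
  0, so that \<open>L\<close> is positive immediately.\<close>

locale good_path =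
  fixes X :: "real \<Rightarrow> 'a \<Rightarrow> 'e" and z :: 'e and L :: "real \<Rightarrow> 'a \<Rightarrow> real"
    and F :: "(real \<Rightarrow> 'e) \<Rightarrow> real \<Rightarrow> real" and \<omega> :: 'a
  assumes L_0: "L 0 \<omega> = 0"
    and L_mono_on: "mono_on {0..} (\<lambda>t. L t \<omega>)"
    and L_continuous: "continuous_on {0..} (\<lambda>t. L t \<omega>)"
    and L_at_top: "filterlim (\<lambda>t. L t \<omega>) at_top at_top"
    and exc: "0 \<le> l \<Longrightarrow> excursion_process X z L l \<omega> \<in> insert None (Some ` excursions z)"
    and exc_0: "excursion_process X z L 0 \<omega> = None"
    and F_mono: "\<epsilon> \<in> excursions z \<Longrightarrow> mono_on {0..} (F \<epsilon>) \<or> antimono_on {0..} (F \<epsilon>)"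
    and F_cont: "\<epsilon> \<in> excursions z \<Longrightarrow> continuous_on {0..} (F \<epsilon>)"
    and F_0: "\<epsilon> \<in> excursions z \<Longrightarrow> F \<epsilon> 0 = 0"
begin

abbreviation "\<tau> l \<equiv> inv_local_time L l \<omega>"
abbreviation "\<tau>l l \<equiv> inv_local_time_left L l \<omega>"
abbreviation "ex l \<equiv> excursion_process X z L l \<omega>"
abbreviation "Y t \<equiv> functional_process X z L F t \<omega>"

lemma L_mono: "0 \<le> s \<Longrightarrow> s \<le> t \<Longrightarrow> L s \<omega> \<le> L t \<omega>"
  using L_mono_on by (auto simp: mono_on_def)

lemma L_nonneg: "0 \<le> t \<Longrightarrow> 0 \<le> L t \<omega>"
  using L_mono [of 0 t] L_0 by simp

lemma L_large: obtains t where "0 \<le> t" "c < L t \<omega>"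
proof -
  have "\<forall>\<^sub>F t in at_top. c < L t \<omega>" using L_at_top by (auto simp: filterlim_at_top_dense)
  with eventually_ge_at_top [of "0::real"] have "\<forall>\<^sub>F t in at_top. 0 \<le> t \<and> c < L t \<omega>"
    by eventually_elim simp
  then show thesis using that by (auto dest: eventually_happens)
qed

lemma L_IVT: assumes "0 \<le> c" "c \<le> L t \<omega>" "0 \<le> t" obtains s where "0 \<le> s" "s \<le> t" "L s \<omega> = c"
  using IVT' [of "\<lambda>t. L t \<omega>" 0 c t] assms L_0 continuous_on_subset [OF L_continuous, of "{0..t}"] by auto

text \<open>By continuity \<open>\<tau> l\<close> is the last time at which \<open>L\<close> is at
  most \<open>l\<close>: a time with \<open>L s \<omega> > l\<close> is preceded by one where
  \<open>L\<close> lies strictly between, hence is not the infimum.\<close>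

lemma le_inv_local_time: assumes "0 \<le> s" "0 \<le> l" shows "s \<le> \<tau> l \<longleftrightarrow> L s \<omega> \<le> l"
proof
  let ?A = "{s. 0 \<le> s \<and> L s \<omega> > l}"
  obtain t where "t \<in> ?A" using L_large [of l] by auto
  then have ne: "?A \<noteq> {}" by auto
  have bdd: "bdd_below ?A" by (auto intro: bdd_belowI [of _ 0])
  show "s \<le> \<tau> l" if "L s \<omega> \<le> l"
    unfolding inv_local_time_def
  proof (rule cInf_greatest [OF ne])
    fix s' assume "s' \<in> ?A"
    then show "s \<le> s'" using that L_mono [of s' s] by (cases "s \<le> s'") auto
  qed
  show "L s \<omega> \<le> l" if "s \<le> \<tau> l"
  proof (rule ccontr)
    assume *: "\<not> L s \<omega> \<le> l"
    obtain s' where s': "0 \<le> s'" "s' \<le> s" "L s' \<omega> = (l + L s \<omega>) / 2"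
      using L_IVT [of "(l + L s \<omega>) / 2" s] * assms by auto
    then have "s' \<in> ?A" using * by auto
    then have "\<tau> l \<le> s'" unfolding inv_local_time_def using bdd by (rule cInf_lower)
    with that s' have "s' = s" by simp
    then show False using s' * by auto
  qed
qed

text \<open>\<open>\<tau>l l\<close> is the first time \<open>b\<close> at which \<open>L\<close>
  reaches \<open>l\<close>: this infimum is attained on a closed set, and \<open>\<tau> k\<close>
  tends to it as \<open>k\<close> increases to \<open>l\<close>. The convention at
  \<open>l = 0\<close> fits because \<open>L\<close> is nonnegative.\<close>

lemma inv_local_time_left_le: assumes "0 \<le> s" "0 \<le> l" shows "\<tau>l l \<le> s \<longleftrightarrow> l \<le> L s \<omega>"
proof (cases "l = 0")
  case True
  then show ?thesis using assms L_nonneg by (simp add: inv_local_time_left_def)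
next
  case False
  then have l: "0 < l" using assms by simp
  define A where "A = {s. 0 \<le> s \<and> l \<le> L s \<omega>}"
  define b where "b = Inf A"
  have "closed ({0..} \<inter> (\<lambda>t. L t \<omega>) -` {l..})"
    by (intro continuous_closed_preimage L_continuous) auto
  moreover have "A = {0..} \<inter> (\<lambda>t. L t \<omega>) -` {l..}" by (auto simp: A_def)
  ultimately have "closed A" by simp
  moreover have "A \<noteq> {}" using L_large [of l] unfolding A_def by (auto intro: less_imp_le)
  moreover have bdd: "bdd_below A" by (auto simp: A_def intro: bdd_belowI [of _ 0])
  ultimately have "b \<in> A" unfolding b_def by (intro closed_contains_Inf)
  have A: "s \<in> A \<longleftrightarrow> b \<le> s" for s
  proof
    show "b \<le> s" if "s \<in> A" unfolding b_def using that bdd by (rule cInf_lower)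
    show "s \<in> A" if "b \<le> s"
      using \<open>b \<in> A\<close> that L_mono [of b s] by (auto simp: A_def)
  qed
  have "0 < b" using \<open>b \<in> A\<close> L_0 l by (auto simp: A_def less_le)
  have "(\<tau> \<longlongrightarrow> b) (at_left l)"
  proof (rule order_tendstoI)
    fix e assume "b < e"
    have "\<forall>\<^sub>F k in at_left l. 0 < k \<and> k < l"
      using l by (auto simp: eventually_at_left intro!: exI [of _ 0])
    then show "\<forall>\<^sub>F k in at_left l. \<tau> k < e"
    proof eventually_elim
      case (elim k)
      have "\<not> b \<le> \<tau> k" using elim \<open>b \<in> A\<close> by (subst le_inv_local_time) (auto simp: A_def)
      then show ?case using \<open>b < e\<close> by simp
    qed
  next
    fix e assume "e < b"
    define e' where "e' = max 0 ((e + b) / 2)"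
    have e': "0 \<le> e'" "e < e'" "e' < b" using \<open>e < b\<close> \<open>0 < b\<close> by (auto simp: e'_def less_max_iff_disj)
    then have "L e' \<omega> < l" using A [of e'] by (auto simp: A_def)
    then have "\<forall>\<^sub>F k in at_left l. L e' \<omega> < k"
      by (auto simp: eventually_at_left)
    then show "\<forall>\<^sub>F k in at_left l. e < \<tau> k"
    proof eventually_elim
      case (elim k)
      then have "e' \<le> \<tau> k" using e' L_nonneg [of e'] by (subst le_inv_local_time) auto
      then show ?case using e' by simp
    qed
  qed
  then have "\<tau>l l = b" using False by (auto simp: inv_local_time_left_def intro!: tendsto_Lim)
  then show ?thesis using A [of s] assms by (auto simp: A_def)
qed

lemma inv_local_time_left_nonneg: assumes "0 \<le> l" shows "0 \<le> \<tau>l l"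
proof (cases "l = 0")
  case False
  show ?thesis
  proof (rule ccontr)
    assume "\<not> 0 \<le> \<tau>l l"
    then have "\<tau>l l \<le> 0" by simp
    then show False using inv_local_time_left_le [of 0 l] assms False L_0 by auto
  qed
qed (simp add: inv_local_time_left_def)

lemma L_eq_iff: "0 \<le> s \<Longrightarrow> 0 \<le> l \<Longrightarrow> L s \<omega> = l \<longleftrightarrow> \<tau>l l \<le> s \<and> s \<le> \<tau> l"
  by (auto simp: le_inv_local_time inv_local_time_left_le)

lemma ex_NoneD: "ex l = None \<Longrightarrow> \<tau> l \<le> \<tau>l l"
  by (auto simp: excursion_process_def Let_def split: if_splits)

text \<open>If \<open>L\<close> vanished up to \<open>t > 0\<close>, the interval from
  \<open>\<tau>l 0\<close> to \<open>\<tau> 0\<close> would have positive length and carry an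
  excursion at local time 0.\<close>

lemma L_pos: assumes "0 < t" shows "0 < L t \<omega>"
proof (rule ccontr)
  assume "\<not> 0 < L t \<omega>"
  then have "L t \<omega> = 0" using L_nonneg [of t] assms by simp
  then have "t \<le> \<tau> 0" using assms by (subst le_inv_local_time) auto
  then show False using ex_NoneD [OF exc_0] assms by (simp add: inv_local_time_left_def)
qed

abbreviation "V \<epsilon> \<equiv> lifetime z \<epsilon>"

lemma ex_SomeD:
  assumes "0 \<le> l" "ex l = Some \<epsilon>"
  shows "\<epsilon> \<in> excursions z" "\<tau>l l < \<tau> l" "\<And>s. 0 \<le> s \<Longrightarrow> s \<le> \<tau> l - \<tau>l l \<Longrightarrow> \<epsilon> s = X (\<tau>l l + s) \<omega>"
    "V \<epsilon> \<le> \<tau> l - \<tau>l l" "0 < V \<epsilon>"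
proof -
  show e: "\<epsilon> \<in> excursions z" using exc [OF assms(1)] assms(2) by auto
  show lt: "\<tau>l l < \<tau> l" using assms(2) by (auto simp: excursion_process_def Let_def split: if_splits)
  then have \<epsilon>: "\<epsilon> = (\<lambda>s\<in>{0..}. if s \<le> \<tau> l - \<tau>l l then X (\<tau>l l + s) \<omega> else z)"
    using assms(2) by (auto simp: excursion_process_def Let_def)
  then show "\<epsilon> s = X (\<tau>l l + s) \<omega>" if "0 \<le> s" "s \<le> \<tau> l - \<tau>l l" for s
    using that by simp
  show "0 < V \<epsilon>" by (rule lifetime(1) [OF e])
  show "V \<epsilon> \<le> \<tau> l - \<tau>l l"
  proof (rule ccontr)
    assume "\<not> V \<epsilon> \<le> \<tau> l - \<tau>l l"
    \<comment> \<open>Past the length of its interval the excursion is extended by \<open>z\<close>,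
      which it avoids during its lifetime.\<close>
    then obtain s where s: "\<tau> l - \<tau>l l < s" "s < V \<epsilon>" using dense [of "\<tau> l - \<tau>l l" "V \<epsilon>"] by auto
    then have "0 < s" using lt by simp
    moreover have "\<epsilon> s = z" using s \<open>0 < s\<close> by (subst \<epsilon>) simp
    ultimately show False using lifetime(2) [OF e, of s] s by auto
  qed
qed

lemma X_zero_iff:
  assumes "0 \<le> l" "ex l = Some \<epsilon>" "\<tau>l l \<le> t" "t \<le> \<tau> l"
  shows "X t \<omega> = z \<longleftrightarrow> t = \<tau>l l \<or> \<tau>l l + V \<epsilon> \<le> t"
  using ex_SomeD(3) [OF assms(1,2), of "t - \<tau>l l"] lifetime(2) [OF ex_SomeD(1) [OF assms(1,2)], of "t - \<tau>l l"] assms(3,4)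
  by auto

lemma Y_excursion:
  assumes "0 \<le> l" "ex l = Some \<epsilon>" "\<tau>l l \<le> t" "t < \<tau>l l + V \<epsilon>"
  shows "L t \<omega> = l" "Y t = F \<epsilon> (t - \<tau>l l)"
proof -
  have t: "0 \<le> t" "t \<le> \<tau> l"
    using inv_local_time_left_nonneg [OF assms(1)] assms(3,4) ex_SomeD(4) [OF assms(1,2)] by auto
  show L: "L t \<omega> = l" using assms t by (simp add: L_eq_iff)
  have "last_zero X z t \<omega> = \<tau>l l"
    unfolding last_zero_def
  proof (rule cSup_eq_maximum)
    show "\<tau>l l \<in> {u. 0 \<le> u \<and> u \<le> t \<and> X u \<omega> = z}"
      using X_zero_iff [OF assms(1,2), of "\<tau>l l"] ex_SomeD(2) [OF assms(1,2)] assms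
        inv_local_time_left_nonneg [OF assms(1)] by auto
    fix u assume "u \<in> {u. 0 \<le> u \<and> u \<le> t \<and> X u \<omega> = z}"
    then show "u \<le> \<tau>l l"
      using X_zero_iff [OF assms(1,2), of u] t assms(4) by (cases "\<tau>l l \<le> u") auto
  qed
  then show "Y t = F \<epsilon> (t - \<tau>l l)" by (simp add: functional_process_def L assms)
qed

lemma Y_zero: assumes "0 \<le> t" "X t \<omega> = z" shows "Y t = 0"
proof -
  have "last_zero X z t \<omega> = t"
    unfolding last_zero_def by (rule cSup_eq_maximum) (use assms in auto)
  then show ?thesis
    using F_0 ex_SomeD(1) [OF L_nonneg [OF assms(1)]]
    by (auto simp: functional_process_def split: option.split)
qed

lemma Y_cases:
  assumes "0 \<le> t" "Y t \<noteq> 0"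
  obtains \<epsilon> where "ex (L t \<omega>) = Some \<epsilon>" "\<tau>l (L t \<omega>) < t" "t < \<tau>l (L t \<omega>) + V \<epsilon>" "X t \<omega> \<noteq> z"
    "Y t = F \<epsilon> (t - \<tau>l (L t \<omega>))"
proof -
  have X: "X t \<omega> \<noteq> z" using Y_zero assms by auto
  have "ex (L t \<omega>) \<noteq> None"
  proof
    assume "ex (L t \<omega>) = None"
    then have "Y t = 0" by (simp add: functional_process_def)
    then show False using assms by simp
  qed
  then obtain \<epsilon> where \<epsilon>: "ex (L t \<omega>) = Some \<epsilon>" by auto
  have "\<tau>l (L t \<omega>) \<le> t" "t \<le> \<tau> (L t \<omega>)" using L_eq_iff [of t "L t \<omega>"] L_nonneg assms by auto
  with X_zero_iff [OF L_nonneg [OF assms(1)] \<epsilon>, of t] X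
  have *: "\<tau>l (L t \<omega>) < t" "t < \<tau>l (L t \<omega>) + V \<epsilon>" by auto
  then show thesis
    using that [of \<epsilon>] \<epsilon> X Y_excursion(2) [OF L_nonneg [OF assms(1)] \<epsilon>, of t] by auto
qed

lemma F_sign_mono:
  assumes "\<epsilon> \<in> excursions z"
  shows "(\<forall>s t. 0 \<le> s \<longrightarrow> s \<le> t \<longrightarrow> 0 \<le> F \<epsilon> s \<and> F \<epsilon> s \<le> F \<epsilon> t) \<or>
    (\<forall>s t. 0 \<le> s \<longrightarrow> s \<le> t \<longrightarrow> F \<epsilon> s \<le> 0 \<and> F \<epsilon> t \<le> F \<epsilon> s)"
  using F_mono [OF assms]
proof
  assume m: "mono_on {0..} (F \<epsilon>)"
  have "0 \<le> F \<epsilon> s \<and> F \<epsilon> s \<le> F \<epsilon> t" if "0 \<le> s" "s \<le> t" for s t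
    using mono_onD [OF m, of 0 s] mono_onD [OF m, of s t] that F_0 [OF assms] by auto
  then show ?thesis by blast
next
  assume m: "antimono_on {0..} (F \<epsilon>)"
  have "F \<epsilon> s \<le> 0 \<and> F \<epsilon> t \<le> F \<epsilon> s" if "0 \<le> s" "s \<le> t" for s t
    using monotone_onD [OF m, of 0 s] monotone_onD [OF m, of s t] that F_0 [OF assms] by auto
  then show ?thesis by blast
qed

text \<open>The terminal value need not be taken by the process, which is back at 0 when the
  excursion ends. Half the level is reached strictly inside the lifetime by continuity.\<close>

lemma large_excursion_visit:
  assumes "0 \<le> l" "ex l = Some \<epsilon>" "0 < c" "c \<le> \<bar>F \<epsilon> (V \<epsilon>)\<bar>"
  obtains t where "\<tau>l l < t" "L t \<omega> = l" "c / 2 \<le> \<bar>Y t\<bar>"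
proof -
  note e = ex_SomeD [OF assms(1,2)]
  have "continuous_on {0..V \<epsilon>} (\<lambda>s. \<bar>F \<epsilon> s\<bar>)"
    by (intro continuous_on_rabs continuous_on_subset [OF F_cont [OF e(1)]]) auto
  then obtain s where s: "0 \<le> s" "s \<le> V \<epsilon>" "\<bar>F \<epsilon> s\<bar> = c / 2"
    using IVT' [of "\<lambda>s. \<bar>F \<epsilon> s\<bar>" 0 "c / 2" "V \<epsilon>"] F_0 [OF e(1)] assms(3,4) e(5) by auto
  have "s \<noteq> V \<epsilon>" "s \<noteq> 0" using s(3) assms(3,4) F_0 [OF e(1)] by auto
  then show thesis
    using that [of "\<tau>l l + s"] Y_excursion [OF assms(1,2), of "\<tau>l l + s"] s by auto
qed

text \<open>Between two large excursions the process returns to zero, so infinitely many of them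
  would accumulate at a time where a one-sided limit fails to exist.\<close>

lemma finite_large_excursions:
  assumes cadlag: "\<forall>t\<ge>0. continuous (at_right t) Y \<and> (0 < t \<longrightarrow> (\<exists>y. (Y \<longlongrightarrow> y) (at_left t)))"
    and c: "0 < c"
  shows "finite {l. 0 \<le> l \<and> l \<le> K \<and> (\<exists>\<epsilon>. ex l = Some \<epsilon> \<and> c \<le> \<bar>F \<epsilon> (V \<epsilon>)\<bar>)}"
proof (rule ccontr)
  let ?A = "{l. 0 \<le> l \<and> l \<le> K \<and> (\<exists>\<epsilon>. ex l = Some \<epsilon> \<and> c \<le> \<bar>F \<epsilon> (V \<epsilon>)\<bar>)}"
  assume "infinite ?A"
  then obtain q :: "nat \<Rightarrow> real" where q: "inj q" "range q \<subseteq> ?A"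
    using infinite_countable_subset [OF \<open>infinite ?A\<close>] by (elim exE conjE)
  obtain r :: "nat \<Rightarrow> nat" where r: "strict_mono r" "monoseq (\<lambda>n. q (r n))"
    using seq_monosub [of q] by (elim exE conjE)
  define l where "l n = q (r n)" for n
  have l: "l n \<in> ?A" for n using q by (auto simp: l_def)
  have "inj r" using r(1) by (rule strict_mono_imp_inj_on)
  then have inj: "inj l" using inj_compose [OF q(1)] by (simp add: l_def [abs_def] comp_def)
  have "\<exists>t. \<tau>l (l n) < t \<and> L t \<omega> = l n \<and> c / 2 \<le> \<bar>Y t\<bar>" for n
  proof -
    obtain \<epsilon> where "0 \<le> l n" "ex (l n) = Some \<epsilon>" "c \<le> \<bar>F \<epsilon> (V \<epsilon>)\<bar>" using l [of n] by auto
    then show ?thesis using large_excursion_visit [of "l n" \<epsilon> c] c by blast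
  qed
  then obtain t where t: "\<And>n. \<tau>l (l n) < t n" "\<And>n. L (t n) \<omega> = l n" "\<And>n. c / 2 \<le> \<bar>Y (t n)\<bar>" by metis
  define a where "a n = \<tau>l (l n)" for n
  have a0: "0 \<le> a n" for n using l [of n] by (auto simp: a_def inv_local_time_left_nonneg)
  have La: "L (a n) \<omega> = l n" and Ya: "Y (a n) = 0" for n
  proof -
    obtain \<epsilon> where e: "0 \<le> l n" "ex (l n) = Some \<epsilon>" using l [of n] by auto
    then show "L (a n) \<omega> = l n" "Y (a n) = 0"
      using Y_excursion [OF e, of "a n"] ex_SomeD [OF e] F_0 by (auto simp: a_def)
  qed
  have lt: "t m < a n" if "l m < l n" for m n
    using L_mono [of "a n" "t m"] a0 La t(2) that by (cases "t m < a n") (auto simp: not_less)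
  have at: "a n < t n" for n using t(1) by (simp add: a_def)
  have lim_contra: False if "(Y \<longlongrightarrow> y) G" "filterlim a G sequentially" "filterlim t G sequentially" for y G
  proof -
    have "(\<lambda>n. Y (a n)) \<longlonglongrightarrow> y" using that(1,2) by (rule filterlim_compose)
    then have "y = 0" by (simp add: Ya LIMSEQ_const_iff)
    have "(\<lambda>n. \<bar>Y (t n)\<bar>) \<longlonglongrightarrow> \<bar>y\<bar>" by (rule tendsto_rabs [OF filterlim_compose [OF that(1,3)]])
    then have "c / 2 \<le> \<bar>y\<bar>" by (rule LIMSEQ_le_const) (use t(3) in auto)
    then show False using c \<open>y = 0\<close> by simp
  qed
  have strict: "l m \<noteq> l n" if "m \<noteq> n" for m n using inj that by (auto simp: inj_def)
  \<comment> \<open>Increasing levels accumulate from the left of a time, where a left limit exists;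
    decreasing ones from the right, where the process is right-continuous. In both cases starts and
    visits interlace by \<open>lt\<close>, so they share the limit.\<close>
  from r(2) consider "incseq l" | "decseq l" unfolding l_def monoseq_iff by blast
  then show False
  proof cases
    case 1
    have lS: "l n < l (Suc n)" for n using incseqD [OF 1, of n "Suc n"] strict [of n "Suc n"] by auto
    have taS: "t n < a (Suc n)" for n using lt [OF lS] .
    have "incseq a" by (rule incseq_SucI) (use at taS in \<open>auto intro: less_imp_le less_trans\<close>)
    moreover obtain T where "0 \<le> T" "K < L T \<omega>" by (rule L_large)
    moreover have "a n \<le> T" for n
      using L_mono [of T "a n"] La [of n] l [of n] \<open>0 \<le> T\<close> \<open>K < L T \<omega>\<close> by (cases "a n \<le> T") auto
    ultimately obtain y where y: "a \<longlonglongrightarrow> y" "\<And>n. a n \<le> y"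
      using incseq_convergent [of a T] by blast
    have ay: "a n < y" for n using at [of n] taS [of n] y(2) [of "Suc n"] by simp
    have ty: "t n < y" for n using taS [of n] y(2) [of "Suc n"] by simp
    have "t \<longlonglongrightarrow> y"
      by (rule tendsto_sandwich [OF _ _ y(1) tendsto_const])
         (use at ty in \<open>auto intro!: always_eventually less_imp_le\<close>)
    then have lims: "filterlim a (at_left y) sequentially" "filterlim t (at_left y) sequentially"
      using y(1) ay ty by (auto simp: filterlim_at intro!: always_eventually)
    have "0 < y" using a0 [of 0] ay [of 0] by simp
    then have "\<exists>v. (Y \<longlongrightarrow> v) (at_left y)" using cadlag [rule_format, of y] by simp
    then obtain v where "(Y \<longlongrightarrow> v) (at_left y)" ..
    from lim_contra [OF this lims] show False .
  next
    case 2
    have lS: "l (Suc n) < l n" for n using decseqD [OF 2, of n "Suc n"] strict [of n "Suc n"] by auto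
    have taS: "t (Suc n) < a n" for n using lt [OF lS] .
    have "decseq a" by (rule decseq_SucI) (use at taS in \<open>auto intro: less_imp_le less_trans\<close>)
    then obtain y where y: "a \<longlonglongrightarrow> y" "\<And>n. y \<le> a n"
      using decseq_convergent [of a 0] a0 by blast
    have ya: "y < a n" for n using at [of "Suc n"] taS [of n] y(2) [of "Suc n"] by simp
    have yt: "y < t n" for n using at [of n] y(2) [of n] by simp
    have "(\<lambda>n. t (Suc n)) \<longlonglongrightarrow> y"
      by (rule tendsto_sandwich [OF _ _ tendsto_const y(1)])
         (use taS yt in \<open>auto intro!: always_eventually less_imp_le\<close>)
    then have "t \<longlonglongrightarrow> y" by (simp add: filterlim_sequentially_Suc)
    then have lims: "filterlim a (at_right y) sequentially" "filterlim t (at_right y) sequentially"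
      using y(1) ya yt by (auto simp: filterlim_at intro!: always_eventually)
    have "0 \<le> y" using y(1) a0 by (intro LIMSEQ_le_const) auto
    then have "(Y \<longlongrightarrow> Y y) (at_right y)" using cadlag [rule_format, of y] by (simp add: continuous_within)
    from lim_contra [OF this lims] show False .
  qed
qed

end

text \<open>\<open>no_boundary\<close> excludes a terminal value lying exactly at the level: it
  could be first attained at the end of the lifetime, when the process is already back at 0, and the
  excursion would not stop it.\<close>

locale stopped_path = good_path X z L F \<omega>
  for X :: "real \<Rightarrow> 'a \<Rightarrow> 'e" and z :: 'e and L :: "real \<Rightarrow> 'a \<Rightarrow> real"
    and F :: "(real \<Rightarrow> 'e) \<Rightarrow> real \<Rightarrow> real" and \<omega> :: 'a +
  fixes v :: "real \<Rightarrow> ennreal"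
  assumes v_continuous: "continuous_on UNIV v"
    and v_mono_pos: "0 \<le> x \<Longrightarrow> x \<le> y \<Longrightarrow> v x \<le> v y"
    and v_mono_neg: "x \<le> 0 \<Longrightarrow> y \<le> x \<Longrightarrow> v x \<le> v y"
    and v_0: "v 0 = 0"
    and no_boundary: "0 < l \<Longrightarrow> ex l = Some \<epsilon> \<Longrightarrow> v (F \<epsilon> (V \<epsilon>)) \<noteq> ennreal l"
begin

lemma v_F_mono:
  assumes "\<epsilon> \<in> excursions z" "0 \<le> s" "s \<le> t" shows "v (F \<epsilon> s) \<le> v (F \<epsilon> t)"
  using F_sign_mono [OF assms(1)] assms(2,3) v_mono_pos [of "F \<epsilon> s" "F \<epsilon> t"] v_mono_neg [of "F \<epsilon> s" "F \<epsilon> t"] by blast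

definition R :: "real set" where
  "R = {l. 0 < l \<and> (\<exists>\<epsilon>. ex l = Some \<epsilon> \<and> ennreal l \<le> v (F \<epsilon> (V \<epsilon>)))}"

text \<open>Along an excursion \<open>L\<close> is constant and \<open>v\<close> of the functional
  increases, so the stopping condition persists to the end of the excursion. The interval so
  obtained contains rational times, which serves measurability.\<close>

lemma stop_in_excursion:
  assumes "0 < t" "ennreal (L t \<omega>) \<le> v (Y t)"
  shows "L t \<omega> \<in> R" "\<exists>u>t. \<forall>s\<in>{t..<u}. ennreal (L s \<omega>) \<le> v (Y s)"
proof -
  have Lt: "0 < L t \<omega>" using L_pos assms(1) by simp
  have "Y t \<noteq> 0"
  proof
    assume "Y t = 0"
    then show False using assms(2) v_0 Lt by simp
  qed
  then obtain \<epsilon> where e: "ex (L t \<omega>) = Some \<epsilon>" "\<tau>l (L t \<omega>) < t" "t < \<tau>l (L t \<omega>) + V \<epsilon>" "X t \<omega> \<noteq> z"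
      "Y t = F \<epsilon> (t - \<tau>l (L t \<omega>))"
    using Y_cases [of t] assms(1) by auto
  note E = ex_SomeD [OF less_imp_le [OF Lt] e(1)]
  have "v (Y t) \<le> v (F \<epsilon> (V \<epsilon>))" unfolding e(5) using e(2,3) by (intro v_F_mono E) auto
  with assms(2) have "ennreal (L t \<omega>) \<le> v (F \<epsilon> (V \<epsilon>))" by (rule order_trans)
  then show "L t \<omega> \<in> R" using Lt e(1) by (auto simp: R_def)
  have "ennreal (L s \<omega>) \<le> v (Y s)" if "s \<in> {t..<\<tau>l (L t \<omega>) + V \<epsilon>}" for s
  proof -
    have s: "L s \<omega> = L t \<omega>" "Y s = F \<epsilon> (s - \<tau>l (L t \<omega>))"
      using Y_excursion [OF less_imp_le [OF Lt] e(1), of s] that e(2) by auto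
    have "v (Y t) \<le> v (Y s)" unfolding e(5) s(2) using e(2) that by (intro v_F_mono E) auto
    with assms(2) show ?thesis unfolding s(1) by (rule order_trans)
  qed
  then show "\<exists>u>t. \<forall>s\<in>{t..<u}. ennreal (L s \<omega>) \<le> v (Y s)" using e(3) by blast
qed

text \<open>The stop occurs at the least age \<open>s0\<close> at which the level is reached,
  strictly inside the lifetime by \<open>no_boundary\<close>; earlier excursions do not stop since
  \<open>l\<close> is least. By continuity all values between 0 and \<open>Y t\<close> are passed
  before \<open>s0\<close>, where \<open>v\<close> is still below \<open>l\<close>.\<close>

lemma first_stop:
  assumes "l \<in> R" "\<And>l'. l' \<in> R \<Longrightarrow> l \<le> l'" "ex l = Some \<epsilon>"
  obtains t where "0 < t" "L t \<omega> = l" "v (Y t) = ennreal l"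
    "\<And>s. 0 < s \<Longrightarrow> s < t \<Longrightarrow> v (Y s) < ennreal (L s \<omega>)"
    "0 < F \<epsilon> (V \<epsilon>) \<longleftrightarrow> 0 < Y t"
    "\<And>y. 0 \<le> y \<Longrightarrow> y < Y t \<Longrightarrow> v y < ennreal l"
    "\<And>y. Y t < y \<Longrightarrow> y \<le> 0 \<Longrightarrow> v y < ennreal l"
proof -
  from assms(1,3) have l: "0 < l" "ennreal l \<le> v (F \<epsilon> (V \<epsilon>))" by (auto simp: R_def)
  note e = ex_SomeD [OF less_imp_le [OF l(1)] assms(3)]
  have cont: "continuous_on {0..V \<epsilon>} (\<lambda>s. v (F \<epsilon> s))"
    by (rule continuous_on_compose2 [OF v_continuous continuous_on_subset [OF F_cont [OF e(1)]]]) auto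
  obtain s1 where s1: "0 \<le> s1" "s1 \<le> V \<epsilon>" "v (F \<epsilon> s1) = ennreal l"
    using IVT' [of "\<lambda>s. v (F \<epsilon> s)" 0 "ennreal l" "V \<epsilon>"] cont F_0 [OF e(1)] v_0 e(5) l(2) by auto
  define A where "A = {s \<in> {0..V \<epsilon>}. ennreal l \<le> v (F \<epsilon> s)}"
  define s0 where "s0 = Inf A"
  have "closed ({0..V \<epsilon>} \<inter> (\<lambda>s. v (F \<epsilon> s)) -` {ennreal l..})"
    by (intro continuous_closed_preimage cont) auto
  moreover have "A = {0..V \<epsilon>} \<inter> (\<lambda>s. v (F \<epsilon> s)) -` {ennreal l..}" by (auto simp: A_def)
  ultimately have "closed A" by simp
  moreover have "s1 \<in> A" using s1 by (auto simp: A_def)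
  moreover have bdd: "bdd_below A" by (rule bdd_belowI [of _ 0]) (simp add: A_def)
  moreover have "A \<noteq> {}" using \<open>s1 \<in> A\<close> by blast
  ultimately have s0A: "s0 \<in> A" unfolding s0_def by (intro closed_contains_Inf)
  have s0_least: "s0 \<le> s" if "s \<in> A" for s unfolding s0_def using that bdd by (rule cInf_lower)
  have s0: "0 \<le> s0" "s0 \<le> s1" using s0A s0_least [OF \<open>s1 \<in> A\<close>] by (auto simp: A_def)
  have vs0: "v (F \<epsilon> s0) = ennreal l"
    using v_F_mono [OF e(1) s0] s1 s0A by (intro antisym) (auto simp: A_def)
  have "s0 \<noteq> 0" using vs0 F_0 [OF e(1)] v_0 l(1) by auto
  have "s1 \<noteq> V \<epsilon>" using no_boundary [OF l(1) assms(3)] s1 by auto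
  have s0': "0 < s0" "s0 < V \<epsilon>" using \<open>s0 \<noteq> 0\<close> \<open>s1 \<noteq> V \<epsilon>\<close> s0 s1 by auto
  have below: "v (F \<epsilon> s) < ennreal l" if "0 \<le> s" "s < s0" for s
  proof (rule ccontr)
    assume "\<not> v (F \<epsilon> s) < ennreal l"
    then have "s \<in> A" using that s0' by (simp add: A_def not_less)
    then show False using s0_least [of s] that by simp
  qed
  define t where "t = \<tau>l l + s0"
  have t: "L t \<omega> = l" "Y t = F \<epsilon> s0"
    using Y_excursion [OF less_imp_le [OF l(1)] assms(3), of t] s0' by (auto simp: t_def)
  have "0 < t" using inv_local_time_left_nonneg [of l] l s0' by (simp add: t_def)
  have F_cont0: "continuous_on {0..s0} (F \<epsilon>)" by (rule continuous_on_subset [OF F_cont [OF e(1)]]) auto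
  have between: "v y < ennreal l" if y: "(0 \<le> y \<and> y < Y t) \<or> (Y t < y \<and> y \<le> 0)" for y
  proof -
    obtain s where s: "0 \<le> s" "s \<le> s0" "F \<epsilon> s = y"
    proof (cases "0 \<le> y \<and> y < Y t")
      case True
      then show ?thesis
        using IVT' [of "F \<epsilon>" 0 y s0] F_cont0 F_0 [OF e(1)] s0'(1) that unfolding t(2) by fastforce
    next
      case False
      then have "Y t < y \<and> y \<le> 0" using y by blast
      then show ?thesis
        using IVT2' [of "F \<epsilon>" s0 y 0] F_cont0 F_0 [OF e(1)] s0'(1) that unfolding t(2) by fastforce
    qed
    moreover have "s \<noteq> s0" using s y t by auto
    ultimately show ?thesis using below [of s] by simp
  qed
  show thesis
  proof (rule that)
    show "0 < t" "L t \<omega> = l" "v (Y t) = ennreal l" using \<open>0 < t\<close> t vs0 by auto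
    show "v (Y s) < ennreal (L s \<omega>)" if s: "0 < s" "s < t" for s
    proof (rule ccontr)
      assume "\<not> v (Y s) < ennreal (L s \<omega>)"
      then have C: "ennreal (L s \<omega>) \<le> v (Y s)" by simp
      have "l \<le> L s \<omega>" using assms(2) stop_in_excursion(1) [OF s(1) C] .
      moreover have "L s \<omega> \<le> l" using L_mono [of s t] s t by simp
      ultimately have Ls: "L s \<omega> = l" by simp
      then have "\<tau>l l \<le> s" using L_eq_iff [of s l] s l by auto
      then have "Y s = F \<epsilon> (s - \<tau>l l)"
        using Y_excursion(2) [OF less_imp_le [OF l(1)] assms(3), of s] s s0' by (auto simp: t_def)
      then show False using below [of "s - \<tau>l l"] C Ls \<open>\<tau>l l \<le> s\<close> s by (auto simp: t_def)
    qed
    have "Y t \<noteq> 0" using vs0 v_0 l t by auto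
    show "0 < F \<epsilon> (V \<epsilon>) \<longleftrightarrow> 0 < Y t"
    proof (rule disjE [OF F_sign_mono [OF e(1)]])
      assume *: "\<forall>s t. 0 \<le> s \<longrightarrow> s \<le> t \<longrightarrow> 0 \<le> F \<epsilon> s \<and> F \<epsilon> s \<le> F \<epsilon> t"
      have "0 \<le> F \<epsilon> s0" "F \<epsilon> s0 \<le> F \<epsilon> (V \<epsilon>)" using *[rule_format, of s0 "V \<epsilon>"] s0' by auto
      then show ?thesis using \<open>Y t \<noteq> 0\<close> unfolding t(2) by linarith
    next
      assume *: "\<forall>s t. 0 \<le> s \<longrightarrow> s \<le> t \<longrightarrow> F \<epsilon> s \<le> 0 \<and> F \<epsilon> t \<le> F \<epsilon> s"
      have "F \<epsilon> s0 \<le> 0" "F \<epsilon> (V \<epsilon>) \<le> F \<epsilon> s0" using *[rule_format, of s0 "V \<epsilon>"] s0' by auto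
      then show ?thesis unfolding t(2) by linarith
    qed
    show "v y < ennreal l" if "0 \<le> y" "y < Y t" for y using between [of y] that by simp
    show "v y < ennreal l" if "Y t < y" "y \<le> 0" for y using between [of y] that by simp
  qed
qed

end

section \<open>The Poisson process of excursions\<close>

lemma (in complete_measure) AE_measurable:
  assumes "f \<in> M \<rightarrow>\<^sub>M N" "AE x in M. f x = g x" "g \<in> space M \<rightarrow> space N"
  shows "g \<in> M \<rightarrow>\<^sub>M N"
proof (rule measurableI)
  show "g x \<in> space N" if "x \<in> space M" for x using assms(3) that by auto
  fix A assume "A \<in> sets N"
  then have "f -` A \<inter> space M \<in> sets M" using assms(1) by (rule measurable_sets [rotated])
  then show "g -` A \<inter> space M \<in> sets M"
  proof (rule in_sets_AE [rotated])
    show "AE x in M. x \<in> f -` A \<inter> space M \<longleftrightarrow> x \<in> g -` A \<inter> space M"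
      using assms(2) by eventually_elim auto
  qed auto
qed

context excursion_functional
begin

abbreviation FV :: "(real \<Rightarrow> 'e) \<Rightarrow> real" where "FV \<epsilon> \<equiv> F \<epsilon> (lifetime z \<epsilon>)"
abbreviation "eps \<equiv> excursion_process X z L"
abbreviation "J \<equiv> restrict_space (lborel :: real measure) {0..} \<Otimes>\<^sub>M n"
abbreviation "FX \<equiv> functional_process X z L F"
abbreviation "\<nu> \<equiv> functional_measure z n F"

lemma excursions_extensional: "excursions z \<subseteq> extensional {0..}"
  by (auto simp: excursions_def)

lemma space_n: "space n = excursions z"
proof -
  have "space n = space (excursion_algebra z)" using n_sets by (rule sets_eq_imp_space_eq)
  also have "\<dots> = excursions z"
    using excursions_extensional
    by (auto simp: excursion_algebra_def path_algebra_def space_restrict_space space_PiM PiE_def)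
  finally show ?thesis .
qed

lemma F_measurable: assumes "0 \<le> t" shows "(\<lambda>\<epsilon>. F \<epsilon> t) \<in> borel_measurable n"
proof -
  have "(\<lambda>\<epsilon>. restrict \<epsilon> {0..t}) \<in> excursion_algebra z \<rightarrow>\<^sub>M PiM {0..t} (\<lambda>_. borel)"
    unfolding excursion_algebra_def path_algebra_def
    by (intro measurable_restrict_space1 measurable_restrict_subset) auto
  then have "(\<lambda>\<epsilon>. restrict \<epsilon> {0..t}) \<in> n \<rightarrow>\<^sub>M PiM {0..t} (\<lambda>_. borel)"
    using n_sets by (simp cong: measurable_cong_sets)
  then have "(\<lambda>\<epsilon>. \<epsilon>) \<in> n \<rightarrow>\<^sub>M vimage_algebra (excursions z) (\<lambda>\<epsilon>. restrict \<epsilon> {0..t}) (PiM {0..t} (\<lambda>_. borel))"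
    by (intro measurable_vimage_algebra2) (auto simp: space_n)
  from measurable_compose [OF this F_nonanticipating [OF assms]] show ?thesis .
qed

text \<open>Measurability of the lifetime is avoided: the functional is constant after it, so the
  terminal value is a limit along integer times.\<close>

lemma FV_measurable [measurable]: "FV \<in> borel_measurable n"
proof (rule borel_measurable_LIMSEQ_real)
  show "(\<lambda>\<epsilon>. F \<epsilon> (real k)) \<in> borel_measurable n" for k by (rule F_measurable) simp
  fix \<epsilon> assume e: "\<epsilon> \<in> space n"
  obtain k0 where "lifetime z \<epsilon> \<le> real k0" using real_arch_simple by blast
  have "\<forall>\<^sub>F k in sequentially. F \<epsilon> (real k) = FV \<epsilon>"
    using eventually_ge_at_top [of k0]
  proof eventually_elim
    case (elim k)
    then have "lifetime z \<epsilon> \<le> real k" using \<open>lifetime z \<epsilon> \<le> real k0\<close> by simp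
    then show ?case using e by (intro F_end) (simp_all add: space_n)
  qed
  then show "(\<lambda>k. F \<epsilon> (real k)) \<longlonglongrightarrow> FV \<epsilon>" by (rule tendsto_eventually)
qed

lemma sets_nu [measurable_cong, simp]: "sets \<nu> = sets borel" by (simp add: functional_measure_def)

lemma nn_integral_nu: "g \<in> borel_measurable borel \<Longrightarrow> (\<integral>\<^sup>+y. g y \<partial>\<nu>) = (\<integral>\<^sup>+\<epsilon>. g (FV \<epsilon>) \<partial>n)"
  unfolding functional_measure_def by (subst nn_integral_distr) auto

lemma emeasure_nu: "A \<in> sets borel \<Longrightarrow> emeasure \<nu> A = emeasure n {\<epsilon> \<in> space n. FV \<epsilon> \<in> A}"
  unfolding functional_measure_def by (subst emeasure_distr) (auto intro!: arg_cong [where f="emeasure n"])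

lemma ppp:
  shows n_sigma_finite: "sigma_finite_measure n"
    and AE_ex: "AE \<omega> in M. \<forall>l\<ge>0. eps l \<omega> \<in> insert None (Some ` space n)"
    and count_measurable: "\<And>B. B \<in> sets J \<Longrightarrow> point_count eps B \<in> borel_measurable M"
    and count_poisson: "\<And>B k. B \<in> sets J \<Longrightarrow> emeasure J B < \<infinity> \<Longrightarrow>
      measure M {\<omega> \<in> space M. point_count eps B \<omega> = of_nat k} = measure J B ^ k / fact k * exp (- measure J B)"
    and count_infinite: "\<And>B. B \<in> sets J \<Longrightarrow> emeasure J B = \<infinity> \<Longrightarrow> AE \<omega> in M. point_count eps B \<omega> = \<infinity>"
    and count_indep: "\<And>(m::nat) B. (\<And>i. i < m \<Longrightarrow> B i \<in> sets J) \<Longrightarrow> disjoint_family_on B {..<m} \<Longrightarrow>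
      indep_vars (\<lambda>_. borel) (\<lambda>i. point_count eps (B i)) {..<m}"
  using n_characteristic unfolding poisson_point_process_def Let_def by auto

definition void :: "(real \<times> (real \<Rightarrow> 'e)) set \<Rightarrow> 'a \<Rightarrow> bool" where
  "void B \<omega> \<longleftrightarrow> (\<forall>l \<epsilon>. eps l \<omega> = Some \<epsilon> \<longrightarrow> (l, \<epsilon>) \<notin> B)"

lemma void_count: "void B \<omega> \<longleftrightarrow> point_count eps B \<omega> = 0"
  unfolding void_def point_count_def by (subst emeasure_count_space_eq_0) auto

lemma void_measurable [measurable]: "B \<in> sets J \<Longrightarrow> {\<omega> \<in> space M. void B \<omega>} \<in> sets M"
proof -
  assume "B \<in> sets J"
  then have "point_count eps B -` {0} \<inter> space M \<in> sets M"
    by (intro measurable_sets [OF count_measurable]) auto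
  also have "point_count eps B -` {0} \<inter> space M = {\<omega> \<in> space M. void B \<omega>}" by (auto simp: void_count)
  finally show ?thesis .
qed

lemma void_prob:
  assumes "B \<in> sets J" "emeasure J B < \<infinity>"
  shows "measure M {\<omega> \<in> space M. void B \<omega>} = exp (- measure J B)"
  using count_poisson [OF assms, of 0] by (simp add: void_count)

lemma void_null: "B \<in> sets J \<Longrightarrow> emeasure J B = 0 \<Longrightarrow> AE \<omega> in M. void B \<omega>"
  using void_prob [of B] prob_Collect_eq_1 [OF void_measurable, of B] by (simp add: measure_def)

lemma void_indep:
  assumes "C0 \<in> sets J" "C1 \<in> sets J" "C2 \<in> sets J" "C0 \<inter> C1 = {}" "C0 \<inter> C2 = {}" "C1 \<inter> C2 = {}"
    and "emeasure J C0 < \<infinity>" "emeasure J C1 < \<infinity>" "emeasure J C2 < \<infinity>"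
  shows "measure M {\<omega> \<in> space M. void C0 \<omega> \<and> \<not> void C1 \<omega> \<and> void C2 \<omega>} =
    exp (- measure J C0) * (1 - exp (- measure J C1)) * exp (- measure J C2)"
proof -
  define B where "B i = (if i = 0 then C0 else if i = 1 then C1 else C2)" for i :: nat
  define A :: "nat \<Rightarrow> ennreal set" where "A i = (if i = 1 then - {0} else {0})" for i
  have three: "{..<3::nat} = {0, 1, 2}" by auto
  have "indep_vars (\<lambda>_. borel) (\<lambda>i. point_count eps (B i)) {..<3::nat}"
    using assms by (intro count_indep) (auto simp: B_def disjoint_family_on_def)
  from indep_varsD_finite [OF this, of A]
  have "prob (\<Inter>i\<in>{..<3}. point_count eps (B i) -` A i \<inter> space M) = (\<Prod>i\<in>{..<3}. prob (point_count eps (B i) -` A i \<inter> space M))"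
    by (auto simp: A_def three)
  moreover have "(\<Inter>i\<in>{..<3}. point_count eps (B i) -` A i \<inter> space M) = {\<omega> \<in> space M. void C0 \<omega> \<and> \<not> void C1 \<omega> \<and> void C2 \<omega>}"
    unfolding three void_count by (auto simp: B_def A_def)
  moreover have "point_count eps C -` {0} \<inter> space M = {\<omega> \<in> space M. void C \<omega>}" for C
    by (auto simp: void_count)
  moreover have "prob (point_count eps C1 -` (- {0}) \<inter> space M) = 1 - exp (- measure J C1)"
  proof -
    have "point_count eps C1 -` (- {0}) \<inter> space M = space M - {\<omega> \<in> space M. void C1 \<omega>}"
      by (auto simp: void_count)
    then show ?thesis using assms by (simp add: prob_compl void_prob)
  qed
  ultimately show ?thesis using assms by (simp add: three B_def A_def void_prob)
qed

text \<open>The points at local time 0 form a set of intensity 0.\<close>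

lemma AE_ex_0: "AE \<omega> in M. eps 0 \<omega> = None"
proof -
  have 0: "{0::real} \<in> sets (restrict_space lborel {0..})"
    by (subst sets_restrict_space_iff) auto
  then have B: "{0::real} \<times> space n \<in> sets J" by (intro pair_measureI) auto
  interpret n: sigma_finite_measure n by (rule n_sigma_finite)
  have "emeasure J ({0::real} \<times> space n) = emeasure (restrict_space lborel {0..}) {0::real} * emeasure n (space n)"
    by (rule n.emeasure_pair_measure_Times [OF 0]) simp
  also have "\<dots> = 0" by (subst emeasure_restrict_space) auto
  finally have "AE \<omega> in M. void ({0::real} \<times> space n) \<omega>" using B by (intro void_null)
  with AE_ex show ?thesis
  proof eventually_elim
    case (elim \<omega>)
    show ?case
    proof (cases "eps 0 \<omega>")
      case (Some \<epsilon>)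
      then show ?thesis using elim(1) [rule_format, of 0] elim(2) by (auto simp: void_def)
    qed simp
  qed
qed

lemma AE_good_path: "AE \<omega> in M. good_path X z L F \<omega>"
  using L_paths L_unbounded AE_ex AE_ex_0
proof eventually_elim
  case (elim \<omega>)
  show ?case
    by unfold_locales (use elim F_monotone F_continuous F_start in \<open>auto simp: space_n\<close>)
qed

lemma lborel_pair_sigma_finite: "pair_sigma_finite (restrict_space lborel {0::real..}) n"
  unfolding pair_sigma_finite_def
  by (intro conjI n_sigma_finite sigma_finite_measure_restrict_space sigma_finite_lborel) auto

lemma J_cylinder:
  assumes "A \<in> sets n" shows "{0..K} \<times> A \<in> sets J" "0 \<le> K \<Longrightarrow> emeasure J ({0..K} \<times> A) = ennreal K * emeasure n A"
proof -
  interpret n: sigma_finite_measure n by (rule n_sigma_finite)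
  have 0: "{0..K} \<in> sets (restrict_space lborel {0..})"
    by (subst sets_restrict_space_iff) auto
  then show "{0..K} \<times> A \<in> sets J" using assms by (intro pair_measureI)
  show "emeasure J ({0..K} \<times> A) = ennreal K * emeasure n A" if "0 \<le> K"
    using that by (subst n.emeasure_pair_measure_Times [OF 0 assms]) (subst emeasure_restrict_space, auto)
qed

text \<open>Infinite mass would put infinitely many large excursions into local time
  \<open>[0,1]\<close>, contradicting \<open>finite_large_excursions\<close> through the regularity
  of paths.\<close>

lemma FV_large_finite: assumes "0 < c" shows "emeasure n {\<epsilon> \<in> space n. c \<le> \<bar>FV \<epsilon>\<bar>} < \<infinity>"
proof (rule ccontr)
  define A where "A = {\<epsilon> \<in> space n. c \<le> \<bar>FV \<epsilon>\<bar>}"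
  have A: "A \<in> sets n" unfolding A_def by measurable
  assume "\<not> emeasure n {\<epsilon> \<in> space n. c \<le> \<bar>FV \<epsilon>\<bar>} < \<infinity>"
  then have "emeasure n A = \<infinity>" by (simp add: A_def top.not_eq_extremum [symmetric])
  then have "emeasure J ({0..1} \<times> A) = \<infinity>"
    using J_cylinder(2) [OF A, of 1] by simp
  then have "AE \<omega> in M. point_count eps ({0..1} \<times> A) \<omega> = \<infinity>"
    using A by (intro count_infinite J_cylinder)
  with AE_good_path F_cadlag have "AE \<omega> in M. False"
  proof eventually_elim
    case (elim \<omega>)
    interpret good_path X z L F \<omega> by fact
    have "finite {l. 0 \<le> l \<and> l \<le> 1 \<and> (\<exists>\<epsilon>. eps l \<omega> = Some \<epsilon> \<and> c \<le> \<bar>FV \<epsilon>\<bar>)}"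
      by (rule finite_large_excursions [OF elim(2) assms])
    then have "finite {l. \<exists>x. eps l \<omega> = Some x \<and> (l, x) \<in> {0..1} \<times> A}"
      by (rule finite_subset [rotated]) (auto simp: A_def)
    then show False using elim(3) by (simp add: point_count_def)
  qed
  then show False by simp
qed

lemma nu_tails: assumes "0 < c" shows "emeasure \<nu> {c..} < \<infinity>" "emeasure \<nu> {..-c} < \<infinity>"
proof -
  have "emeasure \<nu> B < \<infinity>" if "B \<in> sets borel" "\<And>x. x \<in> B \<Longrightarrow> c \<le> \<bar>x\<bar>" for B
  proof -
    have "emeasure \<nu> B \<le> emeasure n {\<epsilon> \<in> space n. c \<le> \<bar>FV \<epsilon>\<bar>}"
      unfolding emeasure_nu [OF that(1)] using that(2) by (intro emeasure_mono) auto
    then show ?thesis using FV_large_finite [OF assms] by (rule order.strict_trans1)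
  qed
  note * = this
  show "emeasure \<nu> {c..} < \<infinity>" "emeasure \<nu> {..-c} < \<infinity>" by (rule *; force)+
qed

lemma nu_sigma_finite: "sigma_finite_measure \<nu>"
proof
  let ?C = "{{0}} \<union> (range (\<lambda>k. {1 / real (Suc k)..})) \<union> (range (\<lambda>k. {..- (1 / real (Suc k))}))"
  show "\<exists>A. countable A \<and> A \<subseteq> sets \<nu> \<and> \<Union>A = space \<nu> \<and> (\<forall>a\<in>A. emeasure \<nu> a \<noteq> \<infinity>)"
  proof (intro exI [of _ ?C] conjI ballI)
    have "x \<in> \<Union>?C" for x :: real
    proof (cases "x = 0")
      case False
      then obtain k where k: "inverse (real (Suc k)) < \<bar>x\<bar>" using reals_Archimedean [of "\<bar>x\<bar>"] by auto
      then have "x \<in> {1 / real (Suc k)..} \<or> x \<in> {..- (1 / real (Suc k))}" by (auto simp: inverse_eq_divide abs_if split: if_splits)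
      then show ?thesis by blast
    qed auto
    then have "\<Union>?C = UNIV" by (intro UNIV_eq_I [symmetric])
    then show "\<Union>?C = space \<nu>" by (simp only: functional_measure_def space_distr space_borel)
    fix a assume "a \<in> ?C"
    then consider "a = {0}" | k where "a = {1 / real (Suc k)..}" | k where "a = {..- (1 / real (Suc k))}" by blast
    then show "emeasure \<nu> a \<noteq> \<infinity>"
    proof cases
      case 1
      \<comment> \<open>Terminal values are never 0, so \<open>{0}\<close> is null and completes the
        cover by tails away from 0.\<close>
      have *: "{\<epsilon> \<in> space n. FV \<epsilon> \<in> {0}} = {}" using F_nonzero by (auto simp: space_n)
      show ?thesis using 1 emeasure_nu [of "{0}"] unfolding * by simp
    next
      case 2 then show ?thesis using nu_tails(1) [of "1 / real (Suc k)"] by (simp add: less_top)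
    next
      case 3 then show ?thesis using nu_tails(2) [of "1 / real (Suc k)"] by (simp add: less_top)
    qed
  qed auto
qed

end

section \<open>Adaptedness\<close>

lemma right_continuous_sequence:
  fixes f :: "real \<Rightarrow> 'b::topological_space"
  assumes "continuous (at_right t) f" "x \<longlonglongrightarrow> t" "\<And>k. t \<le> x k"
  shows "(\<lambda>k. f (x k)) \<longlonglongrightarrow> f t"
proof (rule topological_tendstoI)
  fix S assume S: "open S" "f t \<in> S"
  then have "\<forall>\<^sub>F y in at_right t. f y \<in> S"
    using assms(1) by (auto simp: continuous_within dest: topological_tendstoD)
  then obtain b where b: "t < b" "\<And>y. t < y \<Longrightarrow> y < b \<Longrightarrow> f y \<in> S"
    by (auto simp: eventually_at_right [of t "t + 1"])
  have "\<forall>\<^sub>F k in sequentially. x k < b" using assms(2) b(1) by (rule order_tendstoD)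
  then show "\<forall>\<^sub>F k in sequentially. f (x k) \<in> S"
  proof eventually_elim
    case (elim k)
    then show ?case using assms(3) [of k] b(2) [of "x k"] S(2) by (cases "x k = t") auto
  qed
qed

context excursion_functional
begin

abbreviation "\<F> \<equiv> usual_filtration M X"

lemma space_filt [simp]: "space (\<F> t) = space M"
  by (rule filtration.space_F [OF filtration_usual_filtration])

lemma filt_mono: "s \<le> t \<Longrightarrow> sets (\<F> s) \<subseteq> sets (\<F> t)"
  by (rule filtration.sets_F_mono [OF filtration_usual_filtration])

lemma filt_null: "N \<in> null_sets M \<Longrightarrow> N \<in> sets (\<F> t)"
  unfolding sets_usual_filtration by (auto intro: sigma_sets.Basic)

lemma filt_subset: "sets (\<F> t) \<subseteq> sets M"
proof -
  have "sets (\<F> t) \<subseteq> sigma_sets (space M) (history_sets M X \<infinity> \<union> null_sets M)"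
    unfolding sets_usual_filtration by blast
  also have "\<dots> \<subseteq> sets M"
    by (rule sets.sigma_sets_subset) (auto simp: history_sets_def intro!: measurable_sets [OF X_measurable])
  finally show ?thesis .
qed

lemma filt_AE:
  assumes "A \<in> sets (\<F> t)" "AE \<omega> in M. \<omega> \<in> A \<longleftrightarrow> \<omega> \<in> B" "B \<subseteq> space M"
  shows "B \<in> sets (\<F> t)"
proof -
  have A: "A \<subseteq> space M" using sets.sets_into_space [OF assms(1)] by simp
  have "(AE x in M. x \<notin> B - A \<and> x \<notin> A - B)"
    using assms(2) by eventually_elim auto
  then have "B - A \<in> null_sets M" "A - B \<in> null_sets M"
    using A assms(3) unfolding null_sets_iff_AE by auto
  then have "A \<union> (B - A) - (A - B) \<in> sets (\<F> t)"
    using assms(1) filt_null by blast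
  also have "A \<union> (B - A) - (A - B) = B"
    by auto
  finally show "B \<in> sets (\<F> t)" .
qed

lemma filt_AE_measurable:
  assumes "f \<in> \<F> t \<rightarrow>\<^sub>M N" "AE x in M. f x = g x" "g \<in> space M \<rightarrow> space N"
  shows "g \<in> \<F> t \<rightarrow>\<^sub>M N"
proof (rule measurableI)
  show "g x \<in> space N" if "x \<in> space (\<F> t)" for x using assms(3) that by auto
  fix A assume "A \<in> sets N"
  then have "f -` A \<inter> space (\<F> t) \<in> sets (\<F> t)" using assms(1) by (rule measurable_sets [rotated])
  then show "g -` A \<inter> space (\<F> t) \<in> sets (\<F> t)"
  proof (rule filt_AE)
    show "AE x in M. x \<in> f -` A \<inter> space (\<F> t) \<longleftrightarrow> x \<in> g -` A \<inter> space (\<F> t)"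
      using assms(2) by eventually_elim auto
  qed auto
qed

lemma measurable_filt_mono: "s \<le> t \<Longrightarrow> f \<in> \<F> s \<rightarrow>\<^sub>M N \<Longrightarrow> f \<in> \<F> t \<rightarrow>\<^sub>M N"
  using measurable_mono [of N N "\<F> s" "\<F> t"] filt_mono [of s t] by auto

lemma X_adapted: assumes "0 \<le> s" "ennreal s \<le> t" shows "X s \<in> borel_measurable (\<F> t)"
proof (rule measurableI)
  fix A :: "'e set" assume A: "A \<in> sets borel"
  have "X s -` A \<inter> space M \<in> history_sets M X u" if "t < u \<or> u = \<infinity>" for u
  proof -
    have "ennreal s \<le> u" using that assms(2) by (auto intro: less_imp_le order_trans)
    then show ?thesis using A assms(1) unfolding history_sets_def by blast
  qed
  then show "X s -` A \<inter> space (\<F> t) \<in> sets (\<F> t)"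
    unfolding sets_usual_filtration by (auto intro: sigma_sets.Basic)
qed simp

lemma L_measurable: assumes "0 \<le> s" "ennreal s \<le> t" shows "L s \<in> borel_measurable (\<F> t)"
  using measurable_filt_mono [OF assms(2) L_adapted [OF assms(1)]] .

text \<open>The beginning of the excursion straddling \<open>q\<close> is where \<open>L\<close> first reaches \<open>L\<^sub>q\<close>, so it is
  approximated from above by the first dyadic point at which \<open>L\<close> takes that value.\<close>

lemma process_adapted: assumes q: "0 < q" shows "FX q \<in> borel_measurable (\<F> (ennreal q))"
proof -
  let ?Fq = "\<F> (ennreal q)"
  define G where "G = {\<omega> \<in> space M. good_path X z L F \<omega>}"
  have G_AE: "AE \<omega> in M. \<omega> \<in> G" using AE_good_path AE_space by eventually_elim (simp add: G_def)
  have "space M \<in> sets ?Fq" using sets.top [of ?Fq] by simp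
  then have G_sets: "G \<in> sets ?Fq"
    by (rule filt_AE) (use G_AE AE_space in \<open>auto simp: G_def\<close>)
  then have G_Int: "G \<inter> space M \<in> sets ?Fq" by (metis sets.Int_space_eq2 space_filt)
  define \<beta> where "\<beta> k i = real i * q / 2 ^ k" for k i :: nat
  have \<beta>0: "0 \<le> \<beta> k i" for k i using q by (simp add: \<beta>_def)
  have \<beta>q: "\<beta> k i \<le> q \<longleftrightarrow> i \<le> 2 ^ k" for k i
  proof -
    have "\<beta> k i \<le> q \<longleftrightarrow> real i * q \<le> 2 ^ k * q" by (simp add: \<beta>_def field_simps)
    also have "\<dots> \<longleftrightarrow> real i \<le> 2 ^ k" using q by simp
    also have "\<dots> \<longleftrightarrow> i \<le> 2 ^ k" by (metis of_nat_le_iff of_nat_numeral of_nat_power)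
    finally show ?thesis .
  qed
  have Lb: "L (\<beta> k i) \<in> borel_measurable ?Fq" if "i \<le> 2 ^ k" for k i
    using that \<beta>0 \<beta>q by (intro L_measurable) (auto intro: ennreal_leI)
  have Lq: "L q \<in> borel_measurable ?Fq" using q by (intro L_measurable) auto
  have Leq: "{\<omega> \<in> space M. L (\<beta> k i) \<omega> = L q \<omega>} \<in> sets ?Fq" if "i \<le> 2 ^ k" for k i
    using borel_measurable_eq [OF Lb [OF that] Lq] by simp
  \<comment> \<open>The default index \<open>2 ^ k\<close> stands for the time \<open>q\<close>
    itself, where the equality is trivial, so the search always succeeds.\<close>
  define idx where "idx k \<omega> = (LEAST i. 2 ^ k \<le> i \<or> L (\<beta> k i) \<omega> = L q \<omega>)" for k \<omega>
  have idx_le: "idx k \<omega> \<le> 2 ^ k" for k \<omega> unfolding idx_def by (rule Least_le) simp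
  have idx_measurable: "idx k \<in> ?Fq \<rightarrow>\<^sub>M count_space UNIV" for k
    unfolding idx_def
  proof (rule measurable_Least)
    fix i
    show "Measurable.pred ?Fq (\<lambda>\<omega>. 2 ^ k \<le> i \<or> L (\<beta> k i) \<omega> = L q \<omega>)"
    proof (cases "2 ^ k \<le> i")
      case False
      then show ?thesis using Leq [of i k] by (simp add: pred_def)
    qed simp
  qed
  define \<alpha> where "\<alpha> \<omega> = inv_local_time_left L (L q \<omega>) \<omega>" for \<omega>
  define a where "a k \<omega> = \<beta> k (idx k \<omega>)" for k \<omega>
  have good: "0 \<le> \<alpha> \<omega> \<and> \<alpha> \<omega> \<le> q \<and> (\<forall>s. 0 \<le> s \<longrightarrow> s \<le> q \<longrightarrow> L s \<omega> = L q \<omega> \<longleftrightarrow> \<alpha> \<omega> \<le> s)" if "\<omega> \<in> G" for \<omega>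
  proof -
    interpret good_path X z L F \<omega> using that by (simp add: G_def)
    have Lq0: "0 \<le> L q \<omega>" using q by (intro L_nonneg) simp
    then have "0 \<le> \<alpha> \<omega>" unfolding \<alpha>_def by (rule inv_local_time_left_nonneg)
    moreover have *: "\<alpha> \<omega> \<le> s \<longleftrightarrow> L s \<omega> = L q \<omega>" if "0 \<le> s" "s \<le> q" for s
      using inv_local_time_left_le [OF that(1) Lq0] L_mono [OF that] by (auto simp: \<alpha>_def)
    ultimately show ?thesis using * [of q] q by auto
  qed
  have a_good: "\<alpha> \<omega> \<le> a k \<omega> \<and> a k \<omega> \<le> q \<and> a k \<omega> \<le> \<alpha> \<omega> + q / 2 ^ k \<and> L (a k \<omega>) \<omega> = L q \<omega>" if "\<omega> \<in> G" for k \<omega>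
  proof -
    have P: "2 ^ k \<le> idx k \<omega> \<or> L (\<beta> k (idx k \<omega>)) \<omega> = L q \<omega>"
      unfolding idx_def by (rule LeastI [of _ "2 ^ k"]) simp
    have top: "\<beta> k (2 ^ k) = q" by (simp add: \<beta>_def)
    have "L (a k \<omega>) \<omega> = L q \<omega>"
      using P idx_le [of k \<omega>] top by (auto simp: a_def dest: antisym)
    moreover have le: "a k \<omega> \<le> q" using idx_le [of k \<omega>] by (simp add: a_def \<beta>q)
    moreover have "\<alpha> \<omega> \<le> a k \<omega>" using good [OF that] calculation \<beta>0 by (auto simp: a_def)
    moreover have "a k \<omega> \<le> \<alpha> \<omega> + q / 2 ^ k"
    proof (cases "idx k \<omega>")
      case 0
      then show ?thesis using good [OF that] q by (simp add: a_def \<beta>_def)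
    next
      case (Suc j)
      have "\<not> (2 ^ k \<le> j \<or> L (\<beta> k j) \<omega> = L q \<omega>)"
        by (rule not_less_Least) (use Suc in \<open>simp add: idx_def [symmetric]\<close>)
      then have "\<beta> k j < \<alpha> \<omega>" using good [OF that] \<beta>0 [of k j] \<beta>q [of k j] by (auto simp: not_le)
      moreover have "a k \<omega> = \<beta> k j + q / 2 ^ k" by (simp add: a_def \<beta>_def Suc field_simps)
      ultimately show ?thesis by simp
    qed
    ultimately show ?thesis by simp
  qed
  have a_lim: "(\<lambda>k. a k \<omega>) \<longlonglongrightarrow> \<alpha> \<omega>" if "\<omega> \<in> G" for \<omega>
  proof (rule tendsto_sandwich [of "\<lambda>_. \<alpha> \<omega>" _ _ "\<lambda>k. \<alpha> \<omega> + q / 2 ^ k"])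
    have "(\<lambda>k. q * (1 / 2) ^ k) \<longlonglongrightarrow> 0" by (intro tendsto_mult_right_zero LIMSEQ_power_zero) simp
    then have "(\<lambda>k. q / 2 ^ k) \<longlonglongrightarrow> 0" by (simp add: power_divide)
    from tendsto_add [OF tendsto_const this] show "(\<lambda>k. \<alpha> \<omega> + q / 2 ^ k) \<longlonglongrightarrow> \<alpha> \<omega>" by simp
  qed (use a_good [OF that] in auto)
  \<comment> \<open>The path from the start of the straddling excursion, frozen at \<open>q\<close>
    so that nothing later is consulted.\<close>
  define \<xi> where "\<xi> s \<omega> = (if \<omega> \<in> G then X (min (\<alpha> \<omega> + s) q) \<omega> else z)" for s \<omega>
  have \<xi>_measurable: "\<xi> s \<in> borel_measurable ?Fq" if "0 \<le> s" for s
  proof (rule borel_measurable_LIMSEQ_metric)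
    fix k
    have "(\<lambda>\<omega>. X (min (\<beta> k i + s) q) \<omega>) \<in> borel_measurable ?Fq" for i
      using \<beta>0 [of k i] that q by (intro X_adapted) (auto intro: ennreal_leI)
    then have "(\<lambda>\<omega>. X (min (\<beta> k (idx k \<omega>) + s) q) \<omega>) \<in> borel_measurable ?Fq"
      by (rule measurable_compose_countable [OF _ idx_measurable])
    then show "(\<lambda>\<omega>. if \<omega> \<in> G then X (min (a k \<omega> + s) q) \<omega> else z) \<in> borel_measurable ?Fq"
      unfolding a_def using G_Int by (intro measurable_If_set) auto
  next
    fix \<omega> assume "\<omega> \<in> space ?Fq"
    show "(\<lambda>k. if \<omega> \<in> G then X (min (a k \<omega> + s) q) \<omega> else z) \<longlonglongrightarrow> \<xi> s \<omega>"
    proof (cases "\<omega> \<in> G")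
      case True
      have "(\<lambda>k. X (min (a k \<omega> + s) q) \<omega>) \<longlonglongrightarrow> X (min (\<alpha> \<omega> + s) q) \<omega>"
      proof (rule right_continuous_sequence [of _ "\<lambda>t. X t \<omega>"])
        show "continuous (at_right (min (\<alpha> \<omega> + s) q)) (\<lambda>t. X t \<omega>)"
          using good [OF True] that q True by (intro X_right_continuous) (auto simp: G_def)
        show "(\<lambda>k. min (a k \<omega> + s) q) \<longlonglongrightarrow> min (\<alpha> \<omega> + s) q"
          by (intro tendsto_min tendsto_add a_lim [OF True] tendsto_const)
        show "min (\<alpha> \<omega> + s) q \<le> min (a k \<omega> + s) q" for k
          using a_good [OF True, of k] by auto
      qed
      then show ?thesis using True by (simp add: \<xi>_def)
    qed (simp add: \<xi>_def)
  qed
  \<comment> \<open>A dyadic time strictly before \<open>q\<close> with the same local time shows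
    that the excursion began before \<open>q\<close>; since \<open>X q \<omega> \<noteq> z\<close>,
    it is still running.\<close>
  define E where "E k i = {\<omega> \<in> G. X q \<omega> \<noteq> z \<and> (\<exists>k'. \<exists>j<2 ^ k'. L (\<beta> k' j) \<omega> = L q \<omega>) \<and> L (\<beta> k i) \<omega> = L q \<omega>}" for k i
  have E_sets: "E k i \<in> sets ?Fq" if "i \<le> 2 ^ k" for k i
  proof -
    have "{\<omega> \<in> space M. X q \<omega> \<noteq> z} \<in> sets ?Fq"
    proof -
      have "X q -` (- {z}) \<inter> space ?Fq \<in> sets ?Fq"
        using q by (intro measurable_sets [OF X_adapted]) auto
      also have "X q -` (- {z}) \<inter> space ?Fq = {\<omega> \<in> space M. X q \<omega> \<noteq> z}" by auto
      finally show ?thesis .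
    qed
    moreover have "(\<Union>k'. \<Union>j\<in>{..<2 ^ k'}. {\<omega> \<in> space M. L (\<beta> k' j) \<omega> = L q \<omega>}) \<in> sets ?Fq"
    proof -
      have "(\<Union>j\<in>{..<2 ^ k'}. {\<omega> \<in> space M. L (\<beta> k' j) \<omega> = L q \<omega>}) \<in> sets ?Fq" for k'
        by (intro sets.finite_UN Leq) auto
      then show ?thesis by (intro sets.countable_UN) auto
    qed
    ultimately have "G \<inter> {\<omega> \<in> space M. X q \<omega> \<noteq> z} \<inter> (\<Union>k'. \<Union>j\<in>{..<2 ^ k'}. {\<omega> \<in> space M. L (\<beta> k' j) \<omega> = L q \<omega>})
      \<inter> {\<omega> \<in> space M. L (\<beta> k i) \<omega> = L q \<omega>} \<in> sets ?Fq"
      using G_sets Leq [OF that] by (intro sets.Int)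
    moreover have "E k i = G \<inter> {\<omega> \<in> space M. X q \<omega> \<noteq> z} \<inter> (\<Union>k'. \<Union>j\<in>{..<2 ^ k'}. {\<omega> \<in> space M. L (\<beta> k' j) \<omega> = L q \<omega>})
      \<inter> {\<omega> \<in> space M. L (\<beta> k i) \<omega> = L q \<omega>}" by (auto simp: E_def G_def)
    ultimately show ?thesis by (simp only:)
  qed
  have E_D: "\<alpha> \<omega> < q \<and> \<alpha> \<omega> \<le> \<beta> k i \<and> (\<exists>\<epsilon>. eps (L q \<omega>) \<omega> = Some \<epsilon> \<and> \<epsilon> \<in> excursions z \<and>
      (\<forall>s. 0 \<le> s \<longrightarrow> s \<le> q - \<alpha> \<omega> \<longrightarrow> \<epsilon> s = X (\<alpha> \<omega> + s) \<omega>))" if "\<omega> \<in> E k i" "i \<le> 2 ^ k" for k i \<omega>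
  proof -
    have E': "\<omega> \<in> E k i" by fact
    then have "\<omega> \<in> G" by (simp add: E_def)
    interpret good_path X z L F \<omega> using \<open>\<omega> \<in> G\<close> by (simp add: G_def)
    obtain k' j where j: "j < 2 ^ k'" "L (\<beta> k' j) \<omega> = L q \<omega>" using E' by (auto simp: E_def)
    have "\<beta> k' j \<noteq> q" using j(1) q by (auto simp: \<beta>_def field_simps)
    moreover have "\<beta> k' j \<le> q" using j by (simp add: \<beta>q)
    moreover have "\<alpha> \<omega> \<le> \<beta> k' j" using good [OF \<open>\<omega> \<in> G\<close>] j(2) \<beta>0 calculation(2) by auto
    ultimately have lt: "\<alpha> \<omega> < q" by simp
    have Lq0: "0 \<le> L q \<omega>" using q by (intro L_nonneg) simp
    have "q \<le> inv_local_time L (L q \<omega>) \<omega>" using q Lq0 by (subst le_inv_local_time) auto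
    with lt have "eps (L q \<omega>) \<omega> \<noteq> None" using ex_NoneD [of "L q \<omega>"] by (auto simp: \<alpha>_def)
    then obtain \<epsilon> where e: "eps (L q \<omega>) \<omega> = Some \<epsilon>" by auto
    have "\<alpha> \<omega> \<le> \<beta> k i"
      using good [OF \<open>\<omega> \<in> G\<close>] \<beta>0 [of k i] \<beta>q [of k i] that by (auto simp: E_def)
    then show ?thesis
      using lt e ex_SomeD(1,3) [OF Lq0 e] \<open>q \<le> inv_local_time L (L q \<omega>) \<omega>\<close> by (auto simp: \<alpha>_def)
  qed
  define f where "f k i \<omega> = (if i \<le> 2 ^ k \<and> \<omega> \<in> E k i then F (the (eps (L q \<omega>) \<omega>)) (q - \<beta> k i) else 0)" for k i \<omega>
  have f_measurable: "f k i \<in> borel_measurable ?Fq" for k i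
  proof (cases "i \<le> 2 ^ k")
    case True
    define r where "r = q - \<beta> k i"
    have r: "0 \<le> r" using True \<beta>q by (simp add: r_def)
    show ?thesis
    proof (rule measurableI)
      fix A :: "real set" assume A: "A \<in> sets borel"
      \<comment> \<open>As \<open>\<beta> k i\<close> does not precede the start, the age
        \<open>r\<close> is at most the age at \<open>q\<close>. By \<open>F_nonanticipating\<close>
        the condition on \<open>F \<epsilon> r\<close> concerns only the path up to age
        \<open>r\<close>, where the excursion agrees with \<open>\<xi>\<close>.\<close>
      have "(\<lambda>\<epsilon>. F \<epsilon> r) -` A \<inter> excursions z \<in> sets (vimage_algebra (excursions z) (\<lambda>\<epsilon>. restrict \<epsilon> {0..r}) (PiM {0..r} (\<lambda>_. borel)))"
        using measurable_sets [OF F_nonanticipating [OF r] A] by simp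
      also have "\<dots> = {(\<lambda>\<epsilon>. restrict \<epsilon> {0..r}) -` B \<inter> excursions z | B. B \<in> sets (PiM {0..r} (\<lambda>_. borel))}"
        by (rule sets_vimage_algebra2) (auto simp: space_PiM)
      finally obtain B where B: "B \<in> sets (PiM {0..r} (\<lambda>_. borel :: 'e measure))"
        and AB: "(\<lambda>\<epsilon>. F \<epsilon> r) -` A \<inter> excursions z = (\<lambda>\<epsilon>. restrict \<epsilon> {0..r}) -` B \<inter> excursions z" by auto
      have "(\<lambda>\<omega>. \<lambda>s\<in>{0..r}. \<xi> s \<omega>) \<in> ?Fq \<rightarrow>\<^sub>M PiM {0..r} (\<lambda>_. borel)"
        by (rule measurable_restrict) (auto intro: \<xi>_measurable)
      from measurable_sets [OF this B]
      have \<xi>B: "(\<lambda>\<omega>. \<lambda>s\<in>{0..r}. \<xi> s \<omega>) -` B \<inter> space ?Fq \<in> sets ?Fq" .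
      have iff: "f k i \<omega> \<in> A \<longleftrightarrow> (\<lambda>s\<in>{0..r}. \<xi> s \<omega>) \<in> B" if "\<omega> \<in> E k i" for \<omega>
      proof -
        have E': "\<omega> \<in> E k i" by fact
        then have "\<omega> \<in> G" by (simp add: E_def)
        obtain \<epsilon> where e: "eps (L q \<omega>) \<omega> = Some \<epsilon>" "\<epsilon> \<in> excursions z"
            "\<And>s. 0 \<le> s \<Longrightarrow> s \<le> q - \<alpha> \<omega> \<Longrightarrow> \<epsilon> s = X (\<alpha> \<omega> + s) \<omega>" and le: "\<alpha> \<omega> \<le> \<beta> k i"
          using E_D [OF E' True] by blast
        have "restrict \<epsilon> {0..r} = (\<lambda>s\<in>{0..r}. \<xi> s \<omega>)"
        proof (rule restrict_ext)
          fix s assume s: "s \<in> {0..r}"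
          then have "s \<le> q - \<alpha> \<omega>" using le by (simp add: r_def)
          then show "\<epsilon> s = \<xi> s \<omega>" using s e(3) [of s] \<open>\<omega> \<in> G\<close> by (simp add: \<xi>_def min_def)
        qed
        moreover have "F \<epsilon> r \<in> A \<longleftrightarrow> restrict \<epsilon> {0..r} \<in> B"
          using AB e(2) by (auto simp: set_eq_iff)
        moreover have "f k i \<omega> = F \<epsilon> r" using True that e(1) by (simp add: f_def r_def)
        ultimately show ?thesis by simp
      qed
      have "f k i -` A \<inter> space ?Fq = (E k i \<inter> ((\<lambda>\<omega>. \<lambda>s\<in>{0..r}. \<xi> s \<omega>) -` B \<inter> space ?Fq)) \<union> (if 0 \<in> A then space ?Fq - E k i else {})"
      proof (intro equalityI subsetI)
        fix \<omega> assume *: "\<omega> \<in> f k i -` A \<inter> space ?Fq"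
        show "\<omega> \<in> (E k i \<inter> ((\<lambda>\<omega>. \<lambda>s\<in>{0..r}. \<xi> s \<omega>) -` B \<inter> space ?Fq)) \<union> (if 0 \<in> A then space ?Fq - E k i else {})"
        proof (cases "\<omega> \<in> E k i")
          case True then show ?thesis using * iff [OF True] by simp
        next
          case False then have "f k i \<omega> = 0" by (simp add: f_def)
          then show ?thesis using * False by auto
        qed
      next
        fix \<omega> assume *: "\<omega> \<in> (E k i \<inter> ((\<lambda>\<omega>. \<lambda>s\<in>{0..r}. \<xi> s \<omega>) -` B \<inter> space ?Fq)) \<union> (if 0 \<in> A then space ?Fq - E k i else {})"
        show "\<omega> \<in> f k i -` A \<inter> space ?Fq"
        proof (cases "\<omega> \<in> E k i")
          case True then show ?thesis using * iff [OF True] by (simp split: if_splits)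
        next
          case False then have "f k i \<omega> = 0" by (simp add: f_def)
          then show ?thesis using * False by (simp split: if_splits)
        qed
      qed
      also have "\<dots> \<in> sets ?Fq"
      proof -
        have "space ?Fq - E k i \<in> sets ?Fq" using E_sets [OF True] by (rule sets.compl_sets)
        then have "(if 0 \<in> A then space ?Fq - E k i else {}) \<in> sets ?Fq" by (simp only: sets.empty_sets split: if_split) blast
        then show ?thesis by (intro sets.Un sets.Int E_sets [OF True] \<xi>B)
      qed
      finally show "f k i -` A \<inter> space ?Fq \<in> sets ?Fq" .
    qed simp
  next
    case False
    then have "f k i = (\<lambda>_. 0)" by (simp add: f_def fun_eq_iff)
    then show ?thesis by simp
  qed
  define Z where "Z k \<omega> = f k (idx k \<omega>) \<omega>" for k \<omega>
  have Z_measurable: "Z k \<in> borel_measurable ?Fq" for k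
    unfolding Z_def by (rule measurable_compose_countable [OF f_measurable idx_measurable])
  have Z_lim: "(\<lambda>k. Z k \<omega>) \<longlonglongrightarrow> FX q \<omega>" if "\<omega> \<in> G" for \<omega>
  proof -
    interpret good_path X z L F \<omega> using that by (simp add: G_def)
    show ?thesis
    proof (cases "X q \<omega> \<noteq> z \<and> (\<exists>k'. \<exists>j<2 ^ k'. L (\<beta> k' j) \<omega> = L q \<omega>)")
      case True
      have E: "\<omega> \<in> E k (idx k \<omega>)" for k
        using True that a_good [OF that, of k] by (simp add: E_def a_def)
      then obtain \<epsilon> where e: "eps (L q \<omega>) \<omega> = Some \<epsilon>" "\<epsilon> \<in> excursions z"
        using E_D [OF E [of 0] idx_le] by blast
      have Lq0: "0 \<le> L q \<omega>" using q by (intro L_nonneg) simp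
      have lt: "\<alpha> \<omega> < q" using E_D [OF E [of 0] idx_le] by blast
      have "q \<le> inv_local_time L (L q \<omega>) \<omega>" using q Lq0 by (subst le_inv_local_time) auto
      then have "q < \<alpha> \<omega> + lifetime z \<epsilon>"
        using X_zero_iff [OF Lq0 e(1), of q] lt True by (auto simp: \<alpha>_def not_le)
      then have Yq: "FX q \<omega> = F \<epsilon> (q - \<alpha> \<omega>)"
        using Y_excursion(2) [OF Lq0 e(1), of q] lt by (simp add: \<alpha>_def)
      have Zk: "Z k \<omega> = F \<epsilon> (q - a k \<omega>)" for k
        using E [of k] idx_le [of k \<omega>] e by (simp add: Z_def f_def a_def)
      have "(\<lambda>k. F \<epsilon> (q - a k \<omega>)) \<longlonglongrightarrow> F \<epsilon> (q - \<alpha> \<omega>)"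
      proof (rule continuous_on_tendsto_compose [OF F_cont [OF e(2)]])
        show "(\<lambda>k. q - a k \<omega>) \<longlonglongrightarrow> q - \<alpha> \<omega>" by (intro tendsto_diff tendsto_const a_lim [OF that])
      qed (use lt a_good [OF that] in auto)
      then show ?thesis by (simp add: Zk Yq)
    next
      case False
      then have "Z k \<omega> = 0" for k by (auto simp: Z_def f_def E_def)
      moreover have "FX q \<omega> = 0"
      proof (rule ccontr)
        assume "FX q \<omega> \<noteq> 0"
        then have "\<alpha> \<omega> < q" "X q \<omega> \<noteq> z" using Y_cases [of q] q by (auto simp: \<alpha>_def)
        \<comment> \<open>A start strictly before \<open>q\<close> is eventually detected by a
          dyadic point before \<open>q\<close>, contrary to the case assumption.\<close>
        moreover have "\<forall>\<^sub>F k in sequentially. a k \<omega> < q" by (rule order_tendstoD(2) [OF a_lim [OF that] \<open>\<alpha> \<omega> < q\<close>])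
        then obtain k where "a k \<omega> < q" by (auto dest: eventually_happens)
        moreover from this have "idx k \<omega> \<noteq> 2 ^ k" by (auto simp: a_def \<beta>_def)
        then have "idx k \<omega> < 2 ^ k" using idx_le [of k \<omega>] by simp
        ultimately show False using False a_good [OF that, of k] unfolding a_def by blast
      qed
      ultimately show ?thesis by simp
    qed
  qed
  have "(\<lambda>\<omega>. if \<omega> \<in> G then FX q \<omega> else 0) \<in> borel_measurable ?Fq"
  proof (rule borel_measurable_LIMSEQ_real)
    show "(\<lambda>\<omega>. if \<omega> \<in> G then Z k \<omega> else 0) \<in> borel_measurable ?Fq" for k
      using Z_measurable G_Int by (intro measurable_If_set) auto
    show "(\<lambda>k. if \<omega> \<in> G then Z k \<omega> else 0) \<longlonglongrightarrow> (if \<omega> \<in> G then FX q \<omega> else 0)" for \<omega>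
      using Z_lim [of \<omega>] by simp
  qed
  then show ?thesis
    by (rule filt_AE_measurable) (use G_AE in \<open>auto\<close>)
qed

text \<open>The condition persists to the right of any time where it holds, so up to a null set
  \<open>{T < r}\<close> is a countable union over rational times below \<open>r\<close>.
  Right-continuity of the filtration then gives the events with a weak inequality.\<close>

lemma stopping_time_level:
  assumes path: "AE \<omega> in M. stopped_path X z L F \<omega> v" and v [measurable]: "v \<in> borel_measurable borel"
  shows "stopping_time \<F> (\<lambda>\<omega>. Inf {ennreal t | t. 0 < t \<and> ennreal (L t \<omega>) \<le> v (FX t \<omega>)})"
    (is "stopping_time _ ?T")
proof -
  define C where "C t = {\<omega> \<in> space M. ennreal (L t \<omega>) \<le> v (FX t \<omega>)}" for t
  have C: "C t \<in> sets (\<F> (ennreal t))" if "0 < t" for t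
  proof -
    have "(\<lambda>\<omega>. v (FX t \<omega>)) \<in> borel_measurable (\<F> (ennreal t))"
      using measurable_compose [OF process_adapted [OF that] v] .
    moreover have "(\<lambda>\<omega>. ennreal (L t \<omega>)) \<in> borel_measurable (\<F> (ennreal t))"
      using that by (intro measurable_compose [OF L_measurable measurable_ennreal]) auto
    ultimately show ?thesis using borel_measurable_le [of _ "\<F> (ennreal t)"] by (simp add: C_def)
  qed
  have less: "{\<omega> \<in> space M. ?T \<omega> < ennreal r} \<in> sets (\<F> (ennreal r))" for r
  proof -
    have "(\<Union>q\<in>{q\<in>\<rat>. 0 < q \<and> q < r}. C q) \<in> sets (\<F> (ennreal r))"
    proof (rule sets.countable_UN'')
      show "countable {q\<in>\<rat>. 0 < q \<and> q < r}" by (rule countable_subset [OF _ countable_rat]) auto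
      fix q assume "q \<in> {q\<in>\<rat>. 0 < q \<and> q < r}"
      then show "C q \<in> sets (\<F> (ennreal r))"
        using C [of q] filt_mono [of "ennreal q" "ennreal r"] by (auto simp: ennreal_leI)
    qed
    then show ?thesis
    proof (rule filt_AE)
      show "AE \<omega> in M. \<omega> \<in> (\<Union>q\<in>{q\<in>\<rat>. 0 < q \<and> q < r}. C q) \<longleftrightarrow> \<omega> \<in> {\<omega> \<in> space M. ?T \<omega> < ennreal r}"
        using path AE_space
      proof eventually_elim
        case (elim \<omega>)
        interpret stopped_path X z L F \<omega> v by fact
        show ?case
        proof
          assume "\<omega> \<in> (\<Union>q\<in>{q\<in>\<rat>. 0 < q \<and> q < r}. C q)"
          then obtain q where q: "0 < q" "q < r" "ennreal (L q \<omega>) \<le> v (FX q \<omega>)" by (auto simp: C_def)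
          then have "?T \<omega> \<le> ennreal q" by (intro Inf_lower) auto
          also have "ennreal q < ennreal r" using q by (simp add: ennreal_lessI)
          finally show "\<omega> \<in> {\<omega> \<in> space M. ?T \<omega> < ennreal r}" using elim(2) by simp
        next
          assume "\<omega> \<in> {\<omega> \<in> space M. ?T \<omega> < ennreal r}"
          then obtain t where t: "0 < t" "ennreal (L t \<omega>) \<le> v (FX t \<omega>)" "ennreal t < ennreal r"
            by (auto simp: Inf_less_iff)
          then have "t < r" by (simp add: ennreal_less_iff)
          obtain u where u: "t < u" "\<forall>s\<in>{t..<u}. ennreal (L s \<omega>) \<le> v (FX s \<omega>)"
            using stop_in_excursion(2) [OF t(1,2)] by blast
          obtain q where q: "q \<in> \<rat>" "t < q" "q < min u r"
            using Rats_dense_in_real [of t "min u r"] u(1) \<open>t < r\<close> by auto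
          then have "\<omega> \<in> C q" using u(2) elim(2) by (simp add: C_def)
          then show "\<omega> \<in> (\<Union>q\<in>{q\<in>\<rat>. 0 < q \<and> q < r}. C q)" using q t(1) by auto
        qed
      qed
    qed auto
  qed
  show ?thesis
  proof (rule stopping_timeI)
    fix t
    have "{\<omega> \<in> space M. ?T \<omega> \<le> t} \<in> sets (\<F> t)"
    proof (cases t rule: ennreal_cases)
      case (real r)
      have "{\<omega> \<in> space M. ?T \<omega> \<le> t} \<in> sigma_sets (space M) (history_sets M X u \<union> null_sets M)" if u: "t < u \<or> u = \<infinity>" for u
      proof -
        have "\<exists>r'>r. ennreal r' < u \<or> u = \<infinity>"
        proof (cases "u = \<infinity>")
          case False
          then have "t < u" using u by simp
          then obtain c where c: "t < c" "c < u" using dense by blast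
          then obtain r' where "c = ennreal r'" "0 \<le> r'" using False by (cases c rule: ennreal_cases) auto
          then show ?thesis using c real by (intro exI [of _ r']) (simp add: ennreal_less_iff)
        next
          case True
          then show ?thesis by (intro exI [of _ "r + 1"]) simp
        qed
        then obtain r' where r': "r < r'" "ennreal r' < u \<or> u = \<infinity>" by blast
        \<comment> \<open>These points decrease to \<open>r\<close> without leaving
          \<open>(r, r']\<close>, so all events below are known at \<open>r'\<close>.\<close>
        define x where "x k = r + (r' - r) / real (Suc k)" for k
        have x: "r < x k" "x k \<le> r'" for k
          using r' mult_left_mono [of r r' "real k"] by (simp_all add: x_def field_simps)
        have "{\<omega> \<in> space M. ?T \<omega> < ennreal (x k)} \<in> sets (\<F> (ennreal r'))" for k
          using less filt_mono [OF ennreal_leI [OF x(2)]] by blast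
        then have "(\<Inter>k. {\<omega> \<in> space M. ?T \<omega> < ennreal (x k)}) \<in> sets (\<F> (ennreal r'))"
          by (intro sets.countable_INT) auto
        also have "(\<Inter>k. {\<omega> \<in> space M. ?T \<omega> < ennreal (x k)}) = {\<omega> \<in> space M. ?T \<omega> \<le> t}"
        proof (intro equalityI subsetI)
          fix \<omega> assume \<omega>: "\<omega> \<in> (\<Inter>k. {\<omega> \<in> space M. ?T \<omega> < ennreal (x k)})"
          have "(\<lambda>k. r + (r' - r) * (1 / real (Suc k))) \<longlonglongrightarrow> r + (r' - r) * 0"
            by (intro tendsto_intros LIMSEQ_Suc [OF lim_1_over_n])
          then have "x \<longlonglongrightarrow> r" by (simp add: x_def [abs_def])
          then have "(\<lambda>k. ennreal (x k)) \<longlonglongrightarrow> t" unfolding real(2) by (rule tendsto_ennrealI)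
          then have "?T \<omega> \<le> t"
            by (rule LIMSEQ_le_const) (use \<omega> in \<open>auto intro: less_imp_le\<close>)
          then show "\<omega> \<in> {\<omega> \<in> space M. ?T \<omega> \<le> t}" using \<omega> by auto
        next
          fix \<omega> assume \<omega>: "\<omega> \<in> {\<omega> \<in> space M. ?T \<omega> \<le> t}"
          have "t < ennreal (x k)" for k using x(1) [of k] real by (simp add: ennreal_lessI)
          then show "\<omega> \<in> (\<Inter>k. {\<omega> \<in> space M. ?T \<omega> < ennreal (x k)})"
            using \<omega> le_less_trans by blast
        qed
        finally show ?thesis
          using r'(2) unfolding sets_usual_filtration by blast
      qed
      then show ?thesis unfolding sets_usual_filtration by blast
    next
      case top
      then show ?thesis using sets.top [of "\<F> t"] by simp
    qed
    then show "Measurable.pred (\<F> t) (\<lambda>\<omega>. ?T \<omega> \<le> t)" by (simp add: pred_def)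
  qed
qed

end

context target
begin

lemma psi'_continuous: "continuous_on A \<psi>'"
proof -
  interpret m: target "mirror \<mu>" "mirror \<nu>" by (rule target_mirror)
  show ?thesis by (rule m.psi.K_continuous)
qed

lemma w_0: "w 0 = 0"
  by (simp add: w_nonneg psi.K_nonpos)

lemma w_continuous: "continuous_on UNIV w"
proof -
  have "continuous_on UNIV (\<lambda>x. \<psi>' (- x))"
    by (rule continuous_on_compose2 [OF psi'_continuous [of UNIV]]) (auto intro: continuous_intros)
  then have "continuous_on UNIV (\<lambda>x. \<psi> x + \<psi>' (- x))"
    by (intro continuous_on_add_ennreal psi.K_continuous)
  then show ?thesis by (simp add: w_def [abs_def] psi_minus_mirror)
qed

lemma w_mono_pos: "0 \<le> x \<Longrightarrow> x \<le> y \<Longrightarrow> w x \<le> w y"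
  by (simp add: w_nonneg psi.K_mono)

lemma w_mono_neg: "x \<le> 0 \<Longrightarrow> y \<le> x \<Longrightarrow> w x \<le> w y"
proof -
  interpret m: target "mirror \<mu>" "mirror \<nu>" by (rule target_mirror)
  show "x \<le> 0 \<Longrightarrow> y \<le> x \<Longrightarrow> w x \<le> w y" by (simp add: w_nonpos m.psi.K_mono)
qed

lemma le_w_iff: "0 < l \<Longrightarrow> ennreal l \<le> w y \<longleftrightarrow> ennreal l \<le> \<psi> y \<or> ennreal l \<le> \<psi>' (- y)"
  by (cases "0 \<le> y") (simp_all add: w_nonneg w_nonpos psi'_nonpos psi.K_nonpos)

lemma le_psi_pos: "0 < l \<Longrightarrow> ennreal l \<le> \<psi> y \<Longrightarrow> 0 < y"
  using psi.K_nonpos [of y] by (cases "0 < y") auto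

lemma le_psi'_neg: "0 < l \<Longrightarrow> ennreal l \<le> \<psi>' (- y) \<Longrightarrow> y < 0"
  using psi'_nonpos [of "- y"] by (cases "y < 0") auto

lemma Sr_step:
  assumes "0 \<le> l" "l \<le> m" "0 < Sr m"
  shows "Sr m = Sr l * exp (- enn2real (Lam l m)) * exp (- enn2real (Lam' l m))"
proof -
  interpret m: target "mirror \<mu>" "mirror \<nu>" by (rule target_mirror)
  have l: "0 < Sr l" using Sr_antimono [OF assms(2)] assms(3) by simp
  have "enn2real (Lam 0 m) = enn2real (Lam 0 l) + enn2real (Lam l m)"
    using Lam_real(1) [of 0 l] Lam_real(1) [of l m] assms l
    by (subst Lam_add [of 0 l m]) (auto simp: enn2real_plus)
  moreover have "enn2real (Lam' 0 m) = enn2real (Lam' 0 l) + enn2real (Lam' l m)"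
    using m.Lam_real(1) [of 0 l] m.Lam_real(1) [of l m] assms l
    by (subst m.Lam_add [of 0 l m]) (auto simp: enn2real_plus Sr_mirror)
  moreover have "Sr m = exp (- (enn2real (Lam 0 m) + enn2real (Lam' 0 m)))"
    using assms by (intro Sr_exp) auto
  moreover have "Sr l = exp (- (enn2real (Lam 0 l) + enn2real (Lam' 0 l)))"
    using assms l by (intro Sr_exp) auto
  ultimately show ?thesis by (simp add: exp_add [symmetric])
qed

lemma Lam'_finite: "0 \<le> l \<Longrightarrow> l \<le> m \<Longrightarrow> 0 < Sr m \<Longrightarrow> Lam' l m < \<infinity>"
proof -
  interpret m: target "mirror \<mu>" "mirror \<nu>" by (rule target_mirror)
  show "0 \<le> l \<Longrightarrow> l \<le> m \<Longrightarrow> 0 < Sr m \<Longrightarrow> Lam' l m < \<infinity>"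
    by (rule m.Lam_real(1)) (simp_all add: Sr_mirror)
qed

lemma mass_le: "0 \<le> l \<Longrightarrow> l \<le> m \<Longrightarrow> mass l m \<le> Sr l - Sr m"
proof -
  interpret m: target "mirror \<mu>" "mirror \<nu>" by (rule target_mirror)
  have "0 \<le> m.mass l m" by (simp add: m.mass_def)
  then show "0 \<le> l \<Longrightarrow> l \<le> m \<Longrightarrow> mass l m \<le> Sr l - Sr m" using mass_sum [of l m] by simp
qed

lemma tail_pos_mono: "x \<le> y \<Longrightarrow> 0 < emeasure \<mu> {y<..} \<Longrightarrow> 0 < emeasure \<mu> {x<..}"
  by (erule order.strict_trans2) (intro emeasure_mono; auto)

text \<open>By monotonicity of \<open>w\<close> the two sets can differ only on the levels
  \<open>w c\<close> and \<open>w e\<close>, which are null.\<close>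

lemma mass_interval:
  assumes "0 \<le> c" "c \<le> e" "0 < emeasure \<mu> {e<..}"
  shows "measure \<mu> {c<..e} = mass (enn2real (w c)) (enn2real (w e))"
  unfolding mass_def
proof (rule measure_eq_AE)
  have fin: "w c < \<infinity>" "w e < \<infinity>"
    using Sr_pos(1) assms tail_pos_mono [OF assms(2,3)] by auto
  have eq: "ennreal (enn2real (w c)) = w c" "ennreal (enn2real (w e)) = w e" using fin by auto
  have "AE x in \<mu>. x \<notin> {x. w x = ennreal (enn2real (w c))}" "AE x in \<mu>. x \<notin> {x. w x = ennreal (enn2real (w e))}"
    by (intro AE_not_in null_setsI w_level_null; simp)+
  then show "AE x in \<mu>. x \<in> {c<..e} \<longleftrightarrow>
      x \<in> {x. 0 < x \<and> ennreal (enn2real (w c)) < w x \<and> w x \<le> ennreal (enn2real (w e))}"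
  proof eventually_elim
    case (elim x)
    then have ne: "w x \<noteq> w c" "w x \<noteq> w e" unfolding eq by auto
    show ?case
    proof
      assume x: "x \<in> {c<..e}"
      then have "w c \<le> w x" "w x \<le> w e" using assms by (auto intro: w_mono_pos)
      then show "x \<in> {x. 0 < x \<and> ennreal (enn2real (w c)) < w x \<and> w x \<le> ennreal (enn2real (w e))}"
        using ne x assms(1) unfolding eq by simp
    next
      assume x: "x \<in> {x. 0 < x \<and> ennreal (enn2real (w c)) < w x \<and> w x \<le> ennreal (enn2real (w e))}"
      then have *: "0 < x" "w c < w x" "w x < w e" using ne unfolding eq by auto
      then have "\<not> x \<le> c" "\<not> e \<le> x" using w_mono_pos [of x c] w_mono_pos [of e x] assms by auto
      then show "x \<in> {c<..e}" by simp
    qed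
  qed
qed auto

lemma Sr_w_continuous:
  assumes "0 < emeasure \<mu> {b<..}" shows "continuous_on {0..b} (\<lambda>y. Sr (enn2real (w y)))"
proof (rule continuous_on_compose2 [OF Sr_continuous])
  show "continuous_on {0..b} (\<lambda>y. enn2real (w y))"
    unfolding continuous_on_def
  proof
    fix y assume y: "y \<in> {0..b}"
    then have "w y < \<infinity>" using Sr_pos(1) [of y] tail_pos_mono [of y b] assms by auto
    then have "w y = ennreal (enn2real (w y))" by simp
    moreover have "(w \<longlongrightarrow> w y) (at y within {0..b})"
      using continuous_on_subset [OF w_continuous, of "{0..b}"] y by (auto simp: continuous_on_def)
    ultimately have "(w \<longlongrightarrow> ennreal (enn2real (w y))) (at y within {0..b})" by simp
    then show "((\<lambda>y. enn2real (w y)) \<longlongrightarrow> enn2real (w y)) (at y within {0..b})"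
      by (rule tendsto_enn2real) simp
  qed
qed auto

end

section \<open>The stopping point\<close>

locale embedding = excursion_functional M X z PX L n F + tg: target \<mu> "functional_measure z n F"
  for M :: "'a measure" and X :: "real \<Rightarrow> 'a \<Rightarrow> 'e::polish_space" and z :: 'e
    and PX :: "'e \<Rightarrow> (real \<Rightarrow> 'e) measure" and L :: "real \<Rightarrow> 'a \<Rightarrow> real"
    and n :: "(real \<Rightarrow> 'e) measure" and F :: "(real \<Rightarrow> 'e) \<Rightarrow> real \<Rightarrow> real" and \<mu> :: "real measure"
begin

abbreviation "\<psi> \<equiv> psi_plus \<mu> \<nu>"
abbreviation "\<psi>' \<equiv> psi_plus (mirror \<mu>) (mirror \<nu>)"
abbreviation "w \<equiv> tg.w"

lemma psi_measurable [measurable]: "\<psi> \<in> borel_measurable borel" by (rule tg.psi.K_measurable)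
lemma psi'_measurable [measurable]: "\<psi>' \<in> borel_measurable borel" by (rule tg.psi'_measurable)
lemma w_measurable [measurable]: "w \<in> borel_measurable borel" by (rule tg.w_measurable)

lemma fst_J: "fst \<in> borel_measurable J"
  by (rule measurable_compose [OF measurable_fst]) (rule measurable_restrict_space1, simp)

lemma FV_J: "(\<lambda>p. FV (snd p)) \<in> borel_measurable J"
  by (rule measurable_compose [OF measurable_snd FV_measurable])

text \<open>A point \<open>(u,\<epsilon>)\<close> of the excursion process stops \<open>FX\<close> iff \<open>u \<le> w (FV \<epsilon>)\<close>, i.e. iff it lies in the
  positive or the negative slab.\<close>

definition slab :: "(real \<Rightarrow> ennreal) \<Rightarrow> real \<Rightarrow> real \<Rightarrow> (real \<times> (real \<Rightarrow> 'e)) set" where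
  "slab h l m = {p \<in> space J. l < fst p \<and> fst p \<le> m \<and> ennreal (fst p) \<le> h (FV (snd p))}"

lemma slab_sets: "h \<in> borel_measurable borel \<Longrightarrow> slab h l m \<in> sets J"
  unfolding slab_def
  by (intro sets.sets_Collect_conj borel_measurable_less borel_measurable_le borel_measurable_const
      fst_J measurable_compose [OF FV_J] measurable_compose [OF fst_J measurable_ennreal])

lemma slab_emeasure:
  assumes "h \<in> borel_measurable borel" "0 \<le> l"
  shows "emeasure J (slab h l m) = (\<integral>\<^sup>+y. emeasure lborel {u. l < u \<and> u \<le> m \<and> ennreal u \<le> h y} \<partial>\<nu>)"
proof -
  interpret pair_sigma_finite "restrict_space (lborel :: real measure) {0..}" n by (rule lborel_pair_sigma_finite)
  note assms(1) [measurable]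
  have "emeasure J (slab h l m) = (\<integral>\<^sup>+\<epsilon>. emeasure (restrict_space lborel {0..}) ((\<lambda>u. (u, \<epsilon>)) -` slab h l m) \<partial>n)"
    by (rule emeasure_pair_measure_alt2) (rule slab_sets [OF assms(1)])
  also have "\<dots> = (\<integral>\<^sup>+\<epsilon>. emeasure lborel {u. l < u \<and> u \<le> m \<and> ennreal u \<le> h (FV \<epsilon>)} \<partial>n)"
  proof (rule nn_integral_cong)
    fix \<epsilon> assume e: "\<epsilon> \<in> space n"
    have "(\<lambda>u. (u, \<epsilon>)) -` slab h l m = {u. l < u \<and> u \<le> m \<and> ennreal u \<le> h (FV \<epsilon>)}"
      using e assms(2) by (auto simp: slab_def space_pair_measure space_restrict_space)
    moreover have "{u. l < u \<and> u \<le> m \<and> ennreal u \<le> h (FV \<epsilon>)} \<subseteq> {0..}" using assms(2) by auto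
    ultimately show "emeasure (restrict_space lborel {0..}) ((\<lambda>u. (u, \<epsilon>)) -` slab h l m) = emeasure lborel {u. l < u \<and> u \<le> m \<and> ennreal u \<le> h (FV \<epsilon>)}"
      by (simp add: emeasure_restrict_space)
  qed
  also have "\<dots> = (\<integral>\<^sup>+y. emeasure lborel {u. l < u \<and> u \<le> m \<and> ennreal u \<le> h y} \<partial>\<nu>)"
  proof (rule nn_integral_nu [symmetric])
    have "{p \<in> space (borel \<Otimes>\<^sub>M lborel). l < snd p \<and> snd p \<le> m \<and> ennreal (snd p) \<le> h (fst p)} \<in> sets (borel \<Otimes>\<^sub>M lborel)"
      by measurable
    from lborel.measurable_emeasure_Pair [OF this]
    show "(\<lambda>y. emeasure lborel {u. l < u \<and> u \<le> m \<and> ennreal u \<le> h y}) \<in> borel_measurable borel"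
      by (simp add: vimage_def space_pair_measure)
  qed
  finally show ?thesis .
qed

abbreviation "pos_slab \<equiv> slab \<psi>"
abbreviation "neg_slab \<equiv> slab (\<lambda>y. \<psi>' (- y))"

lemma pos_slab_emeasure: "0 \<le> l \<Longrightarrow> emeasure J (pos_slab l m) = tg.Lam l m"
  by (simp add: slab_emeasure tg.Lam_def)

lemma neg_slab_emeasure: assumes "0 \<le> l" shows "emeasure J (neg_slab l m) = tg.Lam' l m"
proof -
  interpret m: target "mirror \<mu>" "mirror \<nu>" by (rule tg.target_mirror)
  have "{p \<in> space (borel \<Otimes>\<^sub>M lborel). l < snd p \<and> snd p \<le> m \<and> ennreal (snd p) \<le> \<psi>' (fst p)} \<in> sets (borel \<Otimes>\<^sub>M lborel)"
    by measurable
  from lborel.measurable_emeasure_Pair [OF this]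
  have "(\<lambda>y. emeasure lborel {u. l < u \<and> u \<le> m \<and> ennreal u \<le> \<psi>' y}) \<in> borel_measurable borel"
    by (simp add: vimage_def space_pair_measure)
  then have "tg.Lam' l m = (\<integral>\<^sup>+y. emeasure lborel {u. l < u \<and> u \<le> m \<and> ennreal u \<le> \<psi>' (- y)} \<partial>\<nu>)"
    unfolding m.Lam_def by (intro nn_integral_mirror) auto
  then show ?thesis using assms by (simp add: slab_emeasure)
qed

text \<open>For a given excursion at most one local time equals the level of its terminal value, so
  by Fubini the boundary set has intensity 0.\<close>

lemma AE_no_boundary: "AE \<omega> in M. \<forall>l \<epsilon>. 0 < l \<longrightarrow> eps l \<omega> = Some \<epsilon> \<longrightarrow> w (FV \<epsilon>) \<noteq> ennreal l"
proof -
  interpret pair_sigma_finite "restrict_space (lborel :: real measure) {0..}" n by (rule lborel_pair_sigma_finite)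
  define B where "B = {p \<in> space J. 0 < fst p \<and> w (FV (snd p)) = ennreal (fst p)}"
  have B: "B \<in> sets J" unfolding B_def
    by (intro sets.sets_Collect_conj borel_measurable_less borel_measurable_eq borel_measurable_const
        fst_J measurable_compose [OF FV_J w_measurable] measurable_compose [OF fst_J measurable_ennreal])
  have "emeasure J B = (\<integral>\<^sup>+\<epsilon>. emeasure (restrict_space lborel {0..}) ((\<lambda>u. (u, \<epsilon>)) -` B) \<partial>n)"
    using B by (rule emeasure_pair_measure_alt2)
  also have "\<dots> = (\<integral>\<^sup>+\<epsilon>. 0 \<partial>n)"
  proof (rule nn_integral_cong)
    fix \<epsilon>
    have "(\<lambda>u. (u, \<epsilon>)) -` B \<subseteq> {enn2real (w (FV \<epsilon>))}"
      by (auto simp: B_def)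
    then have *: "(\<lambda>u. (u, \<epsilon>)) -` B = {} \<or> (\<lambda>u. (u, \<epsilon>)) -` B = {enn2real (w (FV \<epsilon>))}" by auto
    have "emeasure (restrict_space lborel {0..}) {enn2real (w (FV \<epsilon>))} = 0"
      by (subst emeasure_restrict_space) auto
    with * show "emeasure (restrict_space lborel {0..}) ((\<lambda>u. (u, \<epsilon>)) -` B) = 0" by auto
  qed
  also have "\<dots> = 0" by simp
  finally have "AE \<omega> in M. void B \<omega>" using B by (intro void_null)
  with AE_ex show ?thesis
  proof eventually_elim
    case (elim \<omega>)
    show ?case
    proof (intro allI impI)
      fix l \<epsilon> assume l: "0 < l" "eps l \<omega> = Some \<epsilon>"
      then have "\<epsilon> \<in> space n" using elim(1) [rule_format, of l] by auto
      then have "(l, \<epsilon>) \<in> space J" using l by (simp add: space_pair_measure space_restrict_space)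
      moreover have "(l, \<epsilon>) \<notin> B" using elim(2) l by (auto simp: void_def)
      ultimately show "w (FV \<epsilon>) \<noteq> ennreal l" using l by (auto simp: B_def)
    qed
  qed
qed

lemma AE_stopped_path: "AE \<omega> in M. stopped_path X z L F \<omega> w"
  using AE_good_path AE_no_boundary
proof eventually_elim
  case (elim \<omega>)
  interpret good_path X z L F \<omega> by fact
  show ?case
    by unfold_locales (use elim tg.w_continuous tg.w_mono_pos tg.w_mono_neg tg.w_0 in auto)
qed

lemma void_slab:
  assumes "good_path X z L F \<omega>" "0 \<le> l"
  shows "void (slab h l m) \<omega> \<longleftrightarrow> (\<forall>u \<epsilon>. l < u \<longrightarrow> u \<le> m \<longrightarrow> eps u \<omega> = Some \<epsilon> \<longrightarrow> \<not> ennreal u \<le> h (FV \<epsilon>))"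
proof -
  interpret good_path X z L F \<omega> by fact
  have "(u, \<epsilon>) \<in> space J" if "l < u" "eps u \<omega> = Some \<epsilon>" for u \<epsilon>
    using ex_SomeD(1) [of u \<epsilon>] that assms(2) by (simp add: space_pair_measure space_restrict_space space_n)
  then show ?thesis by (auto simp: void_def slab_def)
qed

definition early :: "real \<Rightarrow> (real \<times> (real \<Rightarrow> 'e)) set" where
  "early l = pos_slab 0 l \<union> neg_slab 0 l"

lemma early_sets: "early l \<in> sets J"
  unfolding early_def by (intro sets.Un slab_sets) auto

lemma slab_disjoint: "0 \<le> l \<Longrightarrow> 0 \<le> l' \<Longrightarrow> pos_slab l m \<inter> neg_slab l' m' = {}"
proof (rule equals0I)
  fix p assume l: "0 \<le> l" "0 \<le> l'" and "p \<in> pos_slab l m \<inter> neg_slab l' m'"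
  then have "0 < fst p" "ennreal (fst p) \<le> \<psi> (FV (snd p))" "ennreal (fst p) \<le> \<psi>' (- FV (snd p))"
    by (auto simp: slab_def)
  then show False using tg.le_psi_pos [of "fst p"] tg.le_psi'_neg [of "fst p"] by (metis order.asym)
qed

text \<open>A terminal value cannot stop on both sides, so the two intensities add, and
  \<open>Sr_exp\<close> evaluates the exponential.\<close>

lemma early_measure:
  assumes "0 \<le> l" "0 < tg.Sr l"
  shows "emeasure J (early l) < \<infinity>" "exp (- measure J (early l)) = tg.Sr l"
proof -
  have fin: "tg.Lam 0 l < \<infinity>" "tg.Lam' 0 l < \<infinity>"
    using tg.Lam_real(1) [of 0 l] tg.Lam'_finite [of 0 l] assms by auto
  have eq: "emeasure J (early l) = tg.Lam 0 l + tg.Lam' 0 l"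
    unfolding early_def using slab_disjoint [of 0 0 l l]
    by (subst plus_emeasure [symmetric]) (auto simp: pos_slab_emeasure neg_slab_emeasure intro!: slab_sets)
  then show "emeasure J (early l) < \<infinity>" using fin by simp
  have "measure J (early l) = enn2real (tg.Lam 0 l) + enn2real (tg.Lam' 0 l)"
    unfolding measure_def eq using fin by (simp add: enn2real_plus)
  then show "exp (- measure J (early l)) = tg.Sr l" using tg.Sr_exp(1) [OF assms] by simp
qed

lemma void_early:
  assumes "good_path X z L F \<omega>"
  shows "void (early l) \<omega> \<longleftrightarrow> (\<forall>u \<epsilon>. 0 < u \<longrightarrow> u \<le> l \<longrightarrow> eps u \<omega> = Some \<epsilon> \<longrightarrow> \<not> ennreal u \<le> w (FV \<epsilon>))"
proof -
  have "void (early l) \<omega> \<longleftrightarrow> void (pos_slab 0 l) \<omega> \<and> void (neg_slab 0 l) \<omega>"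
    by (auto simp: void_def early_def)
  then show ?thesis
    by (simp add: void_slab [OF assms order_refl] tg.le_w_iff) blast
qed

section \<open>Existence of a first stopping excursion\<close>

lemma void_early_prob:
  assumes "0 \<le> l" "0 < tg.Sr l"
  shows "measure M {\<omega> \<in> space M. void (early l) \<omega>} = tg.Sr l"
  using void_prob [OF early_sets early_measure(1) [OF assms]] early_measure(2) [OF assms] by simp

text \<open>Stopping levels stay away from 0, because \<open>Sr (1 / real (Suc k))\<close> tends to
  \<open>Sr 0 = 1\<close>.\<close>

lemma AE_early_void: "AE \<omega> in M. \<exists>k. void (early (1 / real (Suc k))) \<omega>"
proof -
  let ?N = "{\<omega> \<in> space M. \<forall>k. \<not> void (early (1 / real (Suc k))) \<omega>}"
  have sets: "{\<omega> \<in> space M. void (early l) \<omega>} \<in> sets M" for l by (intro void_measurable early_sets)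
  have "?N = space M - (\<Union>k. {\<omega> \<in> space M. void (early (1 / real (Suc k))) \<omega>})" by auto
  also have "\<dots> \<in> sets M" using sets by (intro sets.Diff sets.top sets.countable_UN) auto
  finally have N: "?N \<in> sets M" .
  have le: "measure M ?N \<le> 1 - tg.Sr (1 / real (Suc k))" if "0 < tg.Sr (1 / real (Suc k))" for k
  proof -
    have "measure M ?N \<le> measure M (space M - {\<omega> \<in> space M. void (early (1 / real (Suc k))) \<omega>})"
      using sets by (intro finite_measure_mono) auto
    also have "\<dots> = 1 - tg.Sr (1 / real (Suc k))"
      using that sets by (subst prob_compl) (auto simp: void_early_prob)
    finally show ?thesis .
  qed
  have "(\<lambda>k. 1 / real (Suc k)) \<longlonglongrightarrow> 0" by (rule LIMSEQ_Suc [OF lim_1_over_n])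
  then have lim: "(\<lambda>k. tg.Sr (1 / real (Suc k))) \<longlonglongrightarrow> tg.Sr 0"
    by (rule continuous_on_tendsto_compose [OF tg.Sr_continuous]) auto
  then have "\<forall>\<^sub>F k in sequentially. 0 < tg.Sr (1 / real (Suc k))"
    by (rule order_tendstoD) (simp add: tg.Sr_0)
  then have ev: "\<forall>\<^sub>F k in sequentially. measure M ?N \<le> 1 - tg.Sr (1 / real (Suc k))"
    by eventually_elim (rule le)
  have "(\<lambda>k. 1 - tg.Sr (1 / real (Suc k))) \<longlonglongrightarrow> 1 - tg.Sr 0" by (intro tendsto_diff tendsto_const lim)
  from tendsto_lowerbound [OF this ev] have "measure M ?N \<le> 0" by (simp add: tg.Sr_0)
  then have "measure M ?N = 0" by (intro antisym measure_nonneg)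
  then have "?N \<in> null_sets M" using N by (simp add: null_sets_def emeasure_eq_measure)
  then show ?thesis by (rule AE_I') auto
qed

text \<open>Some excursion stops, because by \<open>Sr_small\<close> the probability of none up to
  \<open>l\<close> can be made arbitrarily small.\<close>

lemma AE_early_nonvoid: "AE \<omega> in M. \<exists>k. \<not> void (early (real k)) \<omega>"
proof -
  let ?N = "{\<omega> \<in> space M. \<forall>k. void (early (real k)) \<omega>}"
  have sets: "{\<omega> \<in> space M. void (early l) \<omega>} \<in> sets M" for l by (intro void_measurable early_sets)
  have "?N = (\<Inter>k. {\<omega> \<in> space M. void (early (real k)) \<omega>})" by auto
  also have "\<dots> \<in> sets M" using sets by (intro sets.countable_INT) auto
  finally have N: "?N \<in> sets M" .
  have "measure M ?N \<le> 0 + e" if "0 < e" for e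
  proof -
    obtain l where l: "0 \<le> l" "0 < tg.Sr l" "tg.Sr l < e" using \<open>0 < e\<close> by (rule tg.Sr_small)
    obtain k where k: "l \<le> real k" using real_arch_simple by blast
    have "early l \<subseteq> early (real k)" using k by (auto simp: early_def slab_def)
    then have "?N \<subseteq> {\<omega> \<in> space M. void (early l) \<omega>}" by (auto simp: void_def)
    then have "measure M ?N \<le> measure M {\<omega> \<in> space M. void (early l) \<omega>}"
      using sets by (intro finite_measure_mono) auto
    then show ?thesis using l by (simp add: void_early_prob)
  qed
  then have "measure M ?N \<le> 0" by (rule field_le_epsilon)
  then have "measure M ?N = 0" by (intro antisym measure_nonneg)
  then have "?N \<in> null_sets M" using N by (simp add: null_sets_def emeasure_eq_measure)
  then show ?thesis by (rule AE_I') auto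
qed

definition T :: "'a \<Rightarrow> ennreal" where
  "T \<omega> = Inf {ennreal t | t. 0 < t \<and> ennreal (L t \<omega>) \<le> w (FX t \<omega>)}"

text \<open>The two clauses on \<open>y\<close> say that the stopped value is the one nearest to 0
  among those of its sign and level. A positive stopped value can then be located relative to a
  point \<open>c \<ge> 0\<close> by comparing \<open>w\<close>, even where \<open>w\<close> is
  flat.\<close>

definition stops :: "'a \<Rightarrow> real \<Rightarrow> (real \<Rightarrow> 'e) \<Rightarrow> bool" where
  "stops \<omega> t \<epsilon> \<longleftrightarrow> 0 < t \<and> T \<omega> = ennreal t \<and> w (FX t \<omega>) = ennreal (L t \<omega>) \<and>
     (\<forall>s. 0 < s \<longrightarrow> s < t \<longrightarrow> w (FX s \<omega>) < ennreal (L s \<omega>)) \<and>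
     (\<forall>y. 0 \<le> y \<longrightarrow> y < FX t \<omega> \<longrightarrow> w y < w (FX t \<omega>)) \<and>
     (\<forall>y. FX t \<omega> < y \<longrightarrow> y \<le> 0 \<longrightarrow> w y < w (FX t \<omega>)) \<and>
     eps (L t \<omega>) \<omega> = Some \<epsilon> \<and> ennreal (L t \<omega>) \<le> w (FV \<epsilon>) \<and> (0 < FV \<epsilon> \<longleftrightarrow> 0 < FX t \<omega>) \<and>
     (\<forall>u \<epsilon>'. 0 < u \<longrightarrow> eps u \<omega> = Some \<epsilon>' \<longrightarrow> ennreal u \<le> w (FV \<epsilon>') \<longrightarrow> L t \<omega> \<le> u)"

text \<open>Stopping levels exceed some \<open>\<delta> > 0\<close>, so by continuity of
  \<open>w\<close> at 0 the terminal values concerned are bounded away from 0. There are finitely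
  many up to a given local time, hence a least level, to which \<open>first_stop\<close>
  applies.\<close>

lemma AE_stops: "AE \<omega> in M. \<exists>t \<epsilon>. stops \<omega> t \<epsilon>"
  using AE_stopped_path F_cadlag AE_early_void AE_early_nonvoid
proof eventually_elim
  case (elim \<omega>)
  interpret stopped_path X z L F \<omega> w by fact
  note gp = good_path_axioms
  obtain j where j: "void (early (1 / real (Suc j))) \<omega>" using elim(3) by blast
  obtain k where k: "\<not> void (early (real k)) \<omega>" using elim(4) by blast
  define \<delta> where "\<delta> = 1 / real (Suc j)"
  have \<delta>: "0 < \<delta>" by (simp add: \<delta>_def)
  have R_iff: "u \<in> R \<longleftrightarrow> 0 < u \<and> (\<exists>\<epsilon>. eps u \<omega> = Some \<epsilon> \<and> ennreal u \<le> w (FV \<epsilon>))" for u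
    by (simp add: R_def)
  have late: "\<delta> < u" if "u \<in> R" for u
    using j that unfolding void_early [OF gp] \<delta>_def [symmetric] R_iff by (meson not_le)
  obtain u0 where u0: "u0 \<in> R" "u0 \<le> real k" using k unfolding void_early [OF gp] R_iff by blast
  have "(w \<longlongrightarrow> w 0) (at 0)" using tg.w_continuous by (simp add: continuous_on_def)
  then have "\<forall>\<^sub>F y in at 0. w y < ennreal \<delta>" using \<delta> by (intro order_tendstoD) (auto simp: tg.w_0)
  then obtain c where c: "0 < c" "\<And>y. y \<noteq> 0 \<Longrightarrow> \<bar>y\<bar> < c \<Longrightarrow> w y < ennreal \<delta>"
    unfolding eventually_at by (auto simp: dist_real_def)
  have "finite {l. 0 \<le> l \<and> l \<le> real k \<and> (\<exists>\<epsilon>. eps l \<omega> = Some \<epsilon> \<and> c \<le> \<bar>FV \<epsilon>\<bar>)}"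
    by (rule finite_large_excursions [OF elim(2) c(1)])
  moreover have "R \<inter> {..real k} \<subseteq> {l. 0 \<le> l \<and> l \<le> real k \<and> (\<exists>\<epsilon>. eps l \<omega> = Some \<epsilon> \<and> c \<le> \<bar>FV \<epsilon>\<bar>)}"
  proof
    fix u assume u: "u \<in> R \<inter> {..real k}"
    then obtain \<epsilon> where e: "0 < u" "eps u \<omega> = Some \<epsilon>" "ennreal u \<le> w (FV \<epsilon>)" by (auto simp: R_iff)
    have "\<not> \<bar>FV \<epsilon>\<bar> < c"
    proof
      assume "\<bar>FV \<epsilon>\<bar> < c"
      then have "w (FV \<epsilon>) < ennreal \<delta>" using c(2) [of "FV \<epsilon>"] \<delta> by (cases "FV \<epsilon> = 0") (auto simp: tg.w_0)
      with e(3) have "ennreal u < ennreal \<delta>" by (rule le_less_trans)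
      then show False using late [of u] u e(1) by (simp add: ennreal_less_iff)
    qed
    then show "u \<in> {l. 0 \<le> l \<and> l \<le> real k \<and> (\<exists>\<epsilon>. eps l \<omega> = Some \<epsilon> \<and> c \<le> \<bar>FV \<epsilon>\<bar>)}"
      using e u by (auto simp: not_less)
  qed
  ultimately have fin: "finite (R \<inter> {..real k})" by (rule finite_subset [rotated])
  define l where "l = Min (R \<inter> {..real k})"
  have ne: "R \<inter> {..real k} \<noteq> {}" using u0 by auto
  have lR: "l \<in> R" "l \<le> real k" using Min_in [OF fin ne] by (auto simp: l_def)
  have least: "l \<le> u" if "u \<in> R" for u
    using Min_le [OF fin, of u] that lR(2) by (cases "u \<le> real k") (auto simp: l_def)
  obtain \<epsilon> where e: "eps l \<omega> = Some \<epsilon>" "ennreal l \<le> w (FV \<epsilon>)" using lR by (auto simp: R_iff)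
  obtain t where t: "0 < t" "L t \<omega> = l" "w (FX t \<omega>) = ennreal l"
    "\<And>s. 0 < s \<Longrightarrow> s < t \<Longrightarrow> w (FX s \<omega>) < ennreal (L s \<omega>)"
    "0 < FV \<epsilon> \<longleftrightarrow> 0 < FX t \<omega>"
    "\<And>y. 0 \<le> y \<Longrightarrow> y < FX t \<omega> \<Longrightarrow> w y < ennreal l"
    "\<And>y. FX t \<omega> < y \<Longrightarrow> y \<le> 0 \<Longrightarrow> w y < ennreal l"
    using first_stop [OF lR(1) least e(1)] by blast
  have "T \<omega> = ennreal t"
    unfolding T_def
  proof (rule Inf_eqI)
    fix x assume "x \<in> {ennreal t | t. 0 < t \<and> ennreal (L t \<omega>) \<le> w (FX t \<omega>)}"
    then obtain s where s: "x = ennreal s" "0 < s" "ennreal (L s \<omega>) \<le> w (FX s \<omega>)" by blast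
    then have "\<not> s < t" using t(4) [of s] by auto
    then show "ennreal t \<le> x" using s(1) by (simp add: ennreal_leI)
  next
    fix x assume *: "\<And>i. i \<in> {ennreal t | t. 0 < t \<and> ennreal (L t \<omega>) \<le> w (FX t \<omega>)} \<Longrightarrow> x \<le> i"
    have "ennreal t \<in> {ennreal t | t. 0 < t \<and> ennreal (L t \<omega>) \<le> w (FX t \<omega>)}"
      by (intro CollectI exI [of _ t]) (simp add: t(1,2,3))
    then show "x \<le> ennreal t" by (rule *)
  qed
  moreover have "L t \<omega> \<le> u" if "0 < u" "eps u \<omega> = Some \<epsilon>'" "ennreal u \<le> w (FV \<epsilon>')" for u \<epsilon>'
    using least [of u] that t(2) by (auto simp: R_iff)
  ultimately have "stops \<omega> t \<epsilon>"
    unfolding stops_def using t e by (intro conjI) simp_all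
  then show ?case by blast
qed

end

section \<open>The law of the stopped value and minimality\<close>

text \<open>Right-continuity of \<open>K\<close> makes the infimum attained. The empty set is
  covered as well, as \<open>phi_of\<close> is then infinite.\<close>

lemma (in weight) phi_of_le: "phi_of K l \<le> ereal y \<longleftrightarrow> 0 \<le> y \<and> ennreal l \<le> K y"
proof
  assume "0 \<le> y \<and> ennreal l \<le> K y"
  then show "phi_of K l \<le> ereal y" unfolding phi_of_def by (intro Inf_lower) auto
next
  assume *: "phi_of K l \<le> ereal y"
  have "0 \<le> phi_of K l" unfolding phi_of_def by (intro Inf_greatest) auto
  then have "0 \<le> ereal y" using * by (rule order_trans)
  then have "0 \<le> y" by simp
  moreover have "ennreal l \<le> K y"
  proof (rule ccontr)
    assume "\<not> ennreal l \<le> K y"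
    then have "K y < ennreal l" by simp
    from K_right [OF this] obtain y' where y': "y < y'" "K y' < ennreal l" by blast
    have "ereal y' \<le> phi_of K l"
      unfolding phi_of_def
    proof (rule Inf_greatest)
      fix x assume "x \<in> {ereal x | x. 0 \<le> x \<and> ennreal l \<le> K x}"
      then obtain x' where x': "x = ereal x'" "ennreal l \<le> K x'" by auto
      then have "K y' < K x'" using y'(2) by simp
      then have "\<not> x' \<le> y'" using K_mono [of x' y'] by auto
      then show "ereal y' \<le> x" using x' by simp
    qed
    then have "ereal y' \<le> ereal y" using * by (rule order_trans)
    then show False using y' by simp
  qed
  ultimately show "0 \<le> y \<and> ennreal l \<le> K y" by simp
qed

lemma measure_Ioc_split:
  fixes N :: "real measure"
  assumes "finite_measure N" "sets N = sets borel" "a \<le> b" "b \<le> c"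
  shows "measure N {a<..c} = measure N {a<..b} + measure N {b<..c}"
proof -
  interpret finite_measure N by fact
  have "{a<..c} = {a<..b} \<union> {b<..c}" "{a<..b} \<inter> {b<..c} = {}" using assms(3,4) by auto
  then show ?thesis using finite_measure_Union [of "{a<..b}" "{b<..c}"] assms(2) by simp
qed

context target
begin

lemma le_w: "ennreal l \<le> w y \<longleftrightarrow> ennreal l \<le> psi_minus \<mu> \<nu> (- y) \<or> ennreal l \<le> \<psi> y"
  by (cases "0 \<le> y") (auto simp: w_def psi_minus_mirror psi'_nonpos psi.K_nonpos)

lemma level_iff_phi: "ennreal l \<le> w y \<longleftrightarrow>
  ereal y \<notin> {- phi_of (psi_minus \<mu> \<nu>) l <..< phi_of \<psi> l}"
proof -
  interpret m: target "mirror \<mu>" "mirror \<nu>" by (rule target_mirror)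
  have "psi_minus \<mu> \<nu> = \<psi>'" by (simp add: fun_eq_iff psi_minus_mirror)
  then have "phi_of (psi_minus \<mu> \<nu>) l \<le> ereal (- y) \<longleftrightarrow> y \<le> 0 \<and> ennreal l \<le> psi_minus \<mu> \<nu> (- y)"
    using m.psi.phi_of_le [of l "- y"] by simp
  moreover have "ereal y \<le> - c \<longleftrightarrow> c \<le> ereal (- y)" for c
    by (metis ereal_minus_le_minus ereal_uminus_uminus uminus_ereal.simps(1))
  moreover have "phi_of \<psi> l \<le> ereal y \<longleftrightarrow> 0 \<le> y \<and> ennreal l \<le> \<psi> y" by (rule psi.phi_of_le)
  ultimately have "ereal y \<notin> {- phi_of (psi_minus \<mu> \<nu>) l <..< phi_of \<psi> l} \<longleftrightarrow>
      (y \<le> 0 \<and> ennreal l \<le> psi_minus \<mu> \<nu> (- y)) \<or> (0 \<le> y \<and> ennreal l \<le> \<psi> y)"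
    by (auto simp: not_less)
  also have "\<dots> \<longleftrightarrow> ennreal l \<le> w y"
    unfolding le_w by (cases "0 \<le> y") (auto simp: psi_minus_mirror psi'_nonpos psi.K_nonpos)
  finally show ?thesis by simp
qed

lemma mu_real_distribution: "real_distribution \<mu>"
  by unfold_locales simp_all

text \<open>The law of the stopped value is first computed only at points with \<mu>-mass beyond
  them; this lemma reaches an arbitrary \<open>b\<close>.\<close>

lemma approximate_from_left:
  assumes "a \<le> b" "0 < measure \<mu> {a<..b}" "0 < \<epsilon>"
  obtains x where "a \<le> x" "x < b" "0 < emeasure \<mu> {x<..}" "measure \<mu> {x<..b} < \<epsilon>"
proof -
  interpret r: real_distribution \<mu> by (rule mu_real_distribution)
  \<comment> \<open>The mass left in \<open>(x,b]\<close>: positive so that \<open>x\<close> has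
    mass beyond it, less than \<open>\<epsilon>\<close>, and small enough for
    \<open>a \<le> x\<close>.\<close>
  define p where "p = min (\<epsilon> / 2) (measure \<mu> {a<..b})"
  have p: "0 < p" "p < \<epsilon>" "p \<le> measure \<mu> {a<..b}" using assms by (auto simp: p_def)
  have Ioc: "measure \<mu> {x<..b} = cdf \<mu> b - cdf \<mu> x" if "x \<le> b" for x
  proof (cases "x = b")
    case False then show ?thesis using that by (subst r.cdf_diff_eq) auto
  qed simp
  have "isCont (cdf \<mu>) x" for x by (simp add: r.isCont_cdf measure_def mu_atomless)
  then have "continuous_on {a..b} (cdf \<mu>)" by (intro continuous_at_imp_continuous_on) auto
  then obtain x where x: "a \<le> x" "x \<le> b" "cdf \<mu> x = cdf \<mu> b - p"
    using IVT' [of "cdf \<mu>" a "cdf \<mu> b - p" b] p Ioc [OF assms(1)] assms(1) by auto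
  then have "measure \<mu> {x<..b} = p" using Ioc by simp
  moreover have "x \<noteq> b" using x p by auto
  moreover have "measure \<mu> {x<..b} \<le> measure \<mu> {x<..}" by (intro finite_measure_mono) auto
  ultimately show thesis using that [of x] x p by (simp add: emeasure_eq_measure)
qed

text \<open>Lower bounds for complementary events suffice, because both totals are one.\<close>

lemma prob_eqI:
  assumes "prob_space N" and N [simp]: "sets N = sets borel"
    and pos: "\<And>a. 0 \<le> a \<Longrightarrow> measure \<mu> {a<..} \<le> measure N {a<..}"
      "\<And>a. 0 \<le> a \<Longrightarrow> measure \<mu> {0<..a} \<le> measure N {0<..<a}"
    and neg: "\<And>a. 0 \<le> a \<Longrightarrow> measure \<mu> {..<-a} \<le> measure N {..<-a}"
      "\<And>a. 0 \<le> a \<Longrightarrow> measure \<mu> {-a..<0} \<le> measure N {-a<..<0}"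
  shows "N = \<mu>"
proof -
  interpret N: prob_space N by fact
  \<comment> \<open>The point \<open>y\<close> is \<mu>-null, so a half-line can be cut there at no
    cost.\<close>
  have split: "measure \<mu> (insert y (A \<union> B)) \<le> measure N C"
    if "measure \<mu> A \<le> measure N A'" "measure \<mu> B \<le> measure N B'" "A' \<inter> B' = {}" "A' \<union> B' \<subseteq> C"
      "A \<in> sets borel" "B \<in> sets borel" "A' \<in> sets borel" "B' \<in> sets borel" "C \<in> sets borel" for y A B A' B' C
  proof -
    have "measure \<mu> (insert y (A \<union> B)) = measure \<mu> (A \<union> B)"
      using measure_Un_null_set [of "A \<union> B" \<mu> "{y}"] that D.singleton_null by simp
    also have "\<dots> \<le> measure \<mu> A + measure \<mu> B" using that by (intro measure_Un_le) auto
    also have "\<dots> \<le> measure N A' + measure N B'" using that by simp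
    also have "\<dots> = measure N (A' \<union> B')" using that by (intro N.finite_measure_Union [symmetric]) auto
    also have "\<dots> \<le> measure N C" using that by (intro N.finite_measure_mono) auto
    finally show ?thesis .
  qed
  have lower: "measure \<mu> {x<..} \<le> measure N {x<..}" for x
  proof (cases "0 \<le> x")
    case False
    then have eq: "{x<..} = insert 0 ({x<..<0} \<union> {0<..})" by auto
    have "measure \<mu> {x<..<0} \<le> measure \<mu> {x..<0}" by (intro finite_measure_mono) auto
    then have "measure \<mu> {x<..<0} \<le> measure N {x<..<0}" using neg(2) [of "- x"] False by simp
    moreover have "measure \<mu> {0<..} \<le> measure N {0<..}" by (rule pos(1)) simp
    ultimately have "measure \<mu> (insert 0 ({x<..<0} \<union> {0<..})) \<le> measure N {x<..}"
      by (rule split) (use False in auto)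
    then show ?thesis by (simp only: arg_cong [OF eq, of "measure \<mu>"])
  qed (rule pos(1))
  have upper: "measure \<mu> {..x} \<le> measure N {..x}" for x
  proof (cases "0 \<le> x")
    case True
    then have eq: "{..x} = insert 0 ({..<0} \<union> {0<..x})" by auto
    have "measure \<mu> {..<0} \<le> measure N {..<0}" using neg(1) [of 0] by simp
    then have "measure \<mu> (insert 0 ({..<0} \<union> {0<..x})) \<le> measure N {..x}"
      using pos(2) [OF True] by (rule split) (use True in auto)
    then show ?thesis by (simp only: arg_cong [OF eq, of "measure \<mu>"])
  next
    case False
    have eq: "{..x} = insert x ({..<x} \<union> {})" by auto
    have "measure \<mu> {..<x} \<le> measure N {..<x}" using neg(1) [of "- x"] False by simp
    then have "measure \<mu> (insert x ({..<x} \<union> {})) \<le> measure N {..x}"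
      by (rule split [of _ _ "{}" "{}"]) auto
    then show ?thesis by (simp only: arg_cong [OF eq, of "measure \<mu>"])
  qed
  show "N = \<mu>"
  proof (rule measure_eqI_lessThan)
    fix x :: real
    have "{x<..} \<union> {..x} = UNIV" "{x<..} \<inter> {..x} = {}" by auto
    then have "measure N {x<..} + measure N {..x} = 1" "measure \<mu> {x<..} + measure \<mu> {..x} = 1"
      using N.finite_measure_Union [of "{x<..}" "{..x}"] N.prob_space sets_eq_imp_space_eq [OF N]
        finite_measure_Union [of "{x<..}" "{..x}"] prob_space by simp_all
    then have "measure N {x<..} = measure \<mu> {x<..}" using lower [of x] upper [of x] by linarith
    then show "emeasure N {x<..} = emeasure \<mu> {x<..}"
      by (simp add: N.emeasure_eq_measure emeasure_eq_measure)
    show "emeasure N {x<..} < \<infinity>" by (simp add: N.emeasure_eq_measure)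
  qed simp_all
qed

end

context embedding
begin

lemma process_mirror: "functional_process X z L (\<lambda>\<epsilon> t. - F \<epsilon> t) t \<omega> = - FX t \<omega>"
  by (simp add: functional_process_def split: option.split)

lemma nu_mirror: "functional_measure z n (\<lambda>\<epsilon> t. - F \<epsilon> t) = mirror \<nu>"
  unfolding functional_measure_def mirror_def by (subst distr_distr) (auto simp: comp_def)

text \<open>Replacing \<open>F\<close> by \<open>-F\<close> exchanges the two half-lines, so the law of the stopped value only
  needs to be computed on the right.\<close>

lemma embedding_mirror: "embedding M X z PX L n (\<lambda>\<epsilon> t. - F \<epsilon> t) (mirror \<mu>)"
proof -
  interpret m: excursion_functional M X z PX L n "\<lambda>\<epsilon> t. - F \<epsilon> t"
  proof
    show "mono_on {0..} (\<lambda>t. - F \<epsilon> t) \<or> antimono_on {0..} (\<lambda>t. - F \<epsilon> t)" if "\<epsilon> \<in> excursions z" for \<epsilon>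
      using F_monotone [OF that] by (auto simp: monotone_on_def)
    show "continuous_on {0..} (\<lambda>t. - F \<epsilon> t)" if "\<epsilon> \<in> excursions z" for \<epsilon>
      using F_continuous [OF that] by (rule continuous_on_minus)
    show "- F \<epsilon> t = - F \<epsilon> (lifetime z \<epsilon>)" if "\<epsilon> \<in> excursions z" "lifetime z \<epsilon> \<le> t" for \<epsilon> t
      using F_end [OF that] by simp
    show "(\<lambda>\<epsilon>. - F \<epsilon> t) \<in> borel_measurable (vimage_algebra (excursions z) (\<lambda>\<epsilon>. restrict \<epsilon> {0..t}) (PiM {0..t} (\<lambda>_. borel)))"
      if "0 \<le> t" for t
      using F_nonanticipating [OF that] by (rule borel_measurable_uminus)
    show "AE \<omega> in M. \<forall>t\<ge>0. continuous (at_right t) (\<lambda>s. functional_process X z L (\<lambda>\<epsilon> t. - F \<epsilon> t) s \<omega>) \<and>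
      (0 < t \<longrightarrow> (\<exists>y. ((\<lambda>s. functional_process X z L (\<lambda>\<epsilon> t. - F \<epsilon> t) s \<omega>) \<longlongrightarrow> y) (at_left t)))"
      using F_cadlag
    proof eventually_elim
      case (elim \<omega>)
      show ?case
      proof (intro allI impI)
        fix t :: real assume "0 \<le> t"
        then have "continuous (at_right t) (\<lambda>s. FX s \<omega>) \<and> (0 < t \<longrightarrow> (\<exists>y. ((\<lambda>s. FX s \<omega>) \<longlongrightarrow> y) (at_left t)))"
          using elim by blast
        then show "continuous (at_right t) (\<lambda>s. functional_process X z L (\<lambda>\<epsilon> t. - F \<epsilon> t) s \<omega>) \<and>
          (0 < t \<longrightarrow> (\<exists>y. ((\<lambda>s. functional_process X z L (\<lambda>\<epsilon> t. - F \<epsilon> t) s \<omega>) \<longlongrightarrow> y) (at_left t)))"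
          unfolding process_mirror by (auto intro: continuous_minus tendsto_minus)
      qed
    qed
  qed (use F_start F_nonzero in auto)
  have "target (mirror \<mu>) (functional_measure z n (\<lambda>\<epsilon> t. - F \<epsilon> t))"
    unfolding nu_mirror by (rule tg.target_mirror)
  then show ?thesis by (intro embedding.intro m.excursion_functional_axioms)
qed

definition YT :: "'a \<Rightarrow> real" where "YT \<omega> = FX (enn2real (T \<omega>)) \<omega>"

lemma T_stopping: "stopping_time \<F> T"
  unfolding T_def [abs_def] by (rule stopping_time_level [OF AE_stopped_path w_measurable])

lemma T_measurable: "T \<in> borel_measurable M"
  using T_stopping filt_subset by (rule measurable_stopping_time) simp

lemma FX_measurable: "0 < t \<Longrightarrow> FX t \<in> borel_measurable M"
  using process_adapted [of t] filt_subset [of "ennreal t"]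
  by (auto simp: measurable_def)

text \<open>\<open>T\<close> is approximated from the right by times with countably many values, and
  right-continuity of the paths passes to the limit.\<close>

lemma YT_measurable [measurable]: "YT \<in> borel_measurable M"
proof -
  define G where "G = {\<omega> \<in> space M. \<forall>t\<ge>0. continuous (at_right t) (\<lambda>s. FX s \<omega>)}"
  have G_AE: "AE \<omega> in M. \<omega> \<in> G" using F_cadlag AE_space by eventually_elim (simp add: G_def)
  have G_sets: "G \<in> sets M"
    by (rule in_sets_AE [OF _ sets.top]) (use G_AE AE_space in \<open>auto simp: G_def\<close>)
  define g where "g k \<omega> = nat \<lfloor>2 ^ k * enn2real (T \<omega>)\<rfloor>" for k :: nat and \<omega>
  have g: "g k \<in> M \<rightarrow>\<^sub>M count_space UNIV" for k
    unfolding g_def using T_measurable by measurable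
  \<comment> \<open>Adding 1 keeps these times at or after \<open>T\<close> and strictly positive,
    as \<open>FX_measurable\<close> requires.\<close>
  define r where "r k \<omega> = (real (g k \<omega>) + 1) / 2 ^ k" for k :: nat and \<omega>
  have r: "enn2real (T \<omega>) \<le> r k \<omega>" "r k \<omega> \<le> enn2real (T \<omega>) + 1 / 2 ^ k" for k \<omega>
  proof -
    have "real (g k \<omega>) = of_int \<lfloor>2 ^ k * enn2real (T \<omega>)\<rfloor>" by (simp add: g_def)
    then have "real (g k \<omega>) \<le> 2 ^ k * enn2real (T \<omega>)" "2 ^ k * enn2real (T \<omega>) \<le> real (g k \<omega>) + 1"
      by linarith+
    then show "enn2real (T \<omega>) \<le> r k \<omega>" "r k \<omega> \<le> enn2real (T \<omega>) + 1 / 2 ^ k"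
      by (simp_all add: r_def field_simps)
  qed
  have r_lim: "(\<lambda>k. r k \<omega>) \<longlonglongrightarrow> enn2real (T \<omega>)" for \<omega>
  proof (rule tendsto_sandwich [of "\<lambda>_. enn2real (T \<omega>)" _ _ "\<lambda>k. enn2real (T \<omega>) + 1 / 2 ^ k"])
    have "(\<lambda>k. (1 / 2) ^ k :: real) \<longlonglongrightarrow> 0" by (intro LIMSEQ_power_zero) simp
    then have "(\<lambda>k. 1 / 2 ^ k :: real) \<longlonglongrightarrow> 0" by (simp add: power_divide)
    from tendsto_add [OF tendsto_const this] show "(\<lambda>k. enn2real (T \<omega>) + 1 / 2 ^ k) \<longlonglongrightarrow> enn2real (T \<omega>)" by simp
  qed (use r in auto)
  have "(\<lambda>\<omega>. if \<omega> \<in> G then YT \<omega> else 0) \<in> borel_measurable M"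
  proof (rule borel_measurable_LIMSEQ_real)
    fix k
    have "(\<lambda>\<omega>. FX ((real i + 1) / 2 ^ k) \<omega>) \<in> borel_measurable M" for i :: nat
      by (rule FX_measurable) simp
    then have "(\<lambda>\<omega>. FX ((real (g k \<omega>) + 1) / 2 ^ k) \<omega>) \<in> borel_measurable M"
      by (rule measurable_compose_countable [OF _ g])
    then show "(\<lambda>\<omega>. if \<omega> \<in> G then FX (r k \<omega>) \<omega> else 0) \<in> borel_measurable M"
      unfolding r_def using G_sets by (intro measurable_If_set) auto
  next
    fix \<omega>
    show "(\<lambda>k. if \<omega> \<in> G then FX (r k \<omega>) \<omega> else 0) \<longlonglongrightarrow> (if \<omega> \<in> G then YT \<omega> else 0)"
    proof (cases "\<omega> \<in> G")
      case True
      then have "continuous (at_right (enn2real (T \<omega>))) (\<lambda>s. FX s \<omega>)" by (simp add: G_def)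
      then have "(\<lambda>k. FX (r k \<omega>) \<omega>) \<longlonglongrightarrow> FX (enn2real (T \<omega>)) \<omega>"
        using r_lim r(1) by (rule right_continuous_sequence)
      then show ?thesis using True by (simp add: YT_def)
    qed simp
  qed
  then show ?thesis
    by (rule AE_measurable) (use G_AE in auto)
qed

abbreviation "law \<equiv> distr M borel YT"

lemma law_prob: "prob_space law"
  by (rule prob_space_distr) simp

lemma law_sets: "sets law = sets borel"
  by simp

lemma YT_stops: "stops \<omega> t \<epsilon> \<Longrightarrow> YT \<omega> = FX t \<omega>"
  by (simp add: stops_def YT_def)

text \<open>Stopping at a positive value in the local time interval \<open>(l,m]\<close> forces no stopping point up to
  \<open>l\<close> and a positive one in \<open>(l,m]\<close>; conversely it is forced if moreover there is no negative one in
  \<open>(l,m]\<close>. These events are intersections of independent void events.\<close>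

lemma YT_bounds:
  assumes "0 \<le> c" "c \<le> e" "0 < emeasure \<mu> {e<..}"
  defines "l \<equiv> enn2real (w c)" and "m \<equiv> enn2real (w e)"
  defines "P \<equiv> measure (distr M borel YT) {c<..e}"
  shows "tg.Sr m * enn2real (tg.Lam l m) \<le> P" "P \<le> tg.Sr l * enn2real (tg.Lam l m)"
proof -
  have fin: "w c < \<infinity>" "w e < \<infinity>" and Sm: "0 < tg.Sr m"
    using tg.Sr_pos assms(1-3) tg.tail_pos_mono [OF assms(2,3)] by (auto simp: m_def)
  have w: "w c = ennreal l" "w e = ennreal m" using fin by (auto simp: l_def m_def)
  have lm: "0 \<le> l" "l \<le> m" using tg.w_mono_pos [OF assms(1,2)] fin by (auto simp: l_def m_def intro: enn2real_mono)
  have Sl: "0 < tg.Sr l" using tg.Sr_antimono [OF lm(2)] Sm by simp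
  let ?U = "{\<omega> \<in> space M. void (early l) \<omega> \<and> \<not> void (pos_slab l m) \<omega> \<and> void (neg_slab l m) \<omega>}"
  \<comment> \<open>\<open>void {}\<close> always holds and fills the third place of
    \<open>void_indep\<close> with intensity 0.\<close>
  let ?U' = "{\<omega> \<in> space M. void (early l) \<omega> \<and> \<not> void (pos_slab l m) \<omega> \<and> void {} \<omega>}"
  let ?E = "{\<omega> \<in> space M. c < YT \<omega> \<and> YT \<omega> \<le> e}"
  have slabs: "pos_slab l m \<in> sets J" "neg_slab l m \<in> sets J" by (auto intro!: slab_sets)
  have mLam: "measure J (pos_slab l m) = enn2real (tg.Lam l m)" "measure J (neg_slab l m) = enn2real (tg.Lam' l m)"
    using lm by (simp_all add: measure_def pos_slab_emeasure neg_slab_emeasure)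
  have fins: "emeasure J (pos_slab l m) < \<infinity>" "emeasure J (neg_slab l m) < \<infinity>"
    using tg.Lam_real(1) [OF lm Sm] tg.Lam'_finite [OF lm Sm] lm by (simp_all add: pos_slab_emeasure neg_slab_emeasure)
  have dis: "early l \<inter> pos_slab l m = {}" "early l \<inter> neg_slab l m = {}" "pos_slab l m \<inter> neg_slab l m = {}"
    using slab_disjoint [OF lm(1,1)] by (auto simp: early_def slab_def)
  have U: "measure M ?U = tg.Sr l * (1 - exp (- enn2real (tg.Lam l m))) * exp (- enn2real (tg.Lam' l m))"
    using void_indep [OF early_sets slabs dis early_measure(1) [OF lm(1) Sl] fins] early_measure(2) [OF lm(1) Sl]
    by (simp add: mLam)
  have U': "measure M ?U' = tg.Sr l * (1 - exp (- enn2real (tg.Lam l m)))"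
    using void_indep [OF early_sets slabs(1) sets.empty_sets dis(1) _ _ early_measure(1) [OF lm(1) Sl] fins(1)] early_measure(2) [OF lm(1) Sl]
    by (simp add: mLam)
  have sets: "{\<omega> \<in> space M. void C \<omega>} \<in> sets M" if "C \<in> sets J" for C using that by (rule void_measurable)
  have "?U' = {\<omega> \<in> space M. void (early l) \<omega>} \<inter> (space M - {\<omega> \<in> space M. void (pos_slab l m) \<omega>})"
    by (auto simp: void_def)
  then have U'_sets: "?U' \<in> sets M" using sets [OF early_sets] sets [OF slabs(1)] by auto
  have E_sets: "?E \<in> sets M" by measurable
  have P: "P = measure M ?E"
    unfolding P_def by (subst measure_distr) (auto intro!: arg_cong [where f="measure M"])
  define \<Lambda> where "\<Lambda> = enn2real (tg.Lam l m)"
  have AE_stopped: "AE \<omega> in M. good_path X z L F \<omega> \<and> (\<exists>t \<epsilon>. stops \<omega> t \<epsilon>)"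
    using AE_good_path AE_stops by eventually_elim simp
  have "measure M ?U \<le> P"
    unfolding P
  proof (rule finite_measure_mono_AE)
    show "AE \<omega> in M. \<omega> \<in> ?U \<longrightarrow> \<omega> \<in> ?E"
      using AE_stopped
    proof eventually_elim
      case (elim \<omega>)
      then obtain t \<epsilon> where gp: "good_path X z L F \<omega>" and st: "stops \<omega> t \<epsilon>" by blast
      note s = st [unfolded stops_def]
      show ?case
      proof
        assume U: "\<omega> \<in> ?U"
        have Lt: "0 < L t \<omega>" using good_path.L_pos [OF gp] s by blast
        obtain u \<epsilon>' where u: "l < u" "u \<le> m" "eps u \<omega> = Some \<epsilon>'" "ennreal u \<le> \<psi> (FV \<epsilon>')"
        proof -
          have "\<not> void (pos_slab l m) \<omega>" using U by simp
          then show thesis using that unfolding void_slab [OF gp lm(1)] by blast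
        qed
        have "ennreal u \<le> w (FV \<epsilon>')" using tg.le_w_iff [of u] u lm by auto
        then have "L t \<omega> \<le> u" using s u lm by auto
        then have Lm: "L t \<omega> \<le> m" using u by simp
        have Ll: "l < L t \<omega>"
        proof (rule ccontr)
          assume "\<not> l < L t \<omega>"
          moreover have "void (early l) \<omega>" using U by simp
          ultimately show False using s Lt unfolding void_early [OF gp] by (meson not_less)
        qed
        have "void (neg_slab l m) \<omega>" using U by simp
        then have "\<not> ennreal (L t \<omega>) \<le> \<psi>' (- FV \<epsilon>)"
          using Ll Lm s unfolding void_slab [OF gp lm(1)] by blast
        then have "ennreal (L t \<omega>) \<le> \<psi> (FV \<epsilon>)" using s tg.le_w_iff [OF Lt] by blast
        then have "0 < FV \<epsilon>" by (rule tg.le_psi_pos [OF Lt])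
        then have Yp: "0 < FX t \<omega>" using s by blast
        have "c < FX t \<omega>"
        proof (rule ccontr)
          assume "\<not> c < FX t \<omega>"
          then have "w (FX t \<omega>) \<le> w c" using Yp by (intro tg.w_mono_pos) auto
          then show False using s Ll lm unfolding w by (auto simp: ennreal_le_iff2)
        qed
        moreover have "FX t \<omega> \<le> e"
        proof (rule ccontr)
          assume "\<not> FX t \<omega> \<le> e"
          then have "w e < w (FX t \<omega>)" using s assms(1,2) by auto
          then show False using s Lm lm unfolding w by (auto simp: ennreal_less_iff)
        qed
        ultimately show "\<omega> \<in> ?E" using U YT_stops [OF st] by simp
      qed
    qed
  qed (rule E_sets)
  moreover have "tg.Sr m * \<Lambda> \<le> measure M ?U"
  proof -
    \<comment> \<open>By \<open>Sr_step\<close> the probability of \<open>?U\<close> is exactly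
      \<open>Sr m * (exp \<Lambda> - 1)\<close>.\<close>
    have "tg.Sr m * \<Lambda> \<le> tg.Sr m * (exp \<Lambda> - 1)"
    proof (rule mult_left_mono)
      show "\<Lambda> \<le> exp \<Lambda> - 1" using exp_ge_add_one_self [of \<Lambda>] by linarith
    qed (use Sm in simp)
    also have "\<dots> = measure M ?U"
      unfolding U \<Lambda>_def [symmetric] tg.Sr_step [OF lm Sm] by (simp add: algebra_simps exp_minus)
    finally show ?thesis .
  qed
  ultimately show "tg.Sr m * enn2real (tg.Lam l m) \<le> P" by (simp add: \<Lambda>_def)
  have "P \<le> measure M ?U'"
    unfolding P
  proof (rule finite_measure_mono_AE)
    show "AE \<omega> in M. \<omega> \<in> ?E \<longrightarrow> \<omega> \<in> ?U'"
      using AE_stopped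
    proof eventually_elim
      case (elim \<omega>)
      then obtain t \<epsilon> where gp: "good_path X z L F \<omega>" and st: "stops \<omega> t \<epsilon>" by blast
      note s = st [unfolded stops_def]
      show ?case
      proof
        assume "\<omega> \<in> ?E"
        then have E: "\<omega> \<in> space M" "c < FX t \<omega>" "FX t \<omega> \<le> e" using YT_stops [OF st] by auto
        have Lt: "0 < L t \<omega>" using good_path.L_pos [OF gp] s by blast
        have "w c < w (FX t \<omega>)" using s E assms(1) by blast
        then have Ll: "l < L t \<omega>" using s lm unfolding w by (auto simp: ennreal_less_iff)
        have "w (FX t \<omega>) \<le> w e" using E assms(1) by (intro tg.w_mono_pos) auto
        then have Lm: "L t \<omega> \<le> m" using s lm unfolding w by (auto simp: ennreal_le_iff)
        have "void (early l) \<omega>"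
          unfolding void_early [OF gp]
        proof (intro allI impI notI)
          fix u \<epsilon>' assume "0 < u" "u \<le> l" "eps u \<omega> = Some \<epsilon>'" "ennreal u \<le> w (FV \<epsilon>')"
          then have "L t \<omega> \<le> u" using s by blast
          then show False using \<open>u \<le> l\<close> Ll by simp
        qed
        moreover have "\<not> void (pos_slab l m) \<omega>"
        proof -
          have "0 < FX t \<omega>" using E assms(1) by simp
          then have "0 < FV \<epsilon>" using s by blast
          then have "ennreal (L t \<omega>) \<le> \<psi> (FV \<epsilon>)" using s tg.w_nonneg [of "FV \<epsilon>"] by simp
          then show ?thesis unfolding void_slab [OF gp lm(1)] using s Ll Lm by blast
        qed
        ultimately show "\<omega> \<in> ?U'" using E by (simp add: void_def)
      qed
    qed
  qed (rule U'_sets)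
  also have "\<dots> \<le> tg.Sr l * \<Lambda>"
    unfolding U' \<Lambda>_def [symmetric]
  proof (rule mult_left_mono)
    show "1 - exp (- \<Lambda>) \<le> \<Lambda>" using exp_ge_add_one_self [of "- \<Lambda>"] by linarith
  qed (use Sl in simp)
  finally show "P \<le> tg.Sr l * enn2real (tg.Lam l m)" by (simp add: \<Lambda>_def)
qed

text \<open>\<open>const_of_quadratic_bound\<close> runs along \<open>Sr\<close> composed with
  \<open>w\<close>: the discrepancy on \<open>(a,c]\<close> is at most the squared increment divided
  by \<open>Sr\<close> at \<open>w b\<close>, which is positive because \<mu> has mass beyond
  \<open>b\<close>.\<close>

lemma YT_Ioc:
  assumes "0 \<le> b" "0 < emeasure \<mu> {b<..}"
  shows "measure law {0<..b} = measure \<mu> {0<..b}"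
proof -
  interpret law: prob_space law by (rule law_prob)
  define E where "E y = measure law {0<..y} - measure \<mu> {0<..y}" for y
  have "E b = E 0"
  proof (rule const_of_quadratic_bound [OF assms(1) tg.Sr_w_continuous [OF assms(2)]])
    fix a c assume ac: "0 \<le> a" "a \<le> c" "c \<le> b"
    have c: "0 < emeasure \<mu> {c<..}" using ac(3) assms(2) by (rule tg.tail_pos_mono)
    have a: "0 < emeasure \<mu> {a<..}" using ac(2) c by (rule tg.tail_pos_mono)
    define l m where "l = enn2real (w a)" and "m = enn2real (w c)"
    define \<Lambda> where "\<Lambda> = enn2real (tg.Lam l m)"
    define P where "P = measure law {a<..c}"
    have fin: "w a < \<infinity>" "w c < \<infinity>" "w b < \<infinity>" and Sb: "0 < tg.Sr (enn2real (w b))"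
      using tg.Sr_pos [of a] tg.Sr_pos [of c] tg.Sr_pos [of b] a c assms ac by auto
    have lm: "0 \<le> l" "l \<le> m" "m \<le> enn2real (w b)"
      using tg.w_mono_pos [of a c] tg.w_mono_pos [of c b] fin ac by (auto simp: l_def m_def intro: enn2real_mono)
    have S: "tg.Sr (enn2real (w b)) \<le> tg.Sr m" "tg.Sr m \<le> tg.Sr l" using lm tg.Sr_antimono by auto
    then have pos: "0 < tg.Sr m" "0 < tg.Sr l" using Sb by auto
    have mass: "measure \<mu> {a<..c} = tg.mass l m" unfolding l_def m_def by (rule tg.mass_interval [OF ac(1,2) c])
    have \<Lambda>: "tg.mass l m / tg.Sr l \<le> \<Lambda>" "\<Lambda> \<le> tg.mass l m / tg.Sr m"
      unfolding \<Lambda>_def using tg.Lam_real(2,3) [OF lm(1,2) pos(1)] .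
    have P: "tg.Sr m * \<Lambda> \<le> P" "P \<le> tg.Sr l * \<Lambda>"
      unfolding P_def \<Lambda>_def l_def m_def by (rule YT_bounds [OF ac(1,2) c])+
    have mass0: "0 \<le> tg.mass l m" "tg.mass l m \<le> tg.Sr l - tg.Sr m"
      using tg.mass_le [OF lm(1,2)] by (simp_all add: tg.mass_def)
    let ?D = "tg.Sr l - tg.Sr m"
    have "P \<le> tg.Sr l * (tg.mass l m / tg.Sr m)" using P(2) \<Lambda>(2) pos by (meson mult_left_mono less_imp_le order_trans)
    then have "P - tg.mass l m \<le> tg.mass l m * ?D / tg.Sr m" using pos by (simp add: field_simps)
    also have "\<dots> \<le> ?D * ?D / tg.Sr m" using mass0 S pos by (intro divide_right_mono mult_right_mono) auto
    also have "\<dots> \<le> ?D * ?D / tg.Sr (enn2real (w b))" using S Sb pos by (intro divide_left_mono) auto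
    finally have up: "P - tg.mass l m \<le> ?D * ?D / tg.Sr (enn2real (w b))" .
    have "tg.Sr m * (tg.mass l m / tg.Sr l) \<le> P" using P(1) \<Lambda>(1) pos by (meson mult_left_mono less_imp_le order_trans)
    then have "tg.mass l m - P \<le> tg.mass l m * ?D / tg.Sr l" using pos by (simp add: field_simps)
    also have "\<dots> \<le> ?D * ?D / tg.Sr l" using mass0 S pos by (intro divide_right_mono mult_right_mono) auto
    also have "\<dots> \<le> ?D * ?D / tg.Sr (enn2real (w b))" using S Sb pos by (intro divide_left_mono) auto
    finally have lo: "tg.mass l m - P \<le> ?D * ?D / tg.Sr (enn2real (w b))" .
    have "E c - E a = P - tg.mass l m"
      using measure_Ioc_split [OF law.finite_measure_axioms law_sets ac(1,2)] measure_Ioc_split [OF tg.finite_measure_axioms tg.mu_sets ac(1,2)]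
      by (simp add: E_def P_def mass)
    then show "\<bar>E c - E a\<bar> \<le> 1 / tg.Sr (enn2real (w b)) * (tg.Sr (enn2real (w a)) - tg.Sr (enn2real (w c)))\<^sup>2"
      using up lo by (simp add: abs_le_iff power2_eq_square l_def m_def)
  qed
  moreover have "E 0 = 0" by (simp add: E_def)
  ultimately show ?thesis by (simp add: E_def)
qed

text \<open>If nothing may lie beyond \<open>b\<close>, \<open>YT_Ioc\<close> is used at a point
  \<open>x < b\<close> with mass beyond it and with little mass left in
  \<open>(x,b]\<close>.\<close>

lemma YT_Ioo:
  assumes "0 \<le> a" "a \<le> b" shows "measure \<mu> {a<..b} \<le> measure law {a<..<b}"
proof (cases "measure \<mu> {a<..b} = 0")
  case False
  interpret law: prob_space law by (rule law_prob)
  have pos: "0 < measure \<mu> {a<..b}" using False measure_nonneg [of \<mu> "{a<..b}"] by linarith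
  show ?thesis
  proof (rule field_le_epsilon)
    fix \<epsilon> :: real assume "0 < \<epsilon>"
    with assms(2) pos obtain x where x: "a \<le> x" "x < b" "0 < emeasure \<mu> {x<..}" "measure \<mu> {x<..b} < \<epsilon>"
      by (rule tg.approximate_from_left)
    have a: "0 < emeasure \<mu> {a<..}" using x(1,3) by (rule tg.tail_pos_mono)
    have "measure law {a<..x} \<le> measure law {a<..<b}"
      using x by (intro law.finite_measure_mono) auto
    then show "measure \<mu> {a<..b} \<le> measure law {a<..<b} + \<epsilon>"
      using measure_Ioc_split [OF tg.finite_measure_axioms tg.mu_sets x(1) less_imp_le [OF x(2)]]
        measure_Ioc_split [OF tg.finite_measure_axioms tg.mu_sets assms(1) x(1)] measure_Ioc_split [OF law.finite_measure_axioms law_sets assms(1) x(1)]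
        YT_Ioc [OF assms(1) a] YT_Ioc [of x] x assms by simp
  qed
qed simp

lemma YT_Ioi:
  assumes "0 \<le> a" shows "measure \<mu> {a<..} \<le> measure law {a<..}"
proof -
  interpret law: prob_space law by (rule law_prob)
  have "measure \<mu> {a<..real k} \<le> measure law {a<..}" for k
  proof (cases "a \<le> real k")
    case True
    have "measure \<mu> {a<..real k} \<le> measure law {a<..<real k}" by (rule YT_Ioo [OF assms True])
    also have "\<dots> \<le> measure law {a<..}" by (intro law.finite_measure_mono) auto
    finally show ?thesis .
  qed simp
  moreover have "(\<lambda>k. measure \<mu> {a<..real k}) \<longlonglongrightarrow> measure \<mu> (\<Union>k. {a<..real k})"
    by (rule tg.finite_Lim_measure_incseq) (auto simp: incseq_def)
  moreover have "(\<Union>k. {a<..real k}) = {a<..}" using real_arch_simple by auto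
  ultimately show ?thesis by (intro LIMSEQ_le_const2 [of "\<lambda>k. measure \<mu> {a<..real k}"]) auto
qed

lemma law_mirror: "distr M borel (embedding.YT X z L n (\<lambda>\<epsilon> t. - F \<epsilon> t) (mirror \<mu>)) = mirror law"
proof -
  interpret m: embedding M X z PX L n "\<lambda>\<epsilon> t. - F \<epsilon> t" "mirror \<mu>" by (rule embedding_mirror)
  have "m.T \<omega> = T \<omega>" for \<omega> unfolding m.T_def T_def nu_mirror process_mirror tg.w_mirror by simp
  then have "m.YT = (\<lambda>\<omega>. - YT \<omega>)" by (simp add: fun_eq_iff m.YT_def YT_def process_mirror)
  then show ?thesis unfolding mirror_def by (subst distr_distr) (auto simp: comp_def)
qed

lemma YT_law: "law = \<mu>"
proof -
  interpret m: embedding M X z PX L n "\<lambda>\<epsilon> t. - F \<epsilon> t" "mirror \<mu>" by (rule embedding_mirror)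
  have set_eq: "{x. - x \<in> {a<..}} = {..<-a}" "{x. - x \<in> {0<..a}} = {-a..<0}" "{x. - x \<in> {0<..<a}} = {-a<..<0}" for a :: real
    by auto
  have mir: "measure (mirror N) {a<..} = measure N {..<-a}" "measure (mirror N) {0<..a} = measure N {-a..<0}"
      "measure (mirror N) {0<..<a} = measure N {-a<..<0}" if "sets N = sets borel" for N a
    unfolding measure_def by (simp_all only: emeasure_mirror [OF that] set_eq greaterThan_borel
        greaterThanAtMost_borel greaterThanLessThan_borel)
  show ?thesis
  proof (rule tg.prob_eqI [OF law_prob law_sets])
    fix a :: real assume a: "0 \<le> a"
    show "measure \<mu> {a<..} \<le> measure law {a<..}" by (rule YT_Ioi [OF a])
    show "measure \<mu> {0<..a} \<le> measure law {0<..<a}" by (rule YT_Ioo [OF order_refl a])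
    show "measure \<mu> {..<-a} \<le> measure law {..<-a}"
      using m.YT_Ioi [OF a] unfolding law_mirror mir [OF law_sets] mir [OF tg.mu_sets] .
    show "measure \<mu> {-a..<0} \<le> measure law {-a<..<0}"
      using m.YT_Ioo [OF order_refl a] unfolding law_mirror mir [OF law_sets] mir [OF tg.mu_sets] .
  qed
qed

lemma AE_T_finite: "AE \<omega> in M. T \<omega> < \<infinity>"
  using AE_stops by eventually_elim (auto simp: stops_def)

text \<open>For \<open>0 < r < t\<close> the chain
  \<open>w (FX r) < L r \<le> L t = w (FX t)\<close> holds. A value farther from 0 on the side of
  the stopped value would violate it by monotonicity of \<open>w\<close> on each half-line.\<close>

lemma AE_YT_extremum: "AE \<omega> in M. YT \<omega> =
  (SUP t\<in>{0..enn2real (T \<omega>)}. FX t \<omega>) * indicat_real {\<omega>. YT \<omega> \<ge> 0} \<omega> +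
  (INF t\<in>{0..enn2real (T \<omega>)}. FX t \<omega>) * indicat_real {\<omega>. YT \<omega> < 0} \<omega>"
  using AE_stops AE_good_path X_start
proof eventually_elim
  case (elim \<omega>)
  interpret good_path X z L F \<omega> by fact
  obtain t \<epsilon> where st: "stops \<omega> t \<epsilon>" using elim(1) by blast
  note s = st [unfolded stops_def]
  have t: "0 < t" "enn2real (T \<omega>) = t" using s by auto
  have Y: "YT \<omega> = FX t \<omega>" by (rule YT_stops [OF st])
  have Y0: "FX 0 \<omega> = 0" using elim(3) by (intro Y_zero) auto
  have less: "w (FX r \<omega>) < w (FX t \<omega>)" if "0 < r" "r < t" for r
  proof -
    have "w (FX r \<omega>) < ennreal (L r \<omega>)" using s that by blast
    also have "\<dots> \<le> ennreal (L t \<omega>)" using that by (intro ennreal_leI L_mono) auto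
    also have "\<dots> = w (FX t \<omega>)" using s by simp
    finally show ?thesis .
  qed
  show ?case
  proof (cases "0 \<le> YT \<omega>")
    case True
    have "FX r \<omega> \<le> FX t \<omega>" if "r \<in> {0..t}" for r
    proof -
      consider "r = 0" | "r = t" | "0 < r" "r < t" using \<open>r \<in> {0..t}\<close> by fastforce
      then show ?thesis
      proof cases
        case 3
        show ?thesis
        proof (rule ccontr)
          assume "\<not> FX r \<omega> \<le> FX t \<omega>"
          then have "w (FX t \<omega>) \<le> w (FX r \<omega>)" using True Y by (intro tg.w_mono_pos) auto
          then show False using less [OF 3] by simp
        qed
      qed (use True Y Y0 in auto)
    qed
    then have "(SUP r\<in>{0..t}. FX r \<omega>) = FX t \<omega>"
      using t(1) by (intro cSup_eq_maximum) auto
    then show ?thesis using True Y t by simp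
  next
    case False
    have "FX t \<omega> \<le> FX r \<omega>" if "r \<in> {0..t}" for r
    proof -
      consider "r = 0" | "r = t" | "0 < r" "r < t" using \<open>r \<in> {0..t}\<close> by fastforce
      then show ?thesis
      proof cases
        case 3
        show ?thesis
        proof (rule ccontr)
          assume "\<not> FX t \<omega> \<le> FX r \<omega>"
          then have "w (FX t \<omega>) \<le> w (FX r \<omega>)" using False Y by (intro tg.w_mono_neg) auto
          then show False using less [OF 3] by simp
        qed
      qed (use False Y Y0 in auto)
    qed
    then have "(INF r\<in>{0..t}. FX r \<omega>) = FX t \<omega>"
      using t(1) by (intro cInf_eq_minimum) auto
    then show ?thesis using False Y t by simp
  qed
qed

text \<open>Up to time \<open>T\<close> the level \<open>w (FX t)\<close> stays below \<open>L t\<close>, with equality at \<open>T\<close>. If \<open>S \<le> T\<close> embeds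
  the same law, then \<open>w (FX S) \<le> L S \<le> L T = w (FX T)\<close> has the same law at both ends, so the
  chain consists of equalities and \<open>S\<close> already satisfies the stopping condition.\<close>

lemma T_minimal: "minimal_for M \<F> FX T"
  unfolding minimal_for_def
proof (intro allI impI)
  fix S assume S: "stopping_time \<F> S" and le: "AE \<omega> in M. S \<omega> \<le> T \<omega>"
    and law: "same_law M (\<lambda>\<omega>. FX (enn2real (S \<omega>)) \<omega>) (\<lambda>\<omega>. FX (enn2real (T \<omega>)) \<omega>)"
  define YS where "YS \<omega> = FX (enn2real (S \<omega>)) \<omega>" for \<omega>
  have YS_measurable [measurable]: "YS \<in> borel_measurable M" and law': "distr M borel YS = \<mu>"
    using law YT_law by (simp_all add: same_law_def YS_def [abs_def] YT_def [abs_def])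
  have path: "AE \<omega> in M. w (YS \<omega>) \<le> ennreal (L (enn2real (S \<omega>)) \<omega>) \<and>
      ennreal (L (enn2real (S \<omega>)) \<omega>) \<le> w (YT \<omega>) \<and> w (YT \<omega>) < \<infinity> \<and> S \<omega> < \<infinity> \<and> (S \<omega> = 0 \<longrightarrow> YS \<omega> = 0)"
    using AE_stops AE_good_path X_start le
  proof eventually_elim
    case (elim \<omega>)
    interpret good_path X z L F \<omega> by fact
    obtain t \<epsilon> where st: "stops \<omega> t \<epsilon>" using elim(1) by blast
    note s = st [unfolded stops_def]
    define r where "r = enn2real (S \<omega>)"
    have Y0: "FX 0 \<omega> = 0" using elim(3) by (intro Y_zero) auto
    have "S \<omega> \<le> ennreal t" using elim(4) s by simp
    then have fin: "S \<omega> < \<infinity>" by (rule order.strict_trans1) simp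
    have r: "0 \<le> r" "r \<le> t" using \<open>S \<omega> \<le> ennreal t\<close> s by (auto simp: r_def intro!: enn2real_leI)
    consider "r = 0" | "r = t" | "0 < r" "r < t" using r by fastforce
    then have "w (FX r \<omega>) \<le> ennreal (L r \<omega>)"
    proof cases
      case 1 then show ?thesis by (simp add: Y0 tg.w_0)
    next
      case 2 then show ?thesis using s by simp
    next
      case 3 then show ?thesis using s by (blast intro: less_imp_le)
    qed
    moreover have "ennreal (L r \<omega>) \<le> w (YT \<omega>)"
      using s L_mono [OF r] YT_stops [OF st] by (simp add: ennreal_leI)
    moreover have "w (YT \<omega>) < \<infinity>" using s YT_stops [OF st] by simp
    moreover have "S \<omega> = 0 \<longrightarrow> YS \<omega> = 0" using Y0 by (simp add: YS_def)
    ultimately show ?case using fin by (simp add: YS_def r_def)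
  qed
  \<comment> \<open>This excludes \<open>S = 0\<close>, which matters because the infimum defining
    \<open>T\<close> runs over positive times only.\<close>
  have YS_nonzero: "AE \<omega> in M. YS \<omega> \<noteq> 0"
  proof -
    have "AE x in distr M borel YS. x \<noteq> 0" unfolding law' by (rule tg.AE_nonzero)
    then show ?thesis by (subst (asm) AE_distr_iff) auto
  qed
  \<comment> \<open>\<open>w\<close> need not be integrable, so equal laws are compared through a
    bounded decreasing function of it.\<close>
  let ?f = "\<lambda>y. exp (- enn2real (w y))"
  have eq: "AE \<omega> in M. ?f (YS \<omega>) - ?f (YT \<omega>) = 0"
  proof -
    have int: "integrable M (\<lambda>\<omega>. ?f (Z \<omega>))" if [measurable]: "Z \<in> borel_measurable M" for Z
    proof (rule integrable_const_bound)
      show "AE \<omega> in M. norm (?f (Z \<omega>)) \<le> 1" by (rule AE_I2) simp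
    qed measurable
    have [measurable]: "?f \<in> borel_measurable borel" by measurable
    have "(LINT x|distr M borel YT. ?f x) = (LINT \<omega>|M. ?f (YT \<omega>))"
      by (rule integral_distr) measurable
    moreover have "(LINT x|distr M borel YS. ?f x) = (LINT \<omega>|M. ?f (YS \<omega>))"
      by (rule integral_distr) measurable
    ultimately have "(LINT \<omega>|M. ?f (YS \<omega>) - ?f (YT \<omega>)) = 0"
      using int [OF YT_measurable] int [OF YS_measurable] unfolding law' YT_law
      by (subst Bochner_Integration.integral_diff) simp_all
    moreover have "AE \<omega> in M. 0 \<le> ?f (YS \<omega>) - ?f (YT \<omega>)"
      using path
    proof eventually_elim
      case (elim \<omega>)
      then have "w (YS \<omega>) \<le> w (YT \<omega>)" by (meson order_trans)
      then have "enn2real (w (YS \<omega>)) \<le> enn2real (w (YT \<omega>))" using elim by (intro enn2real_mono) auto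
      then show ?case by simp
    qed
    moreover have "integrable M (\<lambda>\<omega>. ?f (YS \<omega>) - ?f (YT \<omega>))"
      by (intro Bochner_Integration.integrable_diff int YT_measurable YS_measurable)
    ultimately show ?thesis using integral_nonneg_eq_0_iff_AE by blast
  qed
  show "AE \<omega> in M. S \<omega> = T \<omega>"
    using path eq YS_nonzero le
  proof eventually_elim
    case (elim \<omega>)
    have "enn2real (w (YT \<omega>)) = enn2real (w (YS \<omega>))" using elim(2) by simp
    moreover have "w (YS \<omega>) < \<infinity>" using elim(1) by (meson order.strict_trans1)
    ultimately have weq: "w (YT \<omega>) = w (YS \<omega>)" using elim(1)
      by (metis ennreal_enn2real infinity_ennreal_def)
    have "S \<omega> = ennreal (enn2real (S \<omega>))" "S \<omega> \<noteq> 0" using elim(1,3) by auto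
    then have "0 < enn2real (S \<omega>)" by (metis enn2real_nonneg ennreal_0 less_le)
    moreover have "ennreal (L (enn2real (S \<omega>)) \<omega>) \<le> w (FX (enn2real (S \<omega>)) \<omega>)"
      using elim(1) weq by (simp add: YS_def)
    ultimately have "T \<omega> \<le> ennreal (enn2real (S \<omega>))"
      unfolding T_def by (intro Inf_lower) blast
    then show ?case using elim(4) \<open>S \<omega> = ennreal (enn2real (S \<omega>))\<close> by (simp add: antisym)
  qed
qed

end

theorem theorem1:
  fixes M :: "'a measure"
    and X :: "real \<Rightarrow> 'a \<Rightarrow> 'e::polish_space" and z :: 'e
    and PX :: "'e \<Rightarrow> (real \<Rightarrow> 'e) measure"
    and L :: "real \<Rightarrow> 'a \<Rightarrow> real"
    and n :: "(real \<Rightarrow> 'e) measure"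
    and F :: "(real \<Rightarrow> 'e) \<Rightarrow> real \<Rightarrow> real"
    and \<mu> :: "real measure"
  defines "n\<^sub>F \<equiv> functional_measure z n F"
    and "\<F> \<equiv> usual_filtration M X"
    and "Y \<equiv> functional_process X z L F"
  defines "\<psi>\<^sub>p \<equiv> psi_plus \<mu> n\<^sub>F"
    and "\<psi>\<^sub>m \<equiv> psi_minus \<mu> n\<^sub>F"
  defines "T \<equiv> embedding_time \<psi>\<^sub>m \<psi>\<^sub>p Y L"
  defines "Y\<^sub>T \<equiv> \<lambda>\<omega>. Y (enn2real (T \<omega>)) \<omega>"
  assumes functional: "excursion_functional M X z PX L n F"
    and \<mu>_prob: "prob_space \<mu>" and \<mu>_sets: "sets \<mu> = sets borel"
    and \<mu>_nonatomic: "\<And>x. emeasure \<mu> {x} = 0"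
    and \<mu>_neg: "emeasure \<mu> {..0} > 0" and \<mu>_pos: "emeasure \<mu> {0..} > 0"
    and support: "\<And>x y. x \<in> measure_support \<mu> \<Longrightarrow> y \<in> measure_support \<mu> \<Longrightarrow>
      emeasure n\<^sub>F {..x} * emeasure n\<^sub>F {y..} > 0"
    and balance: "D_fun \<mu> n\<^sub>F \<infinity> = G_fun \<mu> n\<^sub>F (- \<infinity>)"
  shows "(\<forall>\<omega>\<in>space M. T \<omega> = Inf {ennreal t | t. 0 < t \<and>
            ereal (Y t \<omega>) \<notin> {- phi_of \<psi>\<^sub>m (L t \<omega>) <..< phi_of \<psi>\<^sub>p (L t \<omega>)}}) \<and>
         stopping_time \<F> T \<and>
         (AE \<omega> in M. T \<omega> < \<infinity>) \<and>
         (Y\<^sub>T \<in> borel_measurable M \<and> distr M borel Y\<^sub>T = \<mu>) \<and>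
         minimal_for M \<F> Y T \<and>
         (AE \<omega> in M. Y\<^sub>T \<omega> =
            (SUP t\<in>{0..enn2real (T \<omega>)}. Y t \<omega>) * indicat_real {\<omega>. Y\<^sub>T \<omega> \<ge> 0} \<omega> +
            (INF t\<in>{0..enn2real (T \<omega>)}. Y t \<omega>) * indicat_real {\<omega>. Y\<^sub>T \<omega> < 0} \<omega>)"
proof -
  interpret f: excursion_functional M X z PX L n F by (rule functional)
  have "target_axioms \<mu> (functional_measure z n F)"
    using \<mu>_sets f.sets_nu f.nu_sigma_finite \<mu>_nonatomic support f.nu_tails
    unfolding n\<^sub>F_def by (intro target_axioms.intro)
  then have "embedding M X z PX L n F \<mu>"
    by (intro embedding.intro functional target.intro \<mu>_prob)
  then interpret e: embedding M X z PX L n F \<mu> .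
  \<comment> \<open>\<open>le_w\<close> merges the two alternatives of \<open>embedding_time\<close>
    into one condition on \<open>w\<close>.\<close>
  have T_eq: "T = e.T"
    unfolding T_def \<psi>\<^sub>m_def \<psi>\<^sub>p_def n\<^sub>F_def Y_def
    by (simp add: fun_eq_iff embedding_time_def e.T_def e.tg.le_w)
  have YT_eq: "Y\<^sub>T = e.YT"
    unfolding Y\<^sub>T_def T_eq Y_def by (simp add: fun_eq_iff e.YT_def)
  have "\<forall>\<omega>\<in>space M. T \<omega> = Inf {ennreal t | t. 0 < t \<and>
      ereal (Y t \<omega>) \<notin> {- phi_of \<psi>\<^sub>m (L t \<omega>) <..< phi_of \<psi>\<^sub>p (L t \<omega>)}}"
    unfolding T_eq e.T_def \<psi>\<^sub>m_def \<psi>\<^sub>p_def n\<^sub>F_def Y_def e.tg.level_iff_phi by simp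
  moreover have "stopping_time \<F> T" unfolding T_eq \<F>_def by (rule e.T_stopping)
  moreover have "AE \<omega> in M. T \<omega> < \<infinity>" unfolding T_eq by (rule e.AE_T_finite)
  moreover have "Y\<^sub>T \<in> borel_measurable M \<and> distr M borel Y\<^sub>T = \<mu>"
    unfolding YT_eq by (intro conjI e.YT_measurable e.YT_law)
  moreover have "minimal_for M \<F> Y T" unfolding T_eq \<F>_def Y_def by (rule e.T_minimal)
  moreover have "AE \<omega> in M. Y\<^sub>T \<omega> =
      (SUP t\<in>{0..enn2real (T \<omega>)}. Y t \<omega>) * indicat_real {\<omega>. Y\<^sub>T \<omega> \<ge> 0} \<omega> +
      (INF t\<in>{0..enn2real (T \<omega>)}. Y t \<omega>) * indicat_real {\<omega>. Y\<^sub>T \<omega> < 0} \<omega>"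
    unfolding T_eq YT_eq Y_def by (rule e.AE_YT_extremum)
  ultimately show ?thesis by blast
qed

end
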